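(* Let $D$ be a domain in $\mathbb{C}^{n}$, let $u \in \mathrm{Psh}(D) \cap C^{0}(D)$, let $k \in \{1, \ldots, n-1\}$ and let $r \in \mathbb{R}$. Put $\overline{B}_{u}(r) = \{z \in D : u(z) \leq r\}$ and $S_{u}(r) = \{z \in D : u(z) = r\}$. Assume that $(dd^{c}u)^{k} = 0$ in $D$ and that $\overline{B}_{u}(r)$ is convex. Then any point of $S_{u}(r)$ lies in the relative interior of a complex $(n-k)$-dimensional convex set contained in $S_{u}(r)$.
   Context: $\mathrm{Psh}(D)$ denotes the set of plurisubharmonic functions in $D$, and $C^{0}(D)$ the continuous real-valued functions on $D$. For $u \in \mathrm{Psh}(D)\cap C^0(D)$, $(dd^{c}u)^{k}$ is the Monge-Ampère current in the sense of Bedford and Taylor ($dd^c$ is a positive constant multiple of $\sqrt{-1}\,\partial\bar\partial$). A complex $m$-dimensional convex set is a convex set in $\mathbb{C}^{n}$ whose (real) affine hull is a complex $m$-dimensional affine subspace of $\mathbb{C}^{n}$; its relative interior is its interior relative to its affine hull. *)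

theory Defs
  imports "HOL-Analysis.Analysis"
begin

section \<open>Plurisubharmonic functions\<close>

text \<open>The mean of \<open>v\<close> over the circle \<open>z + exp(i t) w\<close>. For upper semicontinuous \<open>v < \<infinity>\<close> the
  integral of the positive part is finite, so the difference is well defined in \<open>[-\<infinity>, \<infinity>)\<close>.\<close>

definition circle_mean :: "(complex^'n \<Rightarrow> ereal) \<Rightarrow> complex^'n \<Rightarrow> complex^'n \<Rightarrow> ereal" where
  "circle_mean v z w = ereal (1 / (2 * pi)) *
     (enn2ereal (\<integral>\<^sup>+t\<in>{0..2 * pi}. e2ennreal (v (z + cis t *s w)) \<partial>lborel)
    - enn2ereal (\<integral>\<^sup>+t\<in>{0..2 * pi}. e2ennreal (- v (z + cis t *s w)) \<partial>lborel))"

definition plurisubharmonic_on :: "(complex^'n) set \<Rightarrow> (complex^'n \<Rightarrow> ereal) \<Rightarrow> bool" where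
  "plurisubharmonic_on D v \<longleftrightarrow>
     (\<forall>z\<in>D. v z < \<infinity>) \<and>
     (\<forall>c. openin (top_of_set D) {z \<in> D. v z < c}) \<and>
     (\<forall>z w. (\<forall>\<zeta>. cmod \<zeta> \<le> 1 \<longrightarrow> z + \<zeta> *s w \<in> D) \<longrightarrow> v z \<le> circle_mean v z w)"

section \<open>Real differential forms\<close>

text \<open>A covector of degree \<open>p\<close> is an alternating real-multilinear function of \<open>p\<close> vectors, encoded as
  a function on lists that vanishes on lists of any other length. A differential form assigns a
  covector to every point.\<close>

type_synonym 'a dform = "'a \<Rightarrow> 'a list \<Rightarrow> real"

definition alt_covector :: "nat \<Rightarrow> ('a::real_vector list \<Rightarrow> real) \<Rightarrow> bool" where
  "alt_covector p \<omega> \<longleftrightarrow>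
     (\<forall>vs. length vs \<noteq> p \<longrightarrow> \<omega> vs = 0) \<and>
     (\<forall>vs i. length vs = p \<longrightarrow> i < p \<longrightarrow> linear (\<lambda>v. \<omega> (vs[i := v]))) \<and>
     (\<forall>vs. length vs = p \<longrightarrow> \<not> distinct vs \<longrightarrow> \<omega> vs = 0)"

primrec iter_dir_deriv :: "('a::real_normed_vector \<Rightarrow> real) \<Rightarrow> 'a list \<Rightarrow> 'a \<Rightarrow> real" where
  "iter_dir_deriv f [] = f"
| "iter_dir_deriv f (v # vs) = (\<lambda>x. frechet_derivative (iter_dir_deriv f vs) (at x) v)"

definition smooth_fun :: "('a::real_normed_vector \<Rightarrow> real) \<Rightarrow> bool" where
  "smooth_fun f \<longleftrightarrow> (\<forall>vs x. iter_dir_deriv f vs differentiable at x)"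

definition form_support :: "'a::topological_space dform \<Rightarrow> 'a set" where
  "form_support \<phi> = closure {z. \<exists>vs. \<phi> z vs \<noteq> 0}"

definition cont_test_forms :: "'a::euclidean_space set \<Rightarrow> nat \<Rightarrow> 'a dform set" where
  "cont_test_forms D p = {\<phi>. (\<forall>z. alt_covector p (\<phi> z)) \<and>
     (\<forall>vs. continuous_on UNIV (\<lambda>z. \<phi> z vs)) \<and>
     compact (form_support \<phi>) \<and> form_support \<phi> \<subseteq> D}"

definition smooth_test_forms :: "'a::euclidean_space set \<Rightarrow> nat \<Rightarrow> 'a dform set" where
  "smooth_test_forms D p = {\<phi> \<in> cont_test_forms D p. \<forall>vs. smooth_fun (\<lambda>z. \<phi> z vs)}"

definition ext_deriv :: "'a::real_normed_vector dform \<Rightarrow> 'a dform" where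
  "ext_deriv \<phi> z vs = (\<Sum>i<length vs. (- 1) ^ i *
     frechet_derivative (\<lambda>x. \<phi> x (take i vs @ drop (Suc i) vs)) (at z) (vs ! i))"

text \<open>The real operator \<open>d\<^sup>c = J\<inverse> d J\<close>, where \<open>(J \<phi>)(v\<^sub>1, \<dots>, v\<^sub>p) = \<phi>(i v\<^sub>1, \<dots>, i v\<^sub>p)\<close>. Since \<open>J\<close>
  multiplies forms of bidegree \<open>(p, q)\<close> by \<open>i\<close> to the power \<open>p - q\<close>, this is \<open>i (\<partial>bar - \<partial>)\<close>, so that
  \<open>dd\<^sup>c = 2 i \<partial> \<partial>bar\<close>.\<close>

definition pull_mult :: "complex \<Rightarrow> (complex^'n) dform \<Rightarrow> (complex^'n) dform" where
  "pull_mult c \<phi> z vs = \<phi> z (map (\<lambda>v. c *s v) vs)"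

definition dc_deriv :: "(complex^'n) dform \<Rightarrow> (complex^'n) dform" where
  "dc_deriv \<phi> = pull_mult (- \<i>) (ext_deriv (pull_mult \<i> \<phi>))"

definition ddc :: "(complex^'n) dform \<Rightarrow> (complex^'n) dform" where
  "ddc \<phi> = ext_deriv (dc_deriv \<phi>)"

section \<open>Currents and the Monge-Ampere operator\<close>

text \<open>A current of dimension \<open>p\<close> and order \<open>0\<close> in \<open>D\<close>: a linear functional on the continuous compactly
  supported \<open>p\<close>-forms that is bounded in the sup norm on forms supported in a fixed compact subset
  (equivalently, a current with measure coefficients). Its values on other arguments are
  irrelevant.\<close>

definition order0_current ::
    "'a::euclidean_space set \<Rightarrow> nat \<Rightarrow> ('a dform \<Rightarrow> real) \<Rightarrow> bool" where
  "order0_current D p T \<longleftrightarrow>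
     (\<forall>\<phi>\<in>cont_test_forms D p. \<forall>\<psi>\<in>cont_test_forms D p. \<forall>a b.
        T (\<lambda>z vs. a * \<phi> z vs + b * \<psi> z vs) = a * T \<phi> + b * T \<psi>) \<and>
     (\<forall>K. compact K \<longrightarrow> K \<subseteq> D \<longrightarrow> (\<exists>C. \<forall>\<phi>\<in>cont_test_forms D p. \<forall>M.
        form_support \<phi> \<subseteq> K \<longrightarrow> (\<forall>z vs. (\<forall>v\<in>set vs. norm v \<le> 1) \<longrightarrow> \<bar>\<phi> z vs\<bar> \<le> M) \<longrightarrow>
        \<bar>T \<phi>\<bar> \<le> C * M))"

text \<open>The positively oriented frame \<open>e\<^sub>1, i e\<^sub>1, \<dots>, e\<^sub>n, i e\<^sub>n\<close>. The order of the coordinates does not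
  affect the value of a \<open>2n\<close>-covector on it, because exchanging two pairs is an even
  permutation.\<close>

definition std_frame :: "(complex^'n::finite) list" where
  "std_frame = concat (map (\<lambda>j. [axis j 1, axis j \<i>]) (SOME js. distinct js \<and> set js = UNIV))"

definition integrate_top_form :: "(complex^'n::finite) dform \<Rightarrow> real" where
  "integrate_top_form \<phi> = (LINT z|lborel. \<phi> z std_frame)"

text \<open>\<open>MA_current D u k T\<close> says that \<open>T\<close> is the Bedford-Taylor current \<open>(dd\<^sup>c u)\<^sup>k\<close> in \<open>D\<close>, for \<open>k \<le> n\<close>
  and \<open>u\<close> continuous and plurisubharmonic in the open set \<open>D\<close>: recursively
  \<open>(dd\<^sup>c u)\<^sup>0 = 1\<close>, and \<open>(dd\<^sup>c u)\<^sup>k\<^sup>+\<^sup>1 = dd\<^sup>c (u (dd\<^sup>c u)\<^sup>k)\<close> is the current of order \<open>0\<close> with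
  \<open>\<langle>(dd\<^sup>c u)\<^sup>k\<^sup>+\<^sup>1, \<phi>\<rangle> = \<langle>(dd\<^sup>c u)\<^sup>k, u dd\<^sup>c \<phi>\<rangle>\<close> for smooth test forms \<open>\<phi>\<close>. The form
  \<open>u dd\<^sup>c \<phi>\<close> is only continuous, which is why order \<open>0\<close> is needed at each step. By Bedford and
  Taylor such a \<open>T\<close> exists, and by density of smooth forms its values on
  \<open>cont_test_forms D (2 * (n - k))\<close> are unique.

  All real forms of degree \<open>2 (n - k)\<close> are admitted as test forms; those without component of
  bidegree \<open>(n - k, n - k)\<close> are annihilated.\<close>

primrec MA_current :: "(complex^'n::finite) set \<Rightarrow> (complex^'n \<Rightarrow> real) \<Rightarrow> nat \<Rightarrow>
    ((complex^'n) dform \<Rightarrow> real) \<Rightarrow> bool" where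
  "MA_current D u 0 T \<longleftrightarrow>
     order0_current D (2 * CARD('n)) T \<and>
     (\<forall>\<phi>\<in>cont_test_forms D (2 * CARD('n)). T \<phi> = integrate_top_form \<phi>)"
| "MA_current D u (Suc k) T \<longleftrightarrow>
     order0_current D (2 * (CARD('n) - Suc k)) T \<and>
     (\<exists>S. MA_current D u k S \<and>
        (\<forall>\<phi>\<in>smooth_test_forms D (2 * (CARD('n) - Suc k)). T \<phi> = S (\<lambda>z vs. u z * ddc \<phi> z vs)))"

section \<open>Complex-dimensional convex sets\<close>

definition complex_affine_subspace :: "nat \<Rightarrow> (complex^'n) set \<Rightarrow> bool" where
  "complex_affine_subspace m A \<longleftrightarrow>
     (\<exists>a L. vec.subspace L \<and> vec.dim L = m \<and> A = (+) a ` L)"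

definition complex_dim_convex :: "nat \<Rightarrow> (complex^'n) set \<Rightarrow> bool" where
  "complex_dim_convex m C \<longleftrightarrow> convex C \<and> complex_affine_subspace m (affine hull C)"

end

theory Submission
  imports Defs
begin

text \<open>
  If \<open>p\<close> lies in the relative interior of a slice of the sublevel set \<open>B\<close> by a complex affine
  subspace, the maximum principle makes \<open>u\<close> constant near \<open>p\<close> on that slice; such slices are
  spanned by the largest complex subspace \<open>L\<close> of the space of directions in which \<open>B\<close> contains
  a segment around \<open>p\<close>. So it has to be shown that \<open>L\<close> has dimension at least \<open>n - k\<close>.

  Otherwise there are \<open>n - k\<close> independent linear functionals, among them the complexification of
  a supporting functional of \<open>B\<close> at \<open>p\<close>, whose common zero space \<open>N\<close> meets \<open>L\<close> only in \<open>0\<close>.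
  On \<open>p + N\<close> one has \<open>u \<ge> u(p)\<close>, with equality exactly on \<open>B\<close>. As the face of \<open>B \<inter> (p + N)\<close> at \<open>p\<close>
  contains no complex line, some pluriharmonic quadratic polynomial is positive at \<open>p\<close> and
  negative on the contact set in a shell around \<open>p\<close>: if not, separation would yield points
  \<open>x\<^sub>i\<close> of the contact set (translated by \<open>- p\<close>) and weights with
  \<open>\<Sum>\<mu>\<^sub>i x\<^sub>i = 0\<close> and \<open>\<Sum>\<mu>\<^sub>i x\<^sub>i \<otimes> x\<^sub>i = 0\<close>, which forces a complex line. A small multiple of
  this polynomial, made strictly plurisubharmonic in one direction, lies above \<open>u\<close> at \<open>p\<close> and
  below \<open>u\<close> on the shell, up to a multiple of the squared functionals defining \<open>N\<close>.

  Let \<open>\<beta>\<close> be the product of the forms \<open>i d\<ell> \<and> d\<ell>bar\<close> over the functionals \<open>\<ell>\<close> defining \<open>N\<close>, so that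
  \<open>(dd\<^sup>c u)\<^sup>k \<and> \<beta> = 0\<close>. Gluing \<open>u\<close> with the polynomial and using positivity of
  \<open>dd\<^sup>c w \<and> (dd\<^sup>c u)\<^sup>m \<and> \<dots>\<close> for plurisubharmonic \<open>w\<close>, the factors \<open>dd\<^sup>c u\<close> can be exchanged near \<open>p\<close>, one
  after the other, for forms \<open>i d\<ell> \<and> d\<ell>bar\<close> with further functionals \<open>\<ell>\<close>. In the end a positive
  multiple of Lebesgue measure vanishes near \<open>p\<close>, a contradiction.
\<close>

section \<open>Constant covectors\<close>

text \<open>The obstacle is that \<open>u\<close> is only continuous, so dd^c u and its powers never
  appear as forms. A power is a functional, and all that can be done with it is to move dd^c from
  one factor of a test form to the other and to pass to uniform limits by the order 0 bound. Wedging
  with \<beta> therefore means evaluating only on test forms \<open>cform f (sigs as)\<close>, and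
  positivity is tested on these alone. No comparison principle for Monge-Ampere measures is used: a
  factor is exchanged by a balance of masses between two functions that agree wherever the cutoff is
  not constant. The comparison polynomial is pluriharmonic up to a term \<epsilon>|\<ell>|^2, so
  that its dd^c is a multiple of the single form i d\<ell> \<and> d\<ell>bar, with \<ell> prescribed
  in advance. Hence one basis of functionals can be fixed at the start: its last n - k entries
  define N, its first k entries replace the factors dd^c u. Since the last entries are factors of
  every product that occurs, dd^c of the penalty built from their squares is annihilated, and the
  comparison can be made on a full shell instead of inside p + N.\<close>

text \<open>The wedge product of the 1-form v \<mapsto> v \<bullet> a with \<open>\<Gamma>\<close>;
  vectors stand for real 1-forms through the inner product. The alternating sum over the omitted
  vector is the one in \<open>ext_deriv\<close>, so that d of a function times a constant covector
  becomes a combination of \<open>wedge1\<close> terms.\<close>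

definition wedge1 :: "'a::real_inner \<Rightarrow> ('a list \<Rightarrow> real) \<Rightarrow> 'a list \<Rightarrow> real" where
  "wedge1 a \<Gamma> vs = (\<Sum>i<length vs. (- 1) ^ i * (vs ! i \<bullet> a) * \<Gamma> (take i vs @ drop (Suc i) vs))"

lemma wedge1_Nil [simp]: "wedge1 a \<Gamma> [] = 0"
  by (simp add: wedge1_def)

lemma wedge1_Cons:
  "wedge1 a \<Gamma> (v # vs) = (v \<bullet> a) * \<Gamma> vs - wedge1 a (\<lambda>us. \<Gamma> (v # us)) vs"
  by (simp add: wedge1_def sum.lessThan_Suc_shift sum_negf[symmetric] del: sum.lessThan_Suc)

lemma wedge1_linear_form:
  "wedge1 a (\<lambda>vs. s * \<Gamma> vs + t * \<Delta> vs) vs = s * wedge1 a \<Gamma> vs + t * wedge1 a \<Delta> vs"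
  by (simp add: wedge1_def sum_distrib_left sum.distrib[symmetric] algebra_simps)

lemma wedge1_uminus: "wedge1 a (\<lambda>vs. - \<Gamma> vs) vs = - wedge1 a \<Gamma> vs"
  using wedge1_linear_form[of a "-1" \<Gamma> 0 \<Gamma> vs] by simp

lemma wedge1_scale: "wedge1 a (\<lambda>vs. s * \<Gamma> vs) vs = s * wedge1 a \<Gamma> vs"
  using wedge1_linear_form[of a s \<Gamma> 0 \<Gamma> vs] by simp

lemma wedge1_diff: "wedge1 a (\<lambda>vs. \<Gamma> vs - \<Delta> vs) vs = wedge1 a \<Gamma> vs - wedge1 a \<Delta> vs"
  using wedge1_linear_form[of a 1 \<Gamma> "-1" \<Delta> vs] by simp

lemma wedge1_add: "wedge1 a (\<lambda>vs. \<Gamma> vs + \<Delta> vs) vs = wedge1 a \<Gamma> vs + wedge1 a \<Delta> vs"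
  using wedge1_linear_form[of a 1 \<Gamma> 1 \<Delta> vs] by simp

lemma wedge1_zero [simp]: "wedge1 a (\<lambda>vs. 0) = (\<lambda>vs. 0)"
  by (simp add: wedge1_def fun_eq_iff)

lemma linear_wedge1_left: "linear (\<lambda>a. wedge1 a \<Gamma> vs)"
  by (rule linearI) (simp_all add: wedge1_def inner_simps sum.distrib sum_distrib_left algebra_simps)

lemmas wedge1_left_simps =
  linear_add[OF linear_wedge1_left] linear_diff[OF linear_wedge1_left]
  linear_scale[OF linear_wedge1_left] linear_neg[OF linear_wedge1_left]
  linear_0[OF linear_wedge1_left] linear_sum[OF linear_wedge1_left]

lemma wedge1_anticommute: "wedge1 a (wedge1 b \<Gamma>) vs = - wedge1 b (wedge1 a \<Gamma>) vs"
proof (induction vs arbitrary: \<Gamma>)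
  case (Cons v vs)
  \<comment> \<open>The first two terms together are antisymmetric in x and y; the last one is
    covered by the induction hypothesis for the contraction of \<open>\<Gamma>\<close> with
    v.\<close>
  have "wedge1 x (wedge1 y \<Gamma>) (v # vs) = (v \<bullet> x) * wedge1 y \<Gamma> vs - (v \<bullet> y) * wedge1 x \<Gamma> vs
        + wedge1 x (wedge1 y (\<lambda>us. \<Gamma> (v # us))) vs" for x y
    by (simp add: wedge1_Cons wedge1_diff wedge1_scale)
  then show ?case using Cons.IH[of "\<lambda>us. \<Gamma> (v # us)"] by simp
qed simp

lemma wedge1_self [simp]: "wedge1 a (wedge1 a \<Gamma>) = (\<lambda>vs. 0)"
  using wedge1_anticommute[of a a \<Gamma>] by (simp add: fun_eq_iff)

text \<open>A description of \<open>alt_covector\<close> by adjacent transpositions, suited to induction on lists.\<close>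

definition alternating :: "nat \<Rightarrow> ('a::real_vector list \<Rightarrow> real) \<Rightarrow> bool" where
  "alternating p \<Gamma> \<longleftrightarrow> (\<forall>vs. length vs \<noteq> p \<longrightarrow> \<Gamma> vs = 0) \<and>
     (\<forall>us. linear (\<lambda>v. \<Gamma> (v # us))) \<and>
     (\<forall>us x y ws. \<Gamma> (us @ x # y # ws) = - \<Gamma> (us @ y # x # ws))"

lemma alternatingD:
  assumes "alternating p \<Gamma>"
  shows "length vs \<noteq> p \<Longrightarrow> \<Gamma> vs = 0" "linear (\<lambda>v. \<Gamma> (v # us))"
    "\<Gamma> (us @ x # y # ws) = - \<Gamma> (us @ y # x # ws)"
  using assms unfolding alternating_def by blast+

lemma alternating_move_front:
  assumes "alternating p \<Gamma>"
  shows "\<Gamma> (us @ v # ws) = (- 1) ^ length us * \<Gamma> (v # us @ ws)"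
proof (induction us arbitrary: ws rule: rev_induct)
  case (snoc x us)
  then show ?case using alternatingD(3)[OF assms, of us x v ws] by simp
qed simp

lemma alternating_imp_alt_covector:
  assumes "alternating p \<Gamma>"
  shows "alt_covector p \<Gamma>"
  unfolding alt_covector_def
proof (intro conjI allI impI)
  fix vs :: "'a list"
  show "length vs \<noteq> p \<Longrightarrow> \<Gamma> vs = 0" using alternatingD(1)[OF assms] .
next
  fix vs :: "'a list" and i assume "length vs = p" "i < p"
  then have "\<Gamma> (vs[i := v]) = (- 1) ^ i * \<Gamma> (v # take i vs @ drop (Suc i) vs)" for v
    using alternating_move_front[OF assms, of "take i vs" v "drop (Suc i) vs"]
    by (simp add: upd_conv_take_nth_drop)
  moreover have "linear (\<lambda>v. (- 1) ^ i * \<Gamma> (v # take i vs @ drop (Suc i) vs))"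
    using linear_compose_scale_right[OF alternatingD(2)[OF assms], of "(-1)^i"] by simp
  ultimately show "linear (\<lambda>v. \<Gamma> (vs[i := v]))" by simp
next
  fix vs :: "'a list" assume "length vs = p" "\<not> distinct vs"
  then obtain us ws zs x where vs: "vs = us @ [x] @ ws @ [x] @ zs" using not_distinct_decomp by blast
  have "\<Gamma> vs = (- 1) ^ length us * \<Gamma> ((x # us @ ws) @ x # zs)"
    using alternating_move_front[OF assms, of us x "ws @ x # zs"] by (simp add: vs)
  also have "\<Gamma> ((x # us @ ws) @ x # zs) = (- 1) ^ length (x # us @ ws) * \<Gamma> (x # x # us @ ws @ zs)"
    using alternating_move_front[OF assms, of "x # us @ ws" x zs] by simp
  \<comment> \<open>Exchanging the two copies of x changes the sign but not the list.\<close>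
  also have "\<Gamma> (x # x # us @ ws @ zs) = 0"
    using alternatingD(3)[OF assms, of "[]" x x] by (simp del: append.simps(2))
  finally show "\<Gamma> vs = 0" by simp
qed

lemma alternating_wedge1:
  assumes "alternating p \<Gamma>"
  shows "alternating (Suc p) (wedge1 a \<Gamma>)"
  unfolding alternating_def
proof (intro conjI allI impI)
  fix vs :: "'a list" assume "length vs \<noteq> Suc p"
  then have "length (take i vs @ drop (Suc i) vs) \<noteq> p" if "i < length vs" for i
    using that by auto
  then show "wedge1 a \<Gamma> vs = 0"
    unfolding wedge1_def using alternatingD(1)[OF assms] by (intro sum.neutral) auto
next
  fix us :: "'a list"
  have "linear (\<lambda>v. wedge1 a (\<lambda>ws. \<Gamma> (v # ws)) us)"
    by (intro linearI) (simp_all add: linear_add[OF alternatingD(2)[OF assms]]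
      linear_scale[OF alternatingD(2)[OF assms]] wedge1_add wedge1_scale)
  moreover have "linear (\<lambda>v. (v \<bullet> a) * \<Gamma> us)"
    by (rule linearI) (simp_all add: inner_simps algebra_simps)
  ultimately show "linear (\<lambda>v. wedge1 a \<Gamma> (v # us))"
    unfolding wedge1_Cons by (intro linear_compose_sub)
next
  fix us ws :: "'a list" and x y
  have "\<forall>us x y ws. \<Gamma> (us @ x # y # ws) = - \<Gamma> (us @ y # x # ws)"
    using assms unfolding alternating_def by blast
  then show "wedge1 a \<Gamma> (us @ x # y # ws) = - wedge1 a \<Gamma> (us @ y # x # ws)"
  proof (induction us arbitrary: \<Gamma>)
    case Nil
    have "(\<lambda>us. \<Gamma> (x # y # us)) = (\<lambda>us. - \<Gamma> (y # x # us))"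
      using Nil.prems[rule_format, of "[]" x y] by auto
    then show ?case by (simp add: wedge1_Cons wedge1_uminus)
  next
    case (Cons v us)
    have "wedge1 a (\<lambda>us. \<Gamma> (v # us)) (us @ x # y # ws) = - wedge1 a (\<lambda>us. \<Gamma> (v # us)) (us @ y # x # ws)"
      by (rule Cons.IH) (metis Cons.prems append_Cons)
    then show ?case using Cons.prems[rule_format, of us x y ws] by (simp add: wedge1_Cons)
  qed
qed

text \<open>Linearity reduces the first slot to basis vectors, and each slice
  \<open>\<Gamma> (b # us)\<close> is alternating of one degree less. The bound translates the sup
  norm of a form in \<open>order0_current\<close> into the sup norm of a coefficient
  function.\<close>

lemma alternating_bounded:
  fixes \<Gamma> :: "'a::euclidean_space list \<Rightarrow> real"
  assumes "alternating p \<Gamma>"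
  shows "\<exists>C\<ge>0. \<forall>vs. (\<forall>v\<in>set vs. norm v \<le> 1) \<longrightarrow> \<bar>\<Gamma> vs\<bar> \<le> C"
  using assms
proof (induction p arbitrary: \<Gamma>)
  case 0
  then have "\<bar>\<Gamma> vs\<bar> \<le> \<bar>\<Gamma> []\<bar>" for vs using alternatingD(1)[OF 0, of vs] by (cases vs) auto
  then show ?case by (intro exI[of _ "\<bar>\<Gamma> []\<bar>"]) auto
next
  case (Suc p)
  have alt: "alternating p (\<lambda>us. \<Gamma> (b # us))" for b
    unfolding alternating_def
  proof (intro conjI allI impI)
    fix vs :: "'a list" assume "length vs \<noteq> p" then show "\<Gamma> (b # vs) = 0"
      using alternatingD(1)[OF Suc.prems] by simp
  next
    fix us :: "'a list"
    have "\<Gamma> (b # v # us) = - \<Gamma> (v # b # us)" for v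
      using alternatingD(3)[OF Suc.prems, of "[]" b v us] by simp
    then show "linear (\<lambda>v. \<Gamma> (b # v # us))"
      using linear_compose_neg[OF alternatingD(2)[OF Suc.prems, of "b # us"]] by simp
  next
    fix us ws :: "'a list" and x y
    show "\<Gamma> (b # us @ x # y # ws) = - \<Gamma> (b # us @ y # x # ws)"
      using alternatingD(3)[OF Suc.prems, of "b # us" x y ws] by simp
  qed
  from Suc.IH[OF this] obtain C where C: "\<And>b. C b \<ge> 0"
    "\<And>b vs. (\<forall>v\<in>set vs. norm v \<le> 1) \<Longrightarrow> \<bar>\<Gamma> (b # vs)\<bar> \<le> C b" by metis
  let ?C = "\<Sum>b\<in>Basis. C b"
  have "\<bar>\<Gamma> vs\<bar> \<le> ?C" if vs: "\<forall>v\<in>set vs. norm v \<le> 1" for vs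
  proof (cases vs)
    case Nil
    then show ?thesis using alternatingD(1)[OF Suc.prems, of "[]"] C(1) by (simp add: sum_nonneg)
  next
    case (Cons v us)
    have "\<Gamma> vs = \<Gamma> ((\<Sum>b\<in>Basis. (v \<bullet> b) *\<^sub>R b) # us)" by (simp add: Cons euclidean_representation)
    also have "\<dots> = (\<Sum>b\<in>Basis. (v \<bullet> b) * \<Gamma> (b # us))"
      by (simp add: linear_sum[OF alternatingD(2)[OF Suc.prems]] linear_scale[OF alternatingD(2)[OF Suc.prems]])
    also have "\<bar>\<dots>\<bar> \<le> (\<Sum>b\<in>Basis. \<bar>v \<bullet> b\<bar> * \<bar>\<Gamma> (b # us)\<bar>)"
      by (rule order_trans[OF sum_abs]) (simp add: abs_mult)
    also have "\<dots> \<le> ?C"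
    proof (rule sum_mono)
      fix b :: 'a assume "b \<in> Basis"
      then have "\<bar>v \<bullet> b\<bar> \<le> 1" using Basis_le_norm[of b v] vs Cons by auto
      then have "\<bar>v \<bullet> b\<bar> * \<bar>\<Gamma> (b # us)\<bar> \<le> 1 * C b"
        using C(2)[of us b] vs Cons by (intro mult_mono) auto
      then show "\<bar>v \<bullet> b\<bar> * \<bar>\<Gamma> (b # us)\<bar> \<le> C b" by simp
    qed
    finally show ?thesis .
  qed
  then show ?case using C(1) by (intro exI[of _ ?C]) (auto intro!: sum_nonneg)
qed

text \<open>With \<open>\<ell> v = \<Sum>v\<^sub>j cnj a\<^sub>j\<close> one has \<open>v \<bullet> a = Re (\<ell> v)\<close> and \<open>v \<bullet> \<i>a = Im (\<ell> v)\<close>, so \<open>sig a\<close> is the wedge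
  product with \<open>(i / 2) d\<ell> \<and> d\<ell>bar\<close>.\<close>

definition sig :: "complex^'n \<Rightarrow> ((complex^'n) list \<Rightarrow> real) \<Rightarrow> (complex^'n) list \<Rightarrow> real" where
  "sig a \<Gamma> = wedge1 a (wedge1 (\<i> *s a) \<Gamma>)"

definition sigs :: "(complex^'n) list \<Rightarrow> (complex^'n) list \<Rightarrow> real" where
  "sigs as = foldr sig as (\<lambda>vs. if vs = [] then 1 else 0)"

lemma sigs_Nil: "sigs [] = (\<lambda>vs. if vs = [] then 1 else 0)" and sigs_Cons: "sigs (a # as) = sig a (sigs as)"
  by (simp_all add: sigs_def)

lemma alternating_sig: "alternating p \<Gamma> \<Longrightarrow> alternating (Suc (Suc p)) (sig a \<Gamma>)"
  by (simp add: sig_def alternating_wedge1)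

lemma alternating_sigs: "alternating (2 * length as) (sigs as)"
proof (induction as)
  case Nil
  show ?case by (auto simp: alternating_def sigs_Nil linear_iff)
qed (simp add: sigs_Cons alternating_sig)

lemma complex_scale_real: "(c::complex) *s v = Re c *\<^sub>R v + Im c *\<^sub>R (\<i> *s v)"
  by (simp add: vec_eq_iff complex_eq_iff)

lemma wedge1_scaleC: "wedge1 (c *s a) \<Gamma> vs = Re c * wedge1 a \<Gamma> vs + Im c * wedge1 (\<i> *s a) \<Gamma> vs"
  by (subst complex_scale_real) (simp add: wedge1_left_simps)

lemma ii_scale: "\<i> *s (\<i> *s v) = - (v::complex^'n)"
  by (simp add: vec_eq_iff)

text \<open>In d\<ell> \<and> d\<ell>bar a constant factor of \<ell> comes out with its squared
  modulus. This is why exchanging factors in a product never spoils a sign.\<close>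

lemma sig_scale: "sig (c *s a) \<Gamma> vs = (cmod c)\<^sup>2 * sig a \<Gamma> vs"
proof -
  have eq: "\<i> *s (c *s a) = (\<i> * c) *s a" by (simp add: vec_eq_iff)
  have "wedge1 (\<i> *s (c *s a)) \<Gamma> = (\<lambda>vs. (- Im c) * wedge1 a \<Gamma> vs + Re c * wedge1 (\<i> *s a) \<Gamma> vs)"
    unfolding eq by (rule ext) (subst wedge1_scaleC, simp)
  moreover have "wedge1 d (\<lambda>vs. (- Im c) * wedge1 a \<Gamma> vs + Re c * wedge1 (\<i> *s a) \<Gamma> vs) vs
      = (- Im c) * wedge1 d (wedge1 a \<Gamma>) vs + Re c * wedge1 d (wedge1 (\<i> *s a) \<Gamma>) vs" for d
    by (rule wedge1_linear_form)
  ultimately have "sig (c *s a) \<Gamma> vs = Re c * (Re c * wedge1 a (wedge1 (\<i> *s a) \<Gamma>) vs)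
      - Im c * (Im c * wedge1 (\<i> *s a) (wedge1 a \<Gamma>) vs)"
    unfolding sig_def wedge1_scaleC[of c a] by simp
  also have "wedge1 (\<i> *s a) (wedge1 a \<Gamma>) vs = - sig a \<Gamma> vs"
    unfolding sig_def by (rule wedge1_anticommute)
  finally have "sig (c *s a) \<Gamma> vs = ((Re c)\<^sup>2 + (Im c)\<^sup>2) * sig a \<Gamma> vs"
    by (simp add: sig_def power2_eq_square algebra_simps)
  then show ?thesis by (simp only: cmod_power2)
qed

text \<open>Moving two 1-forms past two others costs four sign changes.\<close>

lemma wedge1_commute4: "wedge1 a (wedge1 b (wedge1 c (wedge1 d \<Gamma>))) = wedge1 c (wedge1 d (wedge1 a (wedge1 b \<Gamma>)))"
proof -
  have s: "wedge1 x (wedge1 y \<Delta>) = (\<lambda>vs. - wedge1 y (wedge1 x \<Delta>) vs)" for x y \<Delta>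
    using wedge1_anticommute by blast
  have "wedge1 a (wedge1 b (wedge1 c (wedge1 d \<Gamma>))) = wedge1 a (\<lambda>vs. - wedge1 c (wedge1 b (wedge1 d \<Gamma>)) vs)"
    by (subst s[of b]) simp
  also have "\<dots> = wedge1 c (wedge1 a (wedge1 b (wedge1 d \<Gamma>)))"
    by (rule ext, subst wedge1_uminus, subst s[of a c], simp)
  also have "wedge1 a (wedge1 b (wedge1 d \<Gamma>)) = wedge1 a (\<lambda>vs. - wedge1 d (wedge1 b \<Gamma>) vs)"
    by (subst s[of b]) simp
  also have "\<dots> = wedge1 d (wedge1 a (wedge1 b \<Gamma>))"
    by (rule ext, subst wedge1_uminus, subst s[of a d], simp)
  finally show ?thesis .
qed

lemma sig_commute: "sig a (sig b \<Gamma>) = sig b (sig a \<Gamma>)"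
  unfolding sig_def by (rule wedge1_commute4)

lemma sig_zero [simp]: "sig 0 \<Gamma> = (\<lambda>vs. 0)"
  by (rule ext) (simp add: sig_def wedge1_left_simps)

lemma sig_form_zero [simp]: "sig a (\<lambda>vs. 0) = (\<lambda>vs. 0)"
  by (simp add: sig_def)

lemma sigs_move: "sigs (us @ a # ws) = sig a (sigs (us @ ws))"
  by (induction us) (simp_all add: sigs_Cons sig_commute)

lemma wedge1_sig_absorb:
  "wedge1 (c *s b) (sig b \<Gamma>) = (\<lambda>vs. 0)"
proof
  fix vs
  have "wedge1 (\<i> *s b) (sig b \<Gamma>) vs = 0"
    unfolding sig_def using wedge1_anticommute[of "\<i> *s b" b "wedge1 (\<i> *s b) \<Gamma>" vs] by simp
  moreover have "wedge1 b (sig b \<Gamma>) vs = 0" unfolding sig_def by simp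
  ultimately show "wedge1 (c *s b) (sig b \<Gamma>) vs = 0" by (subst wedge1_scaleC) simp
qed

text \<open>For every entry b, the product already contains the real and the imaginary part of the
  functional of b, so wedging with any complex combination repeats a factor.\<close>

lemma wedge1_span_sigs:
  assumes "x \<in> vec.span (set as)"
  shows "wedge1 x (sigs as) = (\<lambda>vs. 0)"
  using assms
proof (induction rule: vec.span_induct_alt)
  case base then show ?case by (simp add: fun_eq_iff wedge1_left_simps)
next
  case (step c b y)
  then obtain us ws where as: "as = us @ b # ws" using split_list by metis
  have "wedge1 (c *s b) (sigs as) = (\<lambda>vs. 0)"
    unfolding as sigs_move by (rule wedge1_sig_absorb)
  with step show ?case by (simp add: fun_eq_iff wedge1_left_simps)
qed

text \<open>The real and the imaginary part of the perturbation are both absorbed by the other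
  factors: a factor matters only modulo their complex span.\<close>

lemma sig_add_span:
  assumes "x \<in> vec.span (set as)"
  shows "sig (a + x) (sigs as) = sig a (sigs as)"
proof -
  have "\<i> *s x \<in> vec.span (set as)" using assms by (rule vec.span_scale)
  then have *: "wedge1 (\<i> *s (a + x)) (sigs as) = wedge1 (\<i> *s a) (sigs as)"
    by (simp add: fun_eq_iff vec.scale_right_distrib wedge1_left_simps wedge1_span_sigs)
  have "wedge1 x (wedge1 (\<i> *s a) (sigs as)) = (\<lambda>vs. 0)"
    using wedge1_anticommute[of x "\<i> *s a" "sigs as"] wedge1_span_sigs[OF assms]
    by (simp add: fun_eq_iff)
  then show ?thesis
    unfolding sig_def * by (intro ext) (simp add: linear_add[OF linear_wedge1_left])
qed

lemma sigs_mset_cong: "mset as = mset bs \<Longrightarrow> sigs as = sigs bs"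
proof (induction as arbitrary: bs)
  case (Cons a as)
  then have "a \<in> set bs" by (metis list.set_intros(1) set_mset_mset)
  then obtain us ws where bs: "bs = us @ a # ws" using split_list by metis
  with Cons have "sigs as = sigs (us @ ws)" by simp
  then show ?case by (simp add: bs sigs_move sigs_Cons)
qed simp

lemma sigs_Cons_span: "a \<in> vec.span (set as) \<Longrightarrow> sigs (a # as) = (\<lambda>vs. 0)"
  using sig_add_span[of a as 0] by (simp add: sigs_Cons)

lemma sigs_dependent:
  assumes "\<not> (distinct as \<and> vec.independent (set as))"
  shows "sigs as = (\<lambda>vs. 0)"
proof -
  obtain us x ws where as: "as = us @ x # ws" "x \<in> vec.span (set (us @ ws))"
  proof (cases "distinct as")
    case False
    then obtain us ys zs x where "as = us @ [x] @ ys @ [x] @ zs" using not_distinct_decomp by blast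
    then show ?thesis using that[of us x "ys @ x # zs"] by (simp add: vec.span_base)
  next
    case True
    then obtain x where x: "x \<in> set as" "x \<in> vec.span (set as - {x})"
      using assms vec.dependent_def by blast
    then obtain us ws where as: "as = us @ x # ws" using split_list by metis
    with True have "set as - {x} = set (us @ ws)" by auto
    with x as show ?thesis using that by metis
  qed
  then show ?thesis using sigs_Cons_span[OF as(2)] by (simp only: sigs_move sigs_Cons as(1))
qed

section \<open>Products of n factors and the orientation\<close>

text \<open>Exchange argument: the factors in \<open>ls\<close> are traded one by one for vectors of
  \<open>fs\<close>, and \<open>es\<close> collects those already used. A factor outside the span of
  the others equals c e modulo that span for some e of \<open>fs\<close>, and contributes |c|^2; in
  the degenerate cases the product is zero and \<kappa> = 0 serves.\<close>

lemma sigs_eq_scaled_basis: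
  fixes fs ls es :: "(complex^'n) list"
  assumes "distinct fs" "length fs = CARD('n)" "vec.span (set fs) = UNIV"
  shows "\<lbrakk>distinct es; set es \<subseteq> set fs; length ls + length es = CARD('n)\<rbrakk> \<Longrightarrow>
    \<exists>\<kappa>\<ge>0. \<forall>vs. sigs (ls @ es) vs = \<kappa> * sigs fs vs"
proof (induction ls arbitrary: es)
  case Nil
  then have "set es = set fs" using assms
    by (intro card_subset_eq) (auto simp: distinct_card)
  then have "sigs es = sigs fs" using Nil assms by (intro sigs_mset_cong) (simp add: set_eq_iff_mset_eq_distinct)
  then show ?case by (intro exI[of _ 1]) simp
next
  case (Cons l ls)
  let ?S = "set (ls @ es)"
  consider "l \<in> vec.span ?S" | "\<not> (distinct (ls @ es) \<and> vec.independent ?S)"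
    | "l \<notin> vec.span ?S" "distinct (ls @ es)" "vec.independent ?S" by blast
  then show ?case
  proof cases
    case 1
    then show ?thesis using sigs_Cons_span[of l "ls @ es"] by (intro exI[of _ 0]) simp
  next
    case 2
    then show ?thesis using sigs_dependent[of "ls @ es"] by (intro exI[of _ 0]) (simp add: sigs_Cons)
  next
    case 3
    have "\<not> set fs \<subseteq> vec.span ?S"
      using 3(1) assms(3) vec.span_minimal[OF _ vec.subspace_span, of "set fs" ?S] by blast
    then obtain e where e: "e \<in> set fs" "e \<notin> vec.span ?S" by blast
    have ind: "vec.independent (insert e ?S)" using e 3 by (simp add: vec.independent_insert)
    have "e \<notin> ?S" using e vec.span_base by blast
    moreover have "card ?S = CARD('n) - 1" using 3(2) Cons.prems(3) distinct_card[OF 3(2)] by simp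
    ultimately have "card (insert e ?S) = CARD('n)" using Cons.prems(3)
      by (simp add: card_insert_if)
    then have "vec.span (insert e ?S) = UNIV"
      using vec.card_ge_dim_independent[of "insert e ?S" UNIV] ind
      by (simp add: top_unique vec.dim_UNIV card_cart_basis del: List.set_append)
    then obtain c where c: "l - c *s e \<in> vec.span ?S" using vec.span_breakdown_eq[of l e ?S] by auto
    have "sigs (l # ls @ es) = sig (c *s e + (l - c *s e)) (sigs (ls @ es))" by (simp add: sigs_Cons)
    also have "\<dots> = sig (c *s e) (sigs (ls @ es))" by (rule sig_add_span[OF c])
    also have "\<dots> = (\<lambda>vs. (cmod c)\<^sup>2 * sigs (ls @ e # es) vs)" by (simp add: sig_scale sigs_move fun_eq_iff)
    finally have *: "sigs ((l # ls) @ es) = (\<lambda>vs. (cmod c)\<^sup>2 * sigs (ls @ e # es) vs)" by simp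
    have "\<exists>\<kappa>\<ge>0. \<forall>vs. sigs (ls @ e # es) vs = \<kappa> * sigs fs vs"
      using Cons.prems e \<open>e \<notin> ?S\<close> by (intro Cons.IH) auto
    then obtain \<kappa> where "\<kappa> \<ge> 0" "\<And>vs. sigs (ls @ e # es) vs = \<kappa> * sigs fs vs" by blast
    then have "(cmod c)\<^sup>2 * \<kappa> \<ge> 0 \<and> (\<forall>vs. sigs ((l # ls) @ es) vs = (cmod c)\<^sup>2 * \<kappa> * sigs fs vs)"
      by (simp only: * mult.assoc) simp
    then show ?thesis by blast
  qed
qed

lemma wedge1_orthogonal: "(\<And>v. v \<in> set vs \<Longrightarrow> v \<bullet> a = 0) \<Longrightarrow> wedge1 a \<Gamma> vs = 0"
  by (simp add: wedge1_def)

lemma inner_axis_complex: "axis i x \<bullet> axis j y = (if i = j then x \<bullet> y else (0::real))"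
  by (simp add: inner_axis) (simp add: axis_def)

lemma ii_axis: "\<i> *s axis j 1 = (axis j \<i> :: complex^'n)"
  by (simp add: vec_eq_iff axis_def)

text \<open>Fixes the sign with respect to the orientation: frame vectors of one coordinate are
  orthogonal to the functionals of all others, so only the diagonal term of each expansion
  survives.\<close>

lemma sigs_axis_frame:
  "distinct js \<Longrightarrow> sigs (map (\<lambda>j. axis j 1) js) (concat (map (\<lambda>j. [axis j 1, axis j \<i>]) js)) = 1"
proof (induction js)
  case (Cons j js)
  let ?vs = "concat (map (\<lambda>j. [axis j 1, axis j \<i>]) js)" and ?\<Gamma> = "sigs (map (\<lambda>j. axis j 1) js)"
  have z: "v \<bullet> axis j 1 = 0" "v \<bullet> axis j \<i> = 0" if "v \<in> set ?vs" for v
    using that Cons.prems by (auto simp: inner_axis_complex inner_complex_def)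
  have 1: "wedge1 (axis j 1) \<Delta> (axis j \<i> # ?vs) = 0" for \<Delta>
    using z(1) by (intro wedge1_orthogonal) (auto simp: inner_axis_complex inner_complex_def)
  have 2: "wedge1 (axis j \<i>) \<Delta> ?vs = 0" for \<Delta>
    using z(2) by (intro wedge1_orthogonal)
  have one: "(axis j 1 :: complex^'a) \<bullet> axis j 1 = 1" "(axis j \<i> :: complex^'a) \<bullet> axis j \<i> = 1"
    by (simp_all add: inner_axis_complex inner_complex_def)
  have "sig (axis j 1) ?\<Gamma> (axis j 1 # axis j \<i> # ?vs) = ?\<Gamma> ?vs"
    unfolding sig_def ii_axis
    by (subst wedge1_Cons, subst 1, subst wedge1_Cons, subst 2) (simp only: one, simp)
  with Cons show ?case by (simp add: sigs_Cons)
qed (simp add: sigs_Nil)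

text \<open>The enumeration inside \<open>std_frame\<close> is an arbitrary choice; taking the
  functionals in the same enumeration gives the value 1 without an argument about
  permutations.\<close>

lemma std_frame_axis:
  "\<exists>fs :: (complex^'n) list. distinct fs \<and> length fs = CARD('n) \<and> vec.span (set fs) = UNIV \<and>
     sigs fs std_frame = 1"
proof -
  let ?js = "SOME js. distinct js \<and> set js = (UNIV::'n set)"
  have "\<exists>js. distinct js \<and> set js = (UNIV::'n set)"
    using finite_distinct_list[of "UNIV::'n set"] by auto
  then have "distinct ?js \<and> set ?js = (UNIV::'n set)" by (rule someI_ex)
  then have js: "distinct ?js" "set ?js = UNIV" by blast+
  let ?fs = "map (\<lambda>j. axis j 1 :: complex^'n) ?js"
  have d: "distinct ?fs" using js by (auto simp: distinct_map inj_on_def axis_eq_axis)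
  have "set ?fs = cart_basis" using js by (auto simp: cart_basis_def)
  then have "vec.span (set ?fs) = UNIV" by (simp add: span_cart_basis)
  moreover have "length ?fs = CARD('n)" using js distinct_card[of ?js] by simp
  ultimately show ?thesis using d sigs_axis_frame[OF js(1)] unfolding std_frame_def by blast
qed

lemma sigs_std_frame_nonneg:
  fixes as :: "(complex^'n) list"
  assumes "length as = CARD('n)"
  shows "sigs as std_frame \<ge> 0"
proof -
  obtain fs :: "(complex^'n) list" where "distinct fs" "length fs = CARD('n)" "vec.span (set fs) = UNIV"
    and fs: "sigs fs std_frame = 1" using std_frame_axis by blast
  from sigs_eq_scaled_basis[OF this(1,2,3), of "[]" as] assms
  obtain \<kappa> where "\<kappa> \<ge> 0" "\<And>vs. sigs as vs = \<kappa> * sigs fs vs" by auto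
  with fs show ?thesis by simp
qed

text \<open>The exchange is read backwards: a product with value 1 is a multiple of
  \<open>sigs as\<close>, whose value therefore cannot be 0.\<close>

lemma sigs_std_frame_pos:
  fixes as :: "(complex^'n) list"
  assumes "distinct as" "length as = CARD('n)" "vec.span (set as) = UNIV"
  shows "sigs as std_frame > 0"
proof -
  obtain fs :: "(complex^'n) list" where fs: "length fs = CARD('n)" "sigs fs std_frame = 1"
    using std_frame_axis by blast
  from sigs_eq_scaled_basis[OF assms, of "[]" fs] fs(1)
  obtain \<kappa> where \<kappa>: "\<kappa> \<ge> 0" "\<And>vs. sigs fs vs = \<kappa> * sigs as vs" by auto
  have "sigs as std_frame \<ge> 0" using assms(2) by (rule sigs_std_frame_nonneg)
  moreover have "sigs as std_frame \<noteq> 0" using \<kappa>(2)[of std_frame] fs(2) by auto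
  ultimately show ?thesis by simp
qed

section \<open>Smooth functions\<close>

definition pd :: "'a::real_normed_vector \<Rightarrow> ('a \<Rightarrow> real) \<Rightarrow> 'a \<Rightarrow> real" where
  "pd v f x = frechet_derivative f (at x) v"

lemma iter_dir_deriv_Cons: "iter_dir_deriv f (v # vs) = pd v (iter_dir_deriv f vs)"
  by (simp add: pd_def[abs_def])

lemma iter_dir_deriv_snoc: "iter_dir_deriv f (vs @ [v]) = iter_dir_deriv (pd v f) vs"
  by (induction vs) (simp_all add: pd_def[abs_def])

text \<open>Reduces smoothness to finding a class of differentiable functions that is closed under
  \<open>pd\<close>; no formula for iterated derivatives is needed.\<close>

lemma smooth_fun_coinduct:
  assumes "f \<in> S" "\<And>g x. g \<in> S \<Longrightarrow> g differentiable at x" "\<And>g v. g \<in> S \<Longrightarrow> pd v g \<in> S"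
  shows "smooth_fun f"
proof -
  have "iter_dir_deriv f vs \<in> S" for vs
    by (induction vs) (auto simp: assms(1,3) iter_dir_deriv_Cons simp del: iter_dir_deriv.simps(2))
  then show ?thesis using assms(2) by (auto simp: smooth_fun_def)
qed

lemma smooth_fun_differentiable: "smooth_fun f \<Longrightarrow> f differentiable at x"
  unfolding smooth_fun_def by (metis iter_dir_deriv.simps(1))

lemma smooth_fun_pd: "smooth_fun f \<Longrightarrow> smooth_fun (pd v f)"
  unfolding smooth_fun_def by (metis iter_dir_deriv_snoc)

lemma has_derivative_pd: "f differentiable at x \<Longrightarrow> (f has_derivative (\<lambda>v. pd v f x)) (at x)"
  unfolding pd_def using frechet_derivative_works by blast

lemma pd_eqI: "(f has_derivative D) (at x) \<Longrightarrow> pd v f x = D v"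
  unfolding pd_def using frechet_derivative_at by metis

lemma linear_pd: "f differentiable at x \<Longrightarrow> linear (\<lambda>v. pd v f x)"
  using has_derivative_pd has_derivative_linear by blast

lemma continuous_on_smooth_fun: "smooth_fun f \<Longrightarrow> continuous_on S f"
  by (meson continuous_at_imp_continuous_on differentiable_imp_continuous_within smooth_fun_differentiable)

lemma pd_const: "pd v (\<lambda>x. c) = (\<lambda>x. 0)"
  by (rule ext) (simp add: pd_eqI[OF has_derivative_const])

lemma smooth_fun_const: "smooth_fun (\<lambda>x. c)"
  by (rule smooth_fun_coinduct[of _ "range (\<lambda>c x. c)"]) (auto simp: pd_const)

lemma pd_bounded_linear: "bounded_linear f \<Longrightarrow> pd v f = (\<lambda>x. f v)"
  by (rule ext) (simp add: pd_eqI[OF bounded_linear_imp_has_derivative])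

lemma smooth_fun_bounded_linear: "bounded_linear f \<Longrightarrow> smooth_fun f"
  by (rule smooth_fun_coinduct[of _ "insert f (range (\<lambda>c x. c))"])
     (auto simp: pd_const pd_bounded_linear bounded_linear_imp_differentiable)

lemma pd_add:
  assumes "f differentiable at x" "g differentiable at x"
  shows "pd v (\<lambda>x. f x + g x) x = pd v f x + pd v g x"
  using has_derivative_add[OF assms[THEN has_derivative_pd]] by (rule pd_eqI)

lemma pd_mult:
  assumes "f differentiable at x" "g differentiable at x"
  shows "pd v (\<lambda>x. f x * g x) x = f x * pd v g x + pd v f x * g x"
  using has_derivative_mult[OF assms[THEN has_derivative_pd]] by (rule pd_eqI)

lemma pd_cmult: "f differentiable at x \<Longrightarrow> pd v (\<lambda>x. c * f x) x = c * pd v f x"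
  using pd_mult[of "\<lambda>x. c" x f v] by (simp add: pd_const)

lemma smooth_fun_add:
  assumes "smooth_fun f" "smooth_fun g"
  shows "smooth_fun (\<lambda>x. f x + g x)"
proof (rule smooth_fun_coinduct[of _ "{\<lambda>x. f x + g x |f g. smooth_fun f \<and> smooth_fun g}"])
  show "(\<lambda>x. f x + g x) \<in> {\<lambda>x. f x + g x |f g. smooth_fun f \<and> smooth_fun g}" using assms by blast
next
  fix h x assume "h \<in> {\<lambda>x. f x + g x |f g. smooth_fun f \<and> smooth_fun (g::'a\<Rightarrow>real)}"
  then obtain f g where "h = (\<lambda>x. f x + g x)" "smooth_fun f" "smooth_fun g" by blast
  then show "h differentiable at x" by (simp add: differentiable_add smooth_fun_differentiable)
next
  fix h v assume "h \<in> {\<lambda>x. f x + g x |f g. smooth_fun f \<and> smooth_fun (g::'a\<Rightarrow>real)}"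
  then obtain f g where h: "h = (\<lambda>x. f x + g x)" "smooth_fun f" "smooth_fun g" by blast
  then have "pd v h = (\<lambda>x. pd v f x + pd v g x)"
    unfolding h(1) by (intro ext pd_add smooth_fun_differentiable)
  with h show "pd v h \<in> {\<lambda>x. f x + g x |f g. smooth_fun f \<and> smooth_fun g}"
    using smooth_fun_pd by blast
qed

lemma smooth_fun_sum: "(\<And>i. i \<in> I \<Longrightarrow> smooth_fun (f i)) \<Longrightarrow> smooth_fun (\<lambda>x. \<Sum>i\<in>I. f i x)"
  by (induction I rule: infinite_finite_induct) (auto simp: smooth_fun_const intro: smooth_fun_add)

text \<open>By the Leibniz rule products are not closed under differentiation, but their finite sums
  are.\<close>

inductive_set smooth_prods :: "('a::real_normed_vector \<Rightarrow> real) set" where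
  prod: "smooth_fun f \<Longrightarrow> smooth_fun g \<Longrightarrow> (\<lambda>x. f x * g x) \<in> smooth_prods"
| sum: "f \<in> smooth_prods \<Longrightarrow> g \<in> smooth_prods \<Longrightarrow> (\<lambda>x. f x + g x) \<in> smooth_prods"

lemma smooth_fun_mult:
  assumes "smooth_fun f" "smooth_fun g"
  shows "smooth_fun (\<lambda>x. f x * g x)"
proof (rule smooth_fun_coinduct[of _ smooth_prods])
  show "(\<lambda>x. f x * g x) \<in> smooth_prods" using assms by (rule smooth_prods.prod)
  fix h :: "'a \<Rightarrow> real" assume h: "h \<in> smooth_prods"
  have *: "(\<forall>x. h differentiable at x) \<and> pd v h \<in> smooth_prods" for v using h
  proof induction
    case (prod f g)
    then have "pd v (\<lambda>x. f x * g x) = (\<lambda>x. f x * pd v g x + pd v f x * g x)"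
      by (auto simp: fun_eq_iff pd_mult smooth_fun_differentiable)
    moreover have "\<dots> \<in> smooth_prods" by (intro smooth_prods.intros smooth_fun_pd prod)
    ultimately show ?case by (simp add: differentiable_mult smooth_fun_differentiable prod)
  next
    case (sum f g)
    then have "pd v (\<lambda>x. f x + g x) = (\<lambda>x. pd v f x + pd v g x)"
      by (auto simp: fun_eq_iff pd_add)
    with sum show ?case by (auto intro!: smooth_prods.intros differentiable_add)
  qed
  then show "h differentiable at x" "pd v h \<in> smooth_prods" for x v by blast+
qed

lemma smooth_fun_cmult: "smooth_fun f \<Longrightarrow> smooth_fun (\<lambda>x. c * f x)"
  by (rule smooth_fun_mult[OF smooth_fun_const])

lemma smooth_fun_diff: "smooth_fun f \<Longrightarrow> smooth_fun g \<Longrightarrow> smooth_fun (\<lambda>x. f x - g x)"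
  using smooth_fun_add[of f "\<lambda>x. - 1 * g x"] smooth_fun_cmult[of g "- 1"] by simp

lemma pd_sum:
  "(\<And>i. i \<in> I \<Longrightarrow> f i differentiable at x) \<Longrightarrow> pd v (\<lambda>x. \<Sum>i\<in>I. f i x) x = (\<Sum>i\<in>I. pd v (f i) x)"
proof (induction I rule: infinite_finite_induct)
  case (insert i I)
  then show ?case by (simp add: pd_add differentiable_sum)
qed (simp_all add: pd_const)

lemma pd_cong_open:
  assumes "open U" "x \<in> U" "\<And>y. y \<in> U \<Longrightarrow> f y = g y"
  shows "pd v f x = pd v g x"
proof -
  have "(f has_derivative D) (at x) \<longleftrightarrow> (g has_derivative D) (at x)" for D
    using assms has_derivative_transform_within_open[of _ D x UNIV U] by metis
  then show ?thesis unfolding pd_def frechet_derivative_def by simp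
qed

lemma pd_support: "closure {x. pd v f x \<noteq> 0} \<subseteq> closure {x. f x \<noteq> 0}"
proof (rule closure_minimal)
  show "{x. pd v f x \<noteq> 0} \<subseteq> closure {x. f x \<noteq> 0}"
  proof
    fix x assume "x \<in> {x. pd v f x \<noteq> 0}"
    moreover have "pd v f x = pd v (\<lambda>x. 0) x" if "x \<notin> closure {x. f x \<noteq> 0}"
      using that closure_subset by (intro pd_cong_open[of "- closure {x. f x \<noteq> 0}"]) (auto simp: subset_eq)
    ultimately show "x \<in> closure {x. f x \<noteq> 0}" by (auto simp: pd_const)
  qed
qed simp

lemma DERIV_along_line:
  assumes "f differentiable at (x + s *\<^sub>R v)"
  shows "((\<lambda>s. f (x + s *\<^sub>R v)) has_real_derivative pd v f (x + s *\<^sub>R v)) (at s)"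
proof -
  have "((\<lambda>s. x + s *\<^sub>R v) has_derivative (\<lambda>h. h *\<^sub>R v)) (at s)"
    by (auto intro!: derivative_eq_intros)
  from has_derivative_compose[OF this has_derivative_pd[OF assms]]
  have "((\<lambda>s. f (x + s *\<^sub>R v)) has_derivative (\<lambda>h. pd (h *\<^sub>R v) f (x + s *\<^sub>R v))) (at s)" .
  moreover have "pd (h *\<^sub>R v) f (x + s *\<^sub>R v) = pd v f (x + s *\<^sub>R v) * h" for h
    using linear_scale[OF linear_pd[OF assms]] by simp
  ultimately show ?thesis by (simp add: has_field_derivative_def)
qed

text \<open>Mean value theorem twice: along v for the increment in direction w, then along w for the
  derivative.\<close>

lemma second_difference:
  assumes f: "smooth_fun f" and "t > 0"
  shows "\<exists>a b. 0 < a \<and> a < t \<and> 0 < b \<and> b < t \<and>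
    f (z + t *\<^sub>R v + t *\<^sub>R w) - f (z + t *\<^sub>R v) - f (z + t *\<^sub>R w) + f z = t\<^sup>2 * pd w (pd v f) (z + a *\<^sub>R v + b *\<^sub>R w)"
proof -
  have "((\<lambda>s. f (z + t *\<^sub>R w + s *\<^sub>R v) - f (z + s *\<^sub>R v)) has_real_derivative
      (pd v f (z + t *\<^sub>R w + s *\<^sub>R v) - pd v f (z + s *\<^sub>R v))) (at s)" for s
    by (intro DERIV_diff DERIV_along_line smooth_fun_differentiable f)
  from MVT2[OF \<open>t > 0\<close> this] obtain a where a: "0 < a" "a < t"
    "f (z + t *\<^sub>R w + t *\<^sub>R v) - f (z + t *\<^sub>R v) - (f (z + t *\<^sub>R w) - f z)
      = t * (pd v f (z + t *\<^sub>R w + a *\<^sub>R v) - pd v f (z + a *\<^sub>R v))" by auto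
  have "((\<lambda>r. pd v f (z + a *\<^sub>R v + r *\<^sub>R w)) has_real_derivative pd w (pd v f) (z + a *\<^sub>R v + r *\<^sub>R w)) (at r)" for r
    by (intro DERIV_along_line smooth_fun_differentiable smooth_fun_pd f)
  from MVT2[OF \<open>t > 0\<close> this] obtain b where b: "0 < b" "b < t"
    "pd v f (z + a *\<^sub>R v + t *\<^sub>R w) - pd v f (z + a *\<^sub>R v) = t * pd w (pd v f) (z + a *\<^sub>R v + b *\<^sub>R w)" by auto
  have "f (z + t *\<^sub>R v + t *\<^sub>R w) - f (z + t *\<^sub>R v) - f (z + t *\<^sub>R w) + f z
      = t * (t * pd w (pd v f) (z + a *\<^sub>R v + b *\<^sub>R w))"
    using a(3) unfolding b(3)[symmetric] by (simp add: algebra_simps)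
  with a b show ?thesis by (auto simp: power2_eq_square)
qed

text \<open>The second difference is symmetric in v and w, so the two mixed derivatives take equal
  values at two points tending to z, and both are continuous.\<close>

lemma pd_commute:
  assumes f: "smooth_fun f"
  shows "pd v (pd w f) = pd w (pd v f)"
proof
  fix z
  let ?t = "\<lambda>n. inverse (real (Suc n))"
  have t: "?t \<longlonglongrightarrow> 0" by (rule LIMSEQ_inverse_real_of_nat)
  have "\<exists>a b c d. 0 < a \<and> a < ?t n \<and> 0 < b \<and> b < ?t n \<and> 0 < c \<and> c < ?t n \<and> 0 < d \<and> d < ?t n \<and>
      pd w (pd v f) (z + a *\<^sub>R v + b *\<^sub>R w) = pd v (pd w f) (z + c *\<^sub>R w + d *\<^sub>R v)" for n
  proof -
    obtain a b where 1: "0 < a \<and> a < ?t n \<and> 0 < b \<and> b < ?t n"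
      "f (z + ?t n *\<^sub>R v + ?t n *\<^sub>R w) - f (z + ?t n *\<^sub>R v) - f (z + ?t n *\<^sub>R w) + f z =
        (?t n)\<^sup>2 * pd w (pd v f) (z + a *\<^sub>R v + b *\<^sub>R w)"
      using second_difference[OF f, of "?t n" z v w] by auto
    obtain c d where 2: "0 < c \<and> c < ?t n \<and> 0 < d \<and> d < ?t n"
      "f (z + ?t n *\<^sub>R w + ?t n *\<^sub>R v) - f (z + ?t n *\<^sub>R w) - f (z + ?t n *\<^sub>R v) + f z =
        (?t n)\<^sup>2 * pd v (pd w f) (z + c *\<^sub>R w + d *\<^sub>R v)"
      using second_difference[OF f, of "?t n" z w v] by auto
    have "(?t n)\<^sup>2 * pd w (pd v f) (z + a *\<^sub>R v + b *\<^sub>R w) = (?t n)\<^sup>2 * pd v (pd w f) (z + c *\<^sub>R w + d *\<^sub>R v)"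
      unfolding 1(2)[symmetric] 2(2)[symmetric] by (simp add: algebra_simps)
    then have "pd w (pd v f) (z + a *\<^sub>R v + b *\<^sub>R w) = pd v (pd w f) (z + c *\<^sub>R w + d *\<^sub>R v)" by simp
    with 1 2 show ?thesis by blast
  qed
  then obtain a b c d where abcd: "\<And>n. 0 < a n \<and> a n < ?t n \<and> 0 < b n \<and> b n < ?t n \<and> 0 < c n \<and> c n < ?t n \<and> 0 < d n \<and> d n < ?t n \<and>
      pd w (pd v f) (z + a n *\<^sub>R v + b n *\<^sub>R w) = pd v (pd w f) (z + c n *\<^sub>R w + d n *\<^sub>R v)" by metis
  have lim: "s \<longlonglongrightarrow> 0" if "\<And>n. 0 < s n \<and> s n < ?t n" for s :: "nat \<Rightarrow> real"
    using that by (intro tendsto_sandwich[OF _ _ tendsto_const t]) (auto intro!: always_eventually less_imp_le)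
  have l: "a \<longlonglongrightarrow> 0" "b \<longlonglongrightarrow> 0" "c \<longlonglongrightarrow> 0" "d \<longlonglongrightarrow> 0" using abcd by (auto intro!: lim)
  have cont: "isCont (pd x (pd y f)) z" for x y
    using f by (meson differentiable_imp_continuous_within smooth_fun_differentiable smooth_fun_pd)
  have "(\<lambda>n. z + a n *\<^sub>R v + b n *\<^sub>R w) \<longlonglongrightarrow> z + 0 *\<^sub>R v + 0 *\<^sub>R w"
    by (intro tendsto_intros l)
  then have "(\<lambda>n. pd w (pd v f) (z + a n *\<^sub>R v + b n *\<^sub>R w)) \<longlonglongrightarrow> pd w (pd v f) z"
    using isCont_tendsto_compose[OF cont] by auto
  moreover have "(\<lambda>n. z + c n *\<^sub>R w + d n *\<^sub>R v) \<longlonglongrightarrow> z + 0 *\<^sub>R w + 0 *\<^sub>R v"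
    by (intro tendsto_intros l)
  then have "(\<lambda>n. pd v (pd w f) (z + c n *\<^sub>R w + d n *\<^sub>R v)) \<longlonglongrightarrow> pd v (pd w f) z"
    using isCont_tendsto_compose[OF cont] by auto
  ultimately show "pd v (pd w f) z = pd w (pd v f) z" using abcd LIMSEQ_unique by (metis (lifting) ext)
qed

section \<open>Flat functions and bumps\<close>

text \<open>The powers of 1/t are carried along because differentiating exp(-1/t) produces them; the
  family is closed under differentiation up to linear combinations.\<close>

definition exp_flat :: "nat \<Rightarrow> real \<Rightarrow> real" where
  "exp_flat m t = (if t > 0 then exp (- inverse t) * inverse t ^ m else 0)"

lemma exp_flat_tendsto: "(exp_flat m \<longlongrightarrow> 0) (at 0)"
proof -
  have "((\<lambda>x. x ^ m / exp x) \<longlongrightarrow> (0::real)) at_top" by (rule tendsto_power_div_exp_0)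
  then have "((\<lambda>t. inverse t ^ m / exp (inverse t)) \<longlongrightarrow> (0::real)) (at_right 0)"
    using filterlim_compose filterlim_inverse_at_top_right by blast
  then have "(exp_flat m \<longlongrightarrow> 0) (at_right 0)"
    by (rule Lim_transform_eventually)
      (auto simp: eventually_at_filter exp_flat_def exp_minus divide_inverse mult.commute)
  moreover have "(exp_flat m \<longlongrightarrow> 0) (at_left 0)"
    by (rule tendsto_eventually) (auto simp: eventually_at_filter exp_flat_def)
  ultimately show ?thesis using filterlim_split_at by blast
qed

lemma exp_flat_DERIV:
  "(exp_flat m has_real_derivative (exp_flat (Suc (Suc m)) t - real m * exp_flat (Suc m) t)) (at t)"
proof -
  consider "t > 0" | "t < 0" | "t = 0" by linarith
  then show ?thesis
  proof cases
    case 1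
    have "((\<lambda>t. inverse t ^ m) has_real_derivative (real m * inverse t ^ (m - 1) * - (inverse t * inverse t))) (at t)"
      using 1 by (auto intro!: derivative_eq_intros)
    moreover have "real m * inverse t ^ (m - 1) * inverse t = real m * inverse t ^ m" by (cases m) auto
    ultimately have "((\<lambda>t. inverse t ^ m) has_real_derivative (- (real m * inverse t ^ m * inverse t))) (at t)"
      by (cases m) (simp_all add: algebra_simps)
    moreover have "((\<lambda>t. exp (- inverse t)) has_real_derivative (exp (- inverse t) * (inverse t * inverse t))) (at t)"
      using 1 by (auto intro!: derivative_eq_intros)
    ultimately have "((\<lambda>t. exp (- inverse t) * inverse t ^ m) has_real_derivative
        exp_flat (Suc (Suc m)) t - real m * exp_flat (Suc m) t) (at t)"
      by (rule DERIV_cong[OF DERIV_mult[rotated]]) (use 1 in \<open>simp add: exp_flat_def algebra_simps\<close>)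
    then show ?thesis
      by (rule has_field_derivative_transform_within_open[of _ _ _ "{0<..}"]) (use 1 in \<open>auto simp: exp_flat_def\<close>)
  next
    case 2
    have "((\<lambda>t. 0) has_real_derivative 0) (at t)" by simp
    then have "(exp_flat m has_real_derivative 0) (at t)"
      by (rule has_field_derivative_transform_within_open[of _ _ _ "{..<0}"]) (use 2 in \<open>auto simp: exp_flat_def\<close>)
    with 2 show ?thesis by (simp add: exp_flat_def)
  next
    case 3
    \<comment> \<open>At 0 the difference quotient of \<open>exp_flat m\<close> is
      \<open>exp_flat (Suc m)\<close> itself.\<close>
    have "((\<lambda>h. (exp_flat m (0 + h) - exp_flat m 0) / h) \<longlongrightarrow> 0) (at 0)"
      using exp_flat_tendsto[of "Suc m"]
      by (rule Lim_transform_eventually) (auto simp: eventually_at_filter exp_flat_def field_simps)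
    then show ?thesis using 3 by (simp add: DERIV_def exp_flat_def)
  qed
qed

text \<open>The class for the coinduction: product and chain rule turn one summand into three of the
  same shape.\<close>

inductive_set exp_flat_class :: "('a::real_normed_vector \<Rightarrow> real) \<Rightarrow> ('a \<Rightarrow> real) set" for s where
  base: "smooth_fun q \<Longrightarrow> (\<lambda>x. q x * exp_flat m (s x)) \<in> exp_flat_class s"
| sum: "f \<in> exp_flat_class s \<Longrightarrow> g \<in> exp_flat_class s \<Longrightarrow> (\<lambda>x. f x + g x) \<in> exp_flat_class s"

lemma smooth_exp_flat:
  assumes s: "smooth_fun s"
  shows "smooth_fun (\<lambda>x. exp_flat m (s x))"
proof (rule smooth_fun_coinduct[of _ "exp_flat_class s"])
  show "(\<lambda>x. exp_flat m (s x)) \<in> exp_flat_class s"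
    using exp_flat_class.base[OF smooth_fun_const, of 1 m s] by simp
  have D: "((\<lambda>x. exp_flat m (s x)) has_derivative
      (\<lambda>v. pd v s x * (exp_flat (Suc (Suc m)) (s x) - real m * exp_flat (Suc m) (s x)))) (at x)" for m x
    by (rule has_derivative_eq_rhs[OF has_derivative_compose[OF has_derivative_pd[OF smooth_fun_differentiable[OF s]]
       exp_flat_DERIV[unfolded has_field_derivative_def]]]) (simp add: fun_eq_iff)
  have dif: "(\<lambda>x. exp_flat m (s x)) differentiable at x" for m x using D differentiableI by blast
  have *: "(\<forall>x. h differentiable at x) \<and> pd v h \<in> exp_flat_class s" if "h \<in> exp_flat_class s" for h v
    using that
  proof induction
    case (base q m)
    have "pd v (\<lambda>x. q x * exp_flat m (s x)) =
      (\<lambda>x. ((q x * pd v s x) * exp_flat (Suc (Suc m)) (s x) + ((- real m) * (q x * pd v s x)) * exp_flat (Suc m) (s x))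
        + pd v q x * exp_flat m (s x))"
      using base by (auto simp: fun_eq_iff pd_mult smooth_fun_differentiable dif pd_eqI[OF D] algebra_simps)
    moreover have "\<dots> \<in> exp_flat_class s"
      by (rule exp_flat_class.sum[OF exp_flat_class.sum[OF exp_flat_class.base exp_flat_class.base] exp_flat_class.base])
         (intro smooth_fun_mult smooth_fun_const smooth_fun_pd s base)+
    ultimately show ?case by (simp add: differentiable_mult dif smooth_fun_differentiable base)
  next
    case (sum f g)
    then have "pd v (\<lambda>x. f x + g x) = (\<lambda>x. pd v f x + pd v g x)"
      by (auto simp: fun_eq_iff pd_add)
    with sum show ?case by (auto intro!: exp_flat_class.intros differentiable_add)
  qed
  then show "h differentiable at x" if "h \<in> exp_flat_class s" for h x using that by blast
  show "pd v h \<in> exp_flat_class s" if "h \<in> exp_flat_class s" for h v using * that by blast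
qed

lemma smooth_fun_inner_self: "smooth_fun (\<lambda>x::'a::euclidean_space. x \<bullet> x)"
proof -
  have "(\<lambda>x::'a. x \<bullet> x) = (\<lambda>x. \<Sum>b\<in>Basis. (x \<bullet> b) * (x \<bullet> b))" by (rule ext) (rule euclidean_inner)
  moreover have "smooth_fun (\<lambda>x::'a. x \<bullet> b)" for b
    by (intro smooth_fun_bounded_linear bounded_linear_inner_left)
  ultimately show ?thesis by (simp only:) (rule smooth_fun_sum, rule smooth_fun_mult)
qed

lemma smooth_bump_exists:
  assumes "\<kappa> > 0"
  shows "\<exists>\<rho>::'a::euclidean_space \<Rightarrow> real. smooth_fun \<rho> \<and> (\<forall>x. \<rho> x \<ge> 0) \<and> (\<forall>x. norm x \<ge> \<kappa> \<longrightarrow> \<rho> x = 0) \<and> \<rho> 0 > 0"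
proof -
  have "smooth_fun (\<lambda>x::'a. exp_flat 0 (\<kappa>\<^sup>2 - x \<bullet> x))"
    by (intro smooth_exp_flat smooth_fun_diff smooth_fun_const smooth_fun_inner_self)
  moreover
  have "\<kappa>\<^sup>2 - x \<bullet> x \<le> 0" if "norm x \<ge> \<kappa>" for x :: 'a
    using power_mono[OF that, of 2] assms by (simp add: power2_norm_eq_inner)
  then have "\<forall>x::'a. norm x \<ge> \<kappa> \<longrightarrow> exp_flat 0 (\<kappa>\<^sup>2 - x \<bullet> x) = 0"
    unfolding exp_flat_def by force
  ultimately show ?thesis using assms
    by (intro exI[of _ "\<lambda>x::'a. exp_flat 0 (\<kappa>\<^sup>2 - x \<bullet> x)"] conjI) (simp_all add: exp_flat_def)
qed

section \<open>Compactly supported functions and mollification\<close>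

definition supp :: "('a::topological_space \<Rightarrow> real) \<Rightarrow> 'a set" where
  "supp f = closure {x. f x \<noteq> 0}"

definition Cc :: "'a::topological_space set \<Rightarrow> ('a \<Rightarrow> real) \<Rightarrow> bool" where
  "Cc D f \<longleftrightarrow> continuous_on UNIV f \<and> compact (supp f) \<and> supp f \<subseteq> D"

lemma closed_supp: "closed (supp f)"
  by (simp add: supp_def)

lemma supp_zero: "x \<notin> supp f \<Longrightarrow> f x = 0"
  using closure_subset[of "{x. f x \<noteq> 0}"] by (auto simp: supp_def)

lemma supp_subset: "closed K \<Longrightarrow> (\<And>x. x \<notin> K \<Longrightarrow> f x = 0) \<Longrightarrow> supp f \<subseteq> K"
  unfolding supp_def by (rule closure_minimal) auto

lemma Cc_intro:
  fixes f :: "'a::euclidean_space \<Rightarrow> real"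
  assumes "continuous_on UNIV f" "compact K" "K \<subseteq> D" "\<And>x. x \<notin> K \<Longrightarrow> f x = 0"
  shows "Cc D f"
proof -
  have "supp f \<subseteq> K" using assms by (intro supp_subset compact_imp_closed)
  then have "compact (supp f)" using compact_Int_closed[OF assms(2) closed_supp, of f] by (simp add: Int_absorb1)
  with assms \<open>supp f \<subseteq> K\<close> show ?thesis by (auto simp: Cc_def)
qed

lemma Cc_continuous: "Cc D f \<Longrightarrow> continuous_on S f"
  using continuous_on_subset by (auto simp: Cc_def)

lemma Cc_mult:
  fixes f g :: "'a::euclidean_space \<Rightarrow> real"
  assumes "Cc D f" "continuous_on UNIV g"
  shows "Cc D (\<lambda>x. g x * f x)"
  using assms by (intro Cc_intro[of _ "supp f"] continuous_intros) (auto simp: Cc_def supp_zero)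

text \<open>Meant for factors such as \<open>u\<close> that are continuous only on an open set
  around the support. The product is continuous there and is 0 on the open complement of the
  support.\<close>

lemma Cc_mult_local:
  fixes f g :: "'a::euclidean_space \<Rightarrow> real"
  assumes f: "Cc D f" and g: "continuous_on W g" "open W" "supp f \<subseteq> W"
  shows "Cc D (\<lambda>x. g x * f x)"
proof (rule Cc_intro[of _ "supp f"])
  have "continuous_on (W \<union> - supp f) (\<lambda>x. g x * f x)"
  proof (rule continuous_on_open_Un)
    show "continuous_on W (\<lambda>x. g x * f x)" using g Cc_continuous[OF f] by (intro continuous_intros)
    have "continuous_on (- supp f) (\<lambda>x. 0)" by simp
    then show "continuous_on (- supp f) (\<lambda>x. g x * f x)"
      by (rule continuous_on_eq) (simp add: supp_zero)
  qed (use g closed_supp in auto)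
  moreover have "W \<union> - supp f = UNIV" using g by blast
  ultimately show "continuous_on UNIV (\<lambda>x. g x * f x)" by simp
qed (use f in \<open>auto simp: Cc_def supp_zero\<close>)

lemma Cc_integrable:
  fixes f :: "'a::euclidean_space \<Rightarrow> real"
  assumes "Cc D f"
  shows "integrable lborel f"
proof -
  have "integrable lborel (\<lambda>x. indicator (supp f) x *\<^sub>R f x)"
    using assms by (intro borel_integrable_compact continuous_on_subset[OF Cc_continuous[OF assms]]) (auto simp: Cc_def)
  moreover have "(\<lambda>x. indicator (supp f) x *\<^sub>R f x) = f"
    by (auto simp: fun_eq_iff indicator_def supp_zero)
  ultimately show ?thesis by simp
qed

lemma lborel_integral_reflect:
  fixes f :: "'a::euclidean_space \<Rightarrow> real"
  assumes "f \<in> borel_measurable borel"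
  shows "(LINT x|lborel. f (t - x)) = (LINT x|lborel. f x)"
proof -
  have "(LINT x|lborel. f x) = (LINT x|distr lborel borel (\<lambda>x. t + (-1) *\<^sub>R x). f x)"
    using lborel_affine[of "-1" t] by (simp add: density_1)
  also have "\<dots> = (LINT x|lborel. f (t - x))"
    using assms by (subst integral_distr) auto
  finally show ?thesis by simp
qed

lemma Cc_uniformly_continuous:
  fixes f :: "'a::euclidean_space \<Rightarrow> real"
  assumes f: "Cc D f"
  shows "uniformly_continuous_on UNIV f"
proof -
  \<comment> \<open>Points within distance 1 of the support lie in K, so uniform continuity on this
    compact set settles every close pair that meets the support.\<close>
  define K where "K = {x + y |x y. x \<in> supp f \<and> y \<in> cball 0 1}"
  have "compact K" unfolding K_def using f by (intro compact_sums) (auto simp: Cc_def)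
  then have uc: "uniformly_continuous_on K f"
    by (rule compact_uniformly_continuous[OF Cc_continuous[OF f]])
  show ?thesis
    unfolding uniformly_continuous_on_def
  proof (intro allI impI)
    fix e :: real assume "e > 0"
    with uc obtain d where d: "d > 0"
      "\<And>x x'. x \<in> K \<Longrightarrow> x' \<in> K \<Longrightarrow> dist x' x < d \<Longrightarrow> dist (f x') (f x) < e"
      unfolding uniformly_continuous_on_def by blast
    have key: "dist (f x') (f x) < e" if "x \<in> supp f" "dist x' x < min d 1" for x x'
    proof -
      have "x' = x + (x' - x)" "x' - x \<in> cball 0 1" using that by (auto simp: dist_norm norm_minus_commute)
      moreover have "x = x + 0" "(0::'a) \<in> cball 0 1" by simp_all
      ultimately have "x' \<in> K" "x \<in> K" using that(1) unfolding K_def by blast+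
      then show ?thesis using d(2)[of x x'] that by simp
    qed
    show "\<exists>d>0. \<forall>x\<in>UNIV. \<forall>x'\<in>UNIV. dist x' x < d \<longrightarrow> dist (f x') (f x) < e"
    proof (intro exI[of _ "min d 1"] conjI ballI impI)
      fix x x' :: 'a assume *: "dist x' x < min d 1"
      show "dist (f x') (f x) < e"
        using key[of x x'] key[of x' x] * \<open>e > 0\<close> supp_zero[of x f] supp_zero[of x' f]
        by (cases "x \<in> supp f"; cases "x' \<in> supp f") (auto simp: dist_commute)
    qed (use d in auto)
  qed
qed

lemma Cc_uniform_modulus:
  fixes f :: "'a::euclidean_space \<Rightarrow> real"
  assumes "Cc D f" "e > 0"
  obtains d where "d > 0" "\<And>x y :: 'a. dist x y < d \<Longrightarrow> \<bar>f x - f y\<bar> < e"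
  using Cc_uniformly_continuous[OF assms(1)] assms(2)
  unfolding uniformly_continuous_on_def dist_real_def by (metis UNIV_I)

definition test_fun :: "'a::euclidean_space set \<Rightarrow> ('a \<Rightarrow> real) \<Rightarrow> bool" where
  "test_fun D f \<longleftrightarrow> smooth_fun f \<and> Cc D f"

lemma supp_pd: "supp (pd v f) \<subseteq> supp f"
  unfolding supp_def by (rule pd_support)

lemma test_fun_pd:
  assumes "test_fun D f"
  shows "test_fun D (pd v f)"
proof -
  have "pd v f x = 0" if "x \<notin> supp f" for x
    using that supp_pd[of v f] supp_zero[of x "pd v f"] by blast
  with assms show ?thesis unfolding test_fun_def
    by (intro conjI smooth_fun_pd Cc_intro[of _ "supp f"] continuous_on_smooth_fun) (auto simp: Cc_def)
qed

lemma pd_euclidean: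
  fixes f :: "'a::euclidean_space \<Rightarrow> real"
  assumes "f differentiable at x"
  shows "pd v f x = (\<Sum>b\<in>Basis. (v \<bullet> b) * pd b f x)"
proof -
  have "pd v f x = pd (\<Sum>b\<in>Basis. (v \<bullet> b) *\<^sub>R b) f x" by (simp add: euclidean_representation)
  then show ?thesis
    by (simp add: linear_sum[OF linear_pd[OF assms]] linear_scale[OF linear_pd[OF assms]])
qed

text \<open>Uniformity in y comes from uniform continuity of the partial derivatives; it permits
  differentiation of a convolution under the integral sign by a plain norm estimate.\<close>

lemma test_fun_uniform_derivative:
  fixes f :: "'a::euclidean_space \<Rightarrow> real"
  assumes f: "test_fun D f" and "e > 0"
  shows "\<exists>d>0. \<forall>y h. norm h < d \<longrightarrow> \<bar>f (y + h) - f y - pd h f y\<bar> \<le> e * norm h"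
proof -
  let ?n = "real DIM('a)"
  have sm: "smooth_fun f" using f by (simp add: test_fun_def)
  have "\<exists>d>0. \<forall>x x'. dist x' x < d \<longrightarrow> dist (pd b f x') (pd b f x) < e / ?n" for b
  proof -
    have "uniformly_continuous_on UNIV (pd b f)" "e / ?n > 0"
      using test_fun_pd[OF f, of b] \<open>e > 0\<close> by (auto simp: test_fun_def intro: Cc_uniformly_continuous)
    then show ?thesis unfolding uniformly_continuous_on_def by blast
  qed
  then obtain d where d: "\<And>b. d b > 0" "\<And>b x x'. dist x' x < d b \<Longrightarrow> dist (pd b f x') (pd b f x) < e / ?n"
    by metis
  let ?d = "Min (d ` (Basis::'a set))"
  have "?d > 0" using d(1) by simp
  moreover have "\<bar>f (y + h) - f y - pd h f y\<bar> \<le> e * norm h" if h: "norm h < ?d" for y h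
  proof -
    have "((\<lambda>s. f (y + s *\<^sub>R h)) has_real_derivative pd h f (y + s *\<^sub>R h)) (at s)" for s
      by (intro DERIV_along_line smooth_fun_differentiable sm)
    from MVT2[OF zero_less_one this] obtain s where s: "0 < s" "s < 1"
      "f (y + h) - f y = pd h f (y + s *\<^sub>R h)" by auto
    have "f (y + h) - f y - pd h f y = (\<Sum>b\<in>Basis. (h \<bullet> b) * (pd b f (y + s *\<^sub>R h) - pd b f y))"
      unfolding s(3) by (simp add: pd_euclidean[OF smooth_fun_differentiable[OF sm], of h] sum_subtractf algebra_simps)
    also have "\<bar>\<dots>\<bar> \<le> (\<Sum>b\<in>(Basis::'a set). norm h * (e / ?n))"
    proof (rule order_trans[OF sum_abs], rule sum_mono)
      fix b :: 'a assume b: "b \<in> Basis"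
      have "s * norm h \<le> norm h" using s by (simp add: mult_left_le_one_le)
      also have "\<dots> < d b" using h b by simp
      finally have "dist (y + s *\<^sub>R h) y < d b" using s by (simp add: dist_norm)
      then have "\<bar>pd b f (y + s *\<^sub>R h) - pd b f y\<bar> \<le> e / ?n" using d(2) by (fastforce simp: dist_real_def)
      then show "\<bar>h \<bullet> b * (pd b f (y + s *\<^sub>R h) - pd b f y)\<bar> \<le> norm h * (e / ?n)"
        unfolding abs_mult using b by (intro mult_mono Basis_le_norm) auto
    qed
    also have "\<dots> = e * norm h" by simp
    finally show ?thesis .
  qed
  ultimately show ?thesis by (intro exI[of _ ?d] conjI allI impI)
qed

section \<open>Convolution, mollifiers and smooth cutoffs\<close>

definition conv :: "('a::euclidean_space \<Rightarrow> real) \<Rightarrow> ('a \<Rightarrow> real) \<Rightarrow> 'a \<Rightarrow> real" where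
  "conv w \<rho> z = (LINT x|lborel. w x * \<rho> (z - x))"

lemma conv_integrable:
  fixes w :: "'a::euclidean_space \<Rightarrow> real"
  assumes "Cc D w" "continuous_on UNIV \<rho>"
  shows "integrable lborel (\<lambda>x. w x * \<rho> (z - x))"
proof -
  have "continuous_on UNIV (\<lambda>x. \<rho> (z - x))"
    by (rule continuous_on_compose2[OF assms(2)]) (auto intro!: continuous_intros)
  from Cc_integrable[OF Cc_mult[OF assms(1) this]] show ?thesis by (simp add: mult.commute)
qed

lemma conv_reflect:
  fixes w :: "'a::euclidean_space \<Rightarrow> real"
  assumes "continuous_on UNIV w" "continuous_on UNIV \<rho>"
  shows "conv w \<rho> z = (LINT y|lborel. w (z - y) * \<rho> y)"
proof -
  have "continuous_on UNIV (\<lambda>x. w x * \<rho> (z - x))"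
    by (intro continuous_intros assms(1) continuous_on_compose2[OF assms(2)]) auto
  from lborel_integral_reflect[OF borel_measurable_continuous_onI[OF this], of z]
  show ?thesis by (simp add: conv_def)
qed

lemma conv_has_derivative:
  fixes w :: "'a::euclidean_space \<Rightarrow> real"
  assumes w: "Cc D w" and \<rho>: "test_fun E \<rho>"
  shows "(conv w \<rho> has_derivative (\<lambda>v. conv w (pd v \<rho>) z)) (at z)"
proof -
  have sm: "smooth_fun \<rho>" using \<rho> by (simp add: test_fun_def)
  have cont: "continuous_on UNIV \<rho>" "continuous_on UNIV (pd v \<rho>)" for v
    by (auto intro!: continuous_on_smooth_fun smooth_fun_pd sm)
  have int: "integrable lborel (\<lambda>x. w x * \<rho> (z - x))" "integrable lborel (\<lambda>x. w x * pd v \<rho> (z - x))" for v z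
    using cont w by (auto intro!: conv_integrable)
  have "integrable lborel w" using w by (rule Cc_integrable)
  then have intw: "integrable lborel (\<lambda>x. \<bar>w x\<bar>)" by simp
  let ?M = "LINT x|lborel. \<bar>w x\<bar>"
  have M: "?M \<ge> 0" by simp
  show ?thesis
    unfolding has_derivative_at_alt
  proof (intro conjI allI impI)
    have "linear (\<lambda>v. conv w (pd v \<rho>) z)"
      unfolding conv_def
      by (intro linearI) (simp_all add: linear_add[OF linear_pd[OF smooth_fun_differentiable[OF sm]]]
          linear_scale[OF linear_pd[OF smooth_fun_differentiable[OF sm]]] distrib_left int mult.left_commute)
    then show "bounded_linear (\<lambda>v. conv w (pd v \<rho>) z)" by (simp add: linear_conv_bounded_linear)
    fix e :: real assume "e > 0"
    \<comment> \<open>The summand 1 keeps the denominator positive when \<open>w\<close>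
      vanishes.\<close>
    then have "e / (?M + 1) > 0" using M by (intro divide_pos_pos) linarith+
    from test_fun_uniform_derivative[OF \<rho> this] obtain d where d: "d > 0"
      "\<And>y h. norm h < d \<Longrightarrow> \<bar>\<rho> (y + h) - \<rho> y - pd h \<rho> y\<bar> \<le> e / (?M + 1) * norm h" by blast
    have "norm (conv w \<rho> y - conv w \<rho> z - conv w (pd (y - z) \<rho>) z) \<le> e * norm (y - z)"
      if y: "norm (y - z) < d" for y
    proof -
      let ?h = "y - z"
      have "conv w \<rho> y - conv w \<rho> z - conv w (pd ?h \<rho>) z
         = (LINT x|lborel. w x * (\<rho> (z - x + ?h) - \<rho> (z - x) - pd ?h \<rho> (z - x)))"
        unfolding conv_def using int by (simp add: right_diff_distrib algebra_simps)
      also have "norm \<dots> \<le> (LINT x|lborel. \<bar>w x\<bar> * (e / (?M + 1) * norm ?h))"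
      proof (rule order_trans[OF integral_norm_bound integral_mono])
        have "integrable lborel (\<lambda>x. w x * \<rho> (y - x) - w x * \<rho> (z - x) - w x * pd ?h \<rho> (z - x))"
          using int by simp
        then show "integrable lborel (\<lambda>x. norm (w x * (\<rho> (z - x + ?h) - \<rho> (z - x) - pd ?h \<rho> (z - x))))"
          by (simp add: right_diff_distrib algebra_simps)
        show "integrable lborel (\<lambda>x. \<bar>w x\<bar> * (e / (?M + 1) * norm ?h))" using intw by (rule integrable_mult_left)
        fix x
        show "norm (w x * (\<rho> (z - x + ?h) - \<rho> (z - x) - pd ?h \<rho> (z - x))) \<le> \<bar>w x\<bar> * (e / (?M + 1) * norm ?h)"
          unfolding real_norm_def abs_mult by (intro mult_left_mono d(2)[OF y]) auto
      qed
      also have "\<dots> = ?M * (e / (?M + 1) * norm ?h)" by simp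
      also have "\<dots> = (?M / (?M + 1)) * (e * norm ?h)" by simp
      also have "\<dots> \<le> 1 * (e * norm ?h)"
        using M \<open>e > 0\<close> by (intro mult_right_mono mult_imp_div_pos_le) (linarith | simp)+
      finally show ?thesis by simp
    qed
    with d(1) show "\<exists>d>0. \<forall>y. norm (y - z) < d \<longrightarrow>
        norm (conv w \<rho> y - conv w \<rho> z - conv w (pd (y - z) \<rho>) z) \<le> e * norm (y - z)" by blast
  qed
qed

lemma smooth_conv:
  fixes w :: "'a::euclidean_space \<Rightarrow> real"
  assumes w: "Cc D w" and \<rho>: "test_fun E \<rho>"
  shows "smooth_fun (conv w \<rho>)"
proof (rule smooth_fun_coinduct[of _ "conv w ` Collect (test_fun E)"])
  show "conv w \<rho> \<in> conv w ` Collect (test_fun E)" using \<rho> by blast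
  fix g assume "g \<in> conv w ` Collect (test_fun E)"
  then obtain \<sigma> where g: "g = conv w \<sigma>" "test_fun E \<sigma>" by blast
  show "g differentiable at x" for x
    unfolding g(1) using conv_has_derivative[OF w g(2)] differentiableI by blast
  show "pd v g \<in> conv w ` Collect (test_fun E)" for v
  proof -
    have "pd v g = conv w (pd v \<sigma>)"
      unfolding g(1) using pd_eqI[OF conv_has_derivative[OF w g(2)]] by blast
    then show ?thesis using test_fun_pd[OF g(2)] by blast
  qed
qed

definition mollifier :: "real \<Rightarrow> ('a::euclidean_space \<Rightarrow> real) \<Rightarrow> bool" where
  "mollifier \<kappa> \<rho> \<longleftrightarrow> test_fun UNIV \<rho> \<and> (\<forall>x. \<rho> x \<ge> 0) \<and> (\<forall>x. norm x \<ge> \<kappa> \<longrightarrow> \<rho> x = 0) \<and> (LINT x|lborel. \<rho> x) = 1"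

lemma mollifier_exists:
  assumes "\<kappa> > 0"
  shows "\<exists>\<rho>::'a::euclidean_space \<Rightarrow> real. mollifier \<kappa> \<rho>"
proof -
  obtain \<rho> :: "'a \<Rightarrow> real" where \<rho>: "smooth_fun \<rho>" "\<And>x. \<rho> x \<ge> 0" "\<And>x. norm x \<ge> \<kappa> \<Longrightarrow> \<rho> x = 0" "\<rho> 0 > 0"
    using smooth_bump_exists[OF assms] by metis
  have cont: "continuous_on S \<rho>" for S using \<rho>(1) by (rule continuous_on_smooth_fun)
  have Cc: "Cc UNIV \<rho>" using \<rho>(3) by (intro Cc_intro[of _ "cball 0 \<kappa>"] cont) auto
  let ?I = "LINT x|lborel. \<rho> x"
  have "isCont \<rho> 0" using cont[of UNIV] by (simp add: continuous_on_eq_continuous_at)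
  from this[unfolded continuous_at_eps_delta, rule_format, of "\<rho> 0 / 2"] \<rho>(4) obtain d where
    d: "d > 0" "\<And>x. dist x 0 < d \<Longrightarrow> dist (\<rho> x) (\<rho> 0) < \<rho> 0 / 2" by auto
  have fin: "emeasure lborel (ball (0::'a) d) < \<infinity>" using emeasure_lborel_ball_finite[of 0 d] by (simp add: less_top)
  have "0 < \<rho> 0 / 2 * measure lborel (ball (0::'a) d)"
    using \<rho>(4) content_ball_pos[OF d(1), of "0::'a"] by simp
  also have "\<dots> = (LINT x|lborel. \<rho> 0 / 2 * indicator (ball (0::'a) d) x)" using fin by simp
  also have "\<dots> \<le> ?I"
  proof (rule integral_mono)
    show "integrable lborel (\<lambda>x. \<rho> 0 / 2 * indicator (ball (0::'a) d) x)" using fin by auto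
    show "integrable lborel \<rho>" using Cc by (rule Cc_integrable)
    fix x show "\<rho> 0 / 2 * indicator (ball 0 d) x \<le> \<rho> x"
    proof (cases "x \<in> ball 0 d")
      case True
      then have "\<bar>\<rho> x - \<rho> 0\<bar> < \<rho> 0 / 2" using d(2)[of x] by (simp add: dist_real_def)
      then have "\<rho> 0 / 2 \<le> \<rho> x" by (simp only: abs_less_iff) linarith
      then show ?thesis using True by simp
    qed (simp add: \<rho>(2))
  qed
  finally have I: "?I > 0" .
  have "mollifier \<kappa> (\<lambda>x. (1 / ?I) * \<rho> x)"
    unfolding mollifier_def test_fun_def
  proof (intro conjI allI impI)
    show "smooth_fun (\<lambda>x. (1 / ?I) * \<rho> x)" "Cc UNIV (\<lambda>x. (1 / ?I) * \<rho> x)"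
      using \<rho>(1) Cc by (intro smooth_fun_cmult Cc_mult continuous_intros; simp)+
    show "(LINT x|lborel. (1 / ?I) * \<rho> x) = 1" using I by (subst integral_mult_right_zero) simp
  qed (use \<rho> I in auto)
  then show ?thesis by blast
qed

lemma mollifierD:
  assumes "mollifier \<kappa> \<rho>"
  shows "test_fun UNIV \<rho>" "\<rho> x \<ge> 0" "norm x \<ge> \<kappa> \<Longrightarrow> \<rho> x = 0" "(LINT x|lborel. \<rho> x) = 1"
    "continuous_on S \<rho>" "integrable lborel \<rho>"
  using assms by (auto simp: mollifier_def test_fun_def continuous_on_smooth_fun Cc_integrable)

text \<open>A mollified value is a weighted mean of nearby values. The free number c serves several
  purposes: c = w z for approximation, c = 0 and e = 0 for supports, c = e = 1/2 for bounds by 0 and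
  1, c = 1 and e = 0 on a plateau.\<close>

lemma conv_close:
  fixes w :: "'a::euclidean_space \<Rightarrow> real"
  assumes w: "Cc D w" and \<rho>: "mollifier \<kappa> \<rho>" and e: "\<And>y. norm y < \<kappa> \<Longrightarrow> \<bar>w (z - y) - c\<bar> \<le> e"
  shows "\<bar>conv w \<rho> z - c\<bar> \<le> e"
proof -
  have cw: "continuous_on UNIV w" using w by (rule Cc_continuous)
  have "Cc UNIV (\<lambda>y. w (z - y) * \<rho> y)" 
    using mollifierD(1)[OF \<rho>] by (intro Cc_mult continuous_on_compose2[OF cw] continuous_intros) (auto simp: test_fun_def)
  then have int: "integrable lborel (\<lambda>y. w (z - y) * \<rho> y)" by (rule Cc_integrable)
  have "conv w \<rho> z - c = (LINT y|lborel. w (z - y) * \<rho> y) - (LINT y|lborel. c * \<rho> y)"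
    using mollifierD[OF \<rho>] by (simp add: conv_reflect[OF cw mollifierD(5)[OF \<rho>]])
  also have "\<dots> = (LINT y|lborel. w (z - y) * \<rho> y - c * \<rho> y)"
    using int mollifierD(6)[OF \<rho>] by simp
  also have "\<bar>\<dots>\<bar> \<le> (LINT y|lborel. e * \<rho> y)"
    unfolding real_norm_def[symmetric]
  proof (rule order_trans[OF integral_norm_bound integral_mono])
    show "integrable lborel (\<lambda>y. norm (w (z - y) * \<rho> y - c * \<rho> y))" 
      using int mollifierD(6)[OF \<rho>] by simp
    show "integrable lborel (\<lambda>y. e * \<rho> y)" using mollifierD(6)[OF \<rho>] by simp
    fix y
    have "norm (w (z - y) * \<rho> y - c * \<rho> y) = \<bar>w (z - y) - c\<bar> * \<rho> y"
      using mollifierD(2)[OF \<rho>, of y] by (simp add: abs_mult left_diff_distrib[symmetric])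
    also have "\<dots> \<le> e * \<rho> y"
      using e[of y] mollifierD(2,3)[OF \<rho>, of y] by (cases "norm y < \<kappa>") (auto intro: mult_right_mono)
    finally show "norm (w (z - y) * \<rho> y - c * \<rho> y) \<le> e * \<rho> y" .
  qed
  also have "\<dots> = e" using mollifierD(4)[OF \<rho>] by simp
  finally show ?thesis .
qed

lemma conv_nonneg:
  assumes "\<And>x. w x \<ge> 0" "mollifier \<kappa> \<rho>"
  shows "conv w \<rho> z \<ge> 0"
  unfolding conv_def using assms(1) mollifierD(2)[OF assms(2)] by (intro Bochner_Integration.integral_nonneg) auto

lemma smooth_plateau:
  fixes p :: "'a::euclidean_space"
  assumes "0 < s" "s < t"
  shows "\<exists>\<psi>. test_fun (ball p t) \<psi> \<and> (\<forall>x. 0 \<le> \<psi> x \<and> \<psi> x \<le> 1) \<and> (\<forall>x. dist p x \<le> s \<longrightarrow> \<psi> x = 1)"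
proof -
  \<comment> \<open>Four steps of width \<kappa> lead from s to t: \<open>w\<close> is 1 up to s +
    \<kappa> and 0 from s + 2\<kappa> = t - 2\<kappa> on, and mollification moves these bounds by at
    most \<kappa>.\<close>
  define \<kappa> where "\<kappa> = (t - s) / 4"
  have \<kappa>: "\<kappa> > 0" using assms by (simp add: \<kappa>_def)
  obtain \<rho> :: "'a \<Rightarrow> real" where \<rho>: "mollifier \<kappa> \<rho>" using mollifier_exists[OF \<kappa>] by blast
  define w where "w x = max 0 (min 1 ((t - 2 * \<kappa> - dist p x) / \<kappa>))" for x
  have w01: "0 \<le> w x" "w x \<le> 1" for x by (auto simp: w_def)
  have w1: "w x = 1" if "dist p x \<le> s + \<kappa>" for x
  proof -
    have "(t - 2 * \<kappa> - dist p x) / \<kappa> \<ge> 1" using that \<kappa> by (simp add: pos_le_divide_eq) (simp add: \<kappa>_def field_simps)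
    then show ?thesis by (simp add: w_def)
  qed
  have w0: "w x = 0" if "dist p x \<ge> t - 2 * \<kappa>" for x
    using that \<kappa> by (simp add: w_def divide_nonpos_pos)
  have w: "Cc UNIV w"
    using w0 \<kappa> by (intro Cc_intro[of _ "cball p (t - 2 * \<kappa>)"]) (auto simp: w_def[abs_def] intro!: continuous_intros)
  let ?\<psi> = "conv w \<rho>"
  have sm: "smooth_fun ?\<psi>" using smooth_conv[OF w mollifierD(1)[OF \<rho>]] .
  have z: "?\<psi> x = 0" if "x \<notin> cball p (t - \<kappa>)" for x
  proof -
    have "\<bar>w (x - y) - 0\<bar> \<le> 0" if "norm y < \<kappa>" for y
      using w0[of "x - y"] \<open>x \<notin> _\<close> that norm_triangle_ineq4[of "x - p" y] norm_triangle_ineq2[of "x - p" y]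
      by (auto simp: dist_norm norm_minus_commute algebra_simps)
    from conv_close[OF w \<rho> this] show ?thesis by simp
  qed
  have "test_fun (ball p t) ?\<psi>" unfolding test_fun_def
    using \<kappa> z by (intro conjI sm Cc_intro[of _ "cball p (t - \<kappa>)"] continuous_on_smooth_fun) auto
  moreover have "?\<psi> x \<ge> 0" for x using conv_nonneg[OF _ \<rho>] w01 by blast
  moreover have "?\<psi> x \<le> 1" for x
  proof -
    have "\<bar>w (x - y) - 1/2\<bar> \<le> 1/2" for y using w01[of "x - y"] by (simp only: abs_le_iff) linarith
    from conv_close[OF w \<rho> this] show ?thesis by (simp only: abs_le_iff) linarith
  qed
  moreover have "?\<psi> x = 1" if "dist p x \<le> s" for x
  proof -
    have "\<bar>w (x - y) - 1\<bar> \<le> 0" if "norm y < \<kappa>" for y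
      using w1[of "x - y"] \<open>dist p x \<le> s\<close> that norm_triangle_ineq4[of "x - p" y]
      by (auto simp: dist_norm norm_minus_commute algebra_simps)
    from conv_close[OF w \<rho> this] show ?thesis by simp
  qed
  ultimately show ?thesis by blast
qed

text \<open>The compact set is chosen before e, so that one constant of the order 0 bound serves all
  approximants.\<close>

lemma smooth_approx_nonneg:
  fixes w :: "'a::euclidean_space \<Rightarrow> real"
  assumes w: "Cc D w" "\<And>x. w x \<ge> 0" and D: "open D"
  shows "\<exists>K. compact K \<and> K \<subseteq> D \<and> supp w \<subseteq> K \<and>
     (\<forall>e>0. \<exists>f. test_fun D f \<and> supp f \<subseteq> K \<and> (\<forall>x. f x \<ge> 0 \<and> \<bar>f x - w x\<bar> \<le> e))"
proof -
  have "compact (supp w)" "supp w \<subseteq> D" using w by (auto simp: Cc_def)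
  then obtain r where r: "r > 0" "\<And>x. x \<in> supp w \<Longrightarrow> cball x r \<subseteq> D"
    using compact_subset_open_imp_cball_epsilon_subset[OF _ D] by (metis UN_subset_iff)
  define K where "K = {x + y |x y. x \<in> supp w \<and> y \<in> cball 0 r}"
  have K: "compact K" unfolding K_def using \<open>compact (supp w)\<close> by (intro compact_sums) auto
  have KD: "K \<subseteq> D"
    unfolding K_def
  proof clarify
    fix x y :: 'a assume "x \<in> supp w" "y \<in> cball 0 r"
    then show "x + y \<in> D" using r(2)[of x] by (auto simp: dist_norm subset_eq)
  qed
  have "\<exists>f. test_fun D f \<and> supp f \<subseteq> K \<and> (\<forall>x. f x \<ge> 0 \<and> \<bar>f x - w x\<bar> \<le> e)" if "e > 0" for e
  proof -
    obtain d where d: "d > 0" "\<And>x y :: 'a. dist x y < d \<Longrightarrow> \<bar>w x - w y\<bar> < e"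
      using Cc_uniform_modulus[OF w(1) \<open>e > 0\<close>] by blast
    let ?\<kappa> = "min d r"
    have \<kappa>: "?\<kappa> > 0" using d r by simp
    obtain \<rho> :: "'a \<Rightarrow> real" where \<rho>: "mollifier ?\<kappa> \<rho>" using mollifier_exists[OF \<kappa>] by blast
    let ?f = "conv w \<rho>"
    have sm: "smooth_fun ?f" using smooth_conv[OF w(1) mollifierD(1)[OF \<rho>]] .
    have z: "?f x = 0" if "x \<notin> K" for x
    proof -
      have "\<bar>w (x - y) - 0\<bar> \<le> 0" if "norm y < ?\<kappa>" for y
      proof -
        have "x - y \<notin> supp w"
        proof
          assume "x - y \<in> supp w"
          moreover have "x = (x - y) + y" "y \<in> cball 0 r" using that by auto
          ultimately show False using \<open>x \<notin> K\<close> unfolding K_def by blast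
        qed
        then show ?thesis by (simp add: supp_zero)
      qed
      from conv_close[OF w(1) \<rho> this] show ?thesis by simp
    qed
    have "test_fun D ?f" unfolding test_fun_def
      using K KD z by (intro conjI sm Cc_intro[of _ K] continuous_on_smooth_fun) auto
    moreover have "supp ?f \<subseteq> K" using K z by (intro supp_subset compact_imp_closed) auto
    moreover have "?f x \<ge> 0" for x using conv_nonneg[OF _ \<rho>] w(2) by blast
    moreover have "\<bar>?f x - w x\<bar> \<le> e" for x
    proof (rule conv_close[OF w(1) \<rho>])
      fix y :: 'a assume "norm y < ?\<kappa>"
      then show "\<bar>w (x - y) - w x\<bar> \<le> e" using d(2)[of "x - y" x] by (simp add: dist_norm)
    qed
    ultimately show ?thesis by blast
  qed
  moreover have "supp w \<subseteq> K" 
  proof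
    fix x assume "x \<in> supp w"
    moreover have "x = x + 0" "(0::'a) \<in> cball 0 r" using r(1) by simp_all
    ultimately show "x \<in> K" unfolding K_def by blast
  qed
  ultimately show ?thesis using K KD by blast
qed

section \<open>The sub-mean value property\<close>

lemma norm_scaleC: "norm (c *s v) = cmod c * norm (v::complex^'n)"
  unfolding norm_vec_def by (simp add: norm_mult L2_set_right_distrib)

text \<open>A single disc of the plurisubharmonicity condition, for real functions and without
  extended reals, so that it can be imposed on selected discs only.\<close>

definition submean :: "(complex^'n \<Rightarrow> real) \<Rightarrow> complex^'n \<Rightarrow> complex^'n \<Rightarrow> bool" where
  "submean w z v \<longleftrightarrow> 2 * pi * w z \<le> integral {0..2 * pi} (\<lambda>t. w (z + cis t *s v))"

lemma continuous_on_circle [continuous_intros]: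
  fixes v :: "complex^'n"
  shows "continuous_on S f \<Longrightarrow> continuous_on S (\<lambda>t. cis (f t) *s v)"
  unfolding continuous_on_componentwise[where 'a="complex^'n"] continuous_on_vec_lambda 
  by (simp add: vector_scalar_mult_def) (intro continuous_intros)

lemma circle_quadratic:
  "((\<lambda>t. a * cos t + b * sin t + A * (cos t)\<^sup>2 + 2 * B * (cos t * sin t) + C * (sin t)\<^sup>2 + e)
     has_integral (pi * (A + C) + 2 * pi * e)) {0..2 * pi}"
proof -
  \<comment> \<open>An explicit antiderivative; over a full period only the two squares and the
    constant contribute.\<close>
  define G where "G t = a * sin t - b * cos t + A * (t / 2 + sin t * cos t / 2) + B * (sin t)\<^sup>2
      + C * (t / 2 - sin t * cos t / 2) + e * t" for t
  have "(G has_vector_derivative (a * cos t + b * sin t + A * (cos t)\<^sup>2 + 2 * B * (cos t * sin t) + C * (sin t)\<^sup>2 + e))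
      (at t within {0..2 * pi})" for t
  proof -
    have s: "(sin t)\<^sup>2 = 1 - (cos t)\<^sup>2" by (simp add: sin_squared_eq)
    have "(G has_real_derivative (a * cos t + b * sin t + A * (1 / 2 + ((cos t)\<^sup>2 - (sin t)\<^sup>2) / 2)
        + B * (2 * sin t * cos t) + C * (1 / 2 - ((cos t)\<^sup>2 - (sin t)\<^sup>2) / 2) + e)) (at t within {0..2 * pi})"
      unfolding G_def by (auto intro!: derivative_eq_intros simp: power2_eq_square field_simps)
    also have "(a * cos t + b * sin t + A * (1 / 2 + ((cos t)\<^sup>2 - (sin t)\<^sup>2) / 2)
        + B * (2 * sin t * cos t) + C * (1 / 2 - ((cos t)\<^sup>2 - (sin t)\<^sup>2) / 2) + e)
      = (a * cos t + b * sin t + A * (cos t)\<^sup>2 + 2 * B * (cos t * sin t) + C * (sin t)\<^sup>2 + e)"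
      unfolding s by (simp add: field_simps)
    finally show ?thesis by (simp add: has_real_derivative_iff_has_vector_derivative)
  qed
  then have "((\<lambda>t. a * cos t + b * sin t + A * (cos t)\<^sup>2 + 2 * B * (cos t * sin t) + C * (sin t)\<^sup>2 + e)
     has_integral (G (2 * pi) - G 0)) {0..2 * pi}"
    by (intro fundamental_theorem_of_calculus) auto
  moreover have "G (2 * pi) - G 0 = pi * (A + C) + 2 * pi * e"
    by (simp add: G_def algebra_simps)
  ultimately show ?thesis by simp
qed

lemma submean_cong:
  assumes "\<And>y. dist z y \<le> norm v \<Longrightarrow> w y = w' y" "submean w z v"
  shows "submean w' z v"
proof -
  have "w (z + cis t *s v) = w' (z + cis t *s v)" for t
    by (rule assms(1)) (simp add: dist_norm norm_scaleC)
  with assms(1)[of z] assms(2) show ?thesis by (simp add: submean_def)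
qed

text \<open>The convolution averages translates of \<open>w\<close> with nonnegative weights, and
  averaging commutes with the circle mean. Restricting to a box around the support of \<rho> makes
  Fubini for continuous integrands applicable.\<close>

lemma conv_submean:
  fixes w :: "complex^'n::finite \<Rightarrow> real"
  assumes w: "Cc D w" and \<rho>: "mollifier \<kappa> \<rho>" and sub: "\<And>y. norm y < \<kappa> \<Longrightarrow> submean w (z - y) v"
  shows "submean (conv w \<rho>) z v"
proof -
  obtain c :: "complex^'n" where c: "cball 0 \<kappa> \<subseteq> cbox (- c) c"
    using bounded_subset_cbox_symmetric[OF bounded_cball] by blast
  let ?B = "cbox (- c) c"
  have cw: "continuous_on S w" for S using w by (rule Cc_continuous)
  have c\<rho>: "continuous_on S \<rho>" for S using \<rho> by (rule mollifierD)
  have cF: "continuous_on S (\<lambda>y. w (x - y) * \<rho> y)" for S x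
    by (intro continuous_intros c\<rho> continuous_on_compose2[OF cw[of UNIV]]) auto
  have conv_eq: "conv w \<rho> x = integral ?B (\<lambda>y. w (x - y) * \<rho> y)" for x
  proof -
    have "Cc UNIV (\<lambda>y. w (x - y) * \<rho> y)"
      using mollifierD(3)[OF \<rho>] by (intro Cc_intro[of _ "cball 0 \<kappa>"] cF) auto
    then have "conv w \<rho> x = integral UNIV (\<lambda>y. w (x - y) * \<rho> y)"
      by (subst integral_lborel[OF Cc_integrable]) (simp_all add: conv_reflect[OF cw c\<rho>])
    also have "(\<lambda>y. w (x - y) * \<rho> y) = (\<lambda>y. if y \<in> ?B then w (x - y) * \<rho> y else 0)"
    proof
      fix y show "w (x - y) * \<rho> y = (if y \<in> ?B then w (x - y) * \<rho> y else 0)"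
        using c mollifierD(3)[OF \<rho>, of y] by (cases "norm y \<le> \<kappa>") auto
    qed
    finally show ?thesis by (simp only: integral_restrict_UNIV)
  qed
  let ?F = "\<lambda>t y. w (z + cis t *s v - y) * \<rho> y"
  have cont2: "continuous_on S (\<lambda>p. ?F (fst p) (snd p))" for S
    by (intro continuous_intros continuous_on_compose2[OF cw[of UNIV]] continuous_on_compose2[OF c\<rho>[of UNIV]]) auto
  have swap: "integral {0..2 * pi} (\<lambda>t. integral ?B (?F t)) = integral ?B (\<lambda>y. integral {0..2 * pi} (\<lambda>t. ?F t y))"
    using integral_swap_continuous[of 0 "- c" "2 * pi" c ?F] cont2 by (simp add: case_prod_unfold)
  have "continuous_on (cbox (- c, 0) (c, 2 * pi)) (\<lambda>p. ?F (snd p) (fst p))"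
    by (intro continuous_intros continuous_on_compose2[OF cw[of UNIV]] continuous_on_compose2[OF c\<rho>[of UNIV]]) auto
  from integral_integrable_2dim[OF this]
  have int: "(\<lambda>y. integral {0..2 * pi} (\<lambda>t. ?F t y)) integrable_on ?B" by simp
  have "2 * pi * conv w \<rho> z = integral ?B (\<lambda>y. 2 * pi * (w (z - y) * \<rho> y))"
    unfolding conv_eq by (rule integral_mult_right[symmetric])
  also have "\<dots> \<le> integral ?B (\<lambda>y. integral {0..2 * pi} (\<lambda>t. ?F t y))"
  proof (rule integral_le)
    show "(\<lambda>y. 2 * pi * (w (z - y) * \<rho> y)) integrable_on ?B"
      by (intro integrable_continuous continuous_on_mult continuous_on_const cF)
    show "(\<lambda>y. integral {0..2 * pi} (\<lambda>t. ?F t y)) integrable_on ?B" by (rule int)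
    fix y
    show "2 * pi * (w (z - y) * \<rho> y) \<le> integral {0..2 * pi} (\<lambda>t. ?F t y)"
    proof (cases "norm y < \<kappa>")
      case True
      have "2 * pi * w (z - y) * \<rho> y \<le> integral {0..2 * pi} (\<lambda>t. w (z - y + cis t *s v)) * \<rho> y"
        using sub[OF True] mollifierD(2)[OF \<rho>] unfolding submean_def by (intro mult_right_mono) auto
      also have "\<dots> = integral {0..2 * pi} (\<lambda>t. ?F t y)"
        by (subst integral_mult_left[symmetric]) (simp add: algebra_simps)
      finally show ?thesis by (simp add: mult.assoc)
    next
      case False
      then show ?thesis using mollifierD(3)[OF \<rho>, of y] by simp
    qed
  qed
  also have "\<dots> = integral {0..2 * pi} (\<lambda>t. conv w \<rho> (z + cis t *s v))"
    unfolding conv_eq by (rule swap[symmetric])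
  finally show ?thesis by (simp add: submean_def)
qed

lemma cis_scale: "cis t *s v = cos t *\<^sub>R v + sin t *\<^sub>R (\<i> *s v)" for v :: "complex^'n"
  by (subst complex_scale_real) simp

lemma pd2_circle:
  fixes f :: "complex^'n \<Rightarrow> real"
  assumes f: "smooth_fun f"
  defines "A \<equiv> \<lambda>v w. pd v (pd w f)"
  shows "pd (cis t *s v) (pd (cis t *s v) f) x =
    (cos t)\<^sup>2 * A v v x + 2 * (cos t * sin t) * A v (\<i> *s v) x + (sin t)\<^sup>2 * A (\<i> *s v) (\<i> *s v) x"
proof -
  have d: "g differentiable at x" if "smooth_fun g" for g x using that by (rule smooth_fun_differentiable)
  have "pd (cis t *s v) f = (\<lambda>x. cos t * pd v f x + sin t * pd (\<i> *s v) f x)"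
    unfolding cis_scale by (rule ext)
      (simp add: linear_add[OF linear_pd[OF d[OF f]]] linear_scale[OF linear_pd[OF d[OF f]]])
  moreover have "pd u (\<lambda>x. cos t * pd v f x + sin t * pd (\<i> *s v) f x) x = cos t * A u v x + sin t * A u (\<i> *s v) x" for u
    unfolding A_def by (subst pd_add) (auto intro!: d smooth_fun_cmult smooth_fun_pd f simp: pd_cmult d smooth_fun_pd f)
  moreover have "A (cis t *s v) u x = cos t * A v u x + sin t * A (\<i> *s v) u x" for u
    unfolding A_def cis_scale
    by (simp add: linear_add[OF linear_pd[OF d[OF smooth_fun_pd[OF f]]]] linear_scale[OF linear_pd[OF d[OF smooth_fun_pd[OF f]]]])
  moreover have "A (\<i> *s v) v = A v (\<i> *s v)" unfolding A_def by (rule pd_commute[OF f])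
  ultimately show ?thesis by (simp add: power2_eq_square algebra_simps)
qed

text \<open>On a circle of radius s the linear and mixed terms of the second order Taylor polynomial
  have mean 0, and the squares have mean s^2/4 times the Levi form. A negative Levi form would thus
  violate the sub-mean inequality for small s.\<close>

lemma Levi_nonneg_of_submean:
  fixes f :: "complex^'n::finite \<Rightarrow> real"
  assumes f: "smooth_fun f" and r: "r > 0" and sub: "\<And>v. norm v < r \<Longrightarrow> submean f z v"
  shows "pd v (pd v f) z + pd (\<i> *s v) (pd (\<i> *s v) f) z \<ge> 0"
proof (rule field_le_epsilon)
  fix e :: real assume "e > 0"
  have d: "g differentiable at x" if "smooth_fun g" for g and x :: "complex^'n"
    using that by (rule smooth_fun_differentiable)
  define A where "A u w = pd u (pd w f)" for u w
  define w where "w t = cis t *s v" for t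
  have cont: "isCont (A a b) z" for a b
    unfolding A_def by (meson differentiable_imp_continuous_within smooth_fun_differentiable smooth_fun_pd f)
  \<comment> \<open>On the circle the three second derivatives have weights of modulus at most 1, 2
    and 1, so errors of e/8 add up to e/2.\<close>
  have "\<exists>\<delta>>0. \<forall>x. dist x z < \<delta> \<longrightarrow> \<bar>A a b x - A a b z\<bar> < e / 8" for a b
    using cont[of a b] \<open>e > 0\<close> unfolding continuous_at_eps_delta dist_real_def
    by (metis divide_pos_pos zero_less_numeral)
  then obtain \<delta> where \<delta>: "\<And>a b. \<delta> a b > 0" "\<And>a b x. dist x z < \<delta> a b \<Longrightarrow> \<bar>A a b x - A a b z\<bar> < e / 8" by metis
  define \<eta> where "\<eta> = min (min (\<delta> v v) (\<delta> v (\<i> *s v))) (\<delta> (\<i> *s v) (\<i> *s v))"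
  have \<eta>: "\<eta> > 0" using \<delta>(1) by (simp add: \<eta>_def)
  \<comment> \<open>The added 1 covers v = 0; s is then small enough for the whole circle to stay
    where the estimates hold.\<close>
  define c where "c = norm v + 1"
  have c: "c > 0" "norm v \<le> c" using norm_ge_zero[of v] unfolding c_def by linarith+
  define s where "s = min \<eta> r / (2 * c)"
  have s0: "s > 0" using \<eta> r c by (simp add: s_def)
  have sv: "s * norm v < min \<eta> r"
  proof -
    have "s * norm v \<le> s * c" using s0 c by simp
    also have "\<dots> = min \<eta> r / 2" unfolding s_def using c by simp
    also have "\<dots> < min \<eta> r" using \<eta> r by (auto simp: min_def)
    finally show ?thesis .
  qed
  have w_norm: "norm (w t) = norm v" for t by (simp add: w_def norm_scaleC)
  have pt: "f (z + s *\<^sub>R w t) \<le> f z + s * pd (w t) f z + s\<^sup>2 / 2 * (A (w t) (w t) z + e / 2)" for t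
  proof -
    define \<phi> where "\<phi> m = (if m = 0 then (\<lambda>h. f (z + h *\<^sub>R w t)) else if m = Suc 0 then (\<lambda>h. pd (w t) f (z + h *\<^sub>R w t))
        else (\<lambda>h. A (w t) (w t) (z + h *\<^sub>R w t)))" for m
    have D0: "((\<lambda>h. f (z + h *\<^sub>R w t)) has_real_derivative pd (w t) f (z + h *\<^sub>R w t)) (at h)" for h
      by (intro DERIV_along_line d f)
    have D1: "((\<lambda>h. pd (w t) f (z + h *\<^sub>R w t)) has_real_derivative A (w t) (w t) (z + h *\<^sub>R w t)) (at h)" for h
      unfolding A_def by (intro DERIV_along_line d smooth_fun_pd f)
    have "\<exists>h. 0 < h \<and> h < s \<and> \<phi> 0 s = (\<Sum>m<2. \<phi> m 0 / fact m * s ^ m) + \<phi> 2 h / fact 2 * s ^ 2"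
    proof (rule Maclaurin[OF s0])
      show "\<forall>m h. m < 2 \<and> 0 \<le> h \<and> h \<le> s \<longrightarrow> (\<phi> m has_real_derivative \<phi> (Suc m) h) (at h)"
        using D0 D1 by (auto simp: \<phi>_def less_2_cases_iff)
    qed auto
    then obtain h where h: "0 < h" "h < s"
      "f (z + s *\<^sub>R w t) = f z + s * pd (w t) f z + s\<^sup>2 / 2 * A (w t) (w t) (z + h *\<^sub>R w t)"
      by (auto simp: \<phi>_def eval_nat_numeral algebra_simps)
    let ?x = "z + h *\<^sub>R w t"
    have "dist ?x z = h * norm v" using h by (simp add: dist_norm w_norm)
    also have "\<dots> \<le> s * norm v" using h by (intro mult_right_mono) auto
    finally have "dist ?x z < \<eta>" using sv by simp
    then have bd: "\<bar>A v v ?x - A v v z\<bar> \<le> e / 8" "\<bar>A v (\<i> *s v) ?x - A v (\<i> *s v) z\<bar> \<le> e / 8"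
      "\<bar>A (\<i> *s v) (\<i> *s v) ?x - A (\<i> *s v) (\<i> *s v) z\<bar> \<le> e / 8"
      using \<delta>(2)[of ?x] by (auto simp: \<eta>_def intro: less_imp_le)
    have co: "\<bar>(cos t)\<^sup>2\<bar> \<le> 1" "\<bar>2 * (cos t * sin t)\<bar> \<le> 2" "\<bar>(sin t)\<^sup>2\<bar> \<le> 1"
      using abs_cos_le_one[of t] abs_sin_le_one[of t] mult_mono[of "\<bar>cos t\<bar>" 1 "\<bar>sin t\<bar>" 1]
      by (auto simp: abs_mult abs_square_le_1)
    have "A (w t) (w t) ?x - A (w t) (w t) z = (cos t)\<^sup>2 * (A v v ?x - A v v z)
       + 2 * (cos t * sin t) * (A v (\<i> *s v) ?x - A v (\<i> *s v) z)
       + (sin t)\<^sup>2 * (A (\<i> *s v) (\<i> *s v) ?x - A (\<i> *s v) (\<i> *s v) z)"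
      unfolding A_def w_def pd2_circle[OF f] by (simp add: algebra_simps)
    also have "\<bar>\<dots>\<bar> \<le> 1 * (e / 8) + 2 * (e / 8) + 1 * (e / 8)"
      by (intro order_trans[OF abs_triangle_ineq] add_mono; (subst abs_mult)?; intro mult_mono bd co order_trans[OF abs_triangle_ineq] add_mono) (simp_all add: abs_mult)
    finally have "A (w t) (w t) ?x \<le> A (w t) (w t) z + e / 2" by linarith
    then show ?thesis unfolding h(3) by (simp add: mult_left_mono)
  qed
  have lin: "pd (w t) f z = cos t * pd v f z + sin t * pd (\<i> *s v) f z" for t
    unfolding w_def cis_scale by (simp add: linear_add[OF linear_pd[OF d[OF f]]] linear_scale[OF linear_pd[OF d[OF f]]])
  have sw: "s *\<^sub>R w t = cis t *s (s *\<^sub>R v)" for t by (simp add: w_def vec_eq_iff scaleR_conv_of_real)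
  have "norm (s *\<^sub>R v) < r" using sv s0 by simp
  from sub[OF this] have "2 * pi * f z \<le> integral {0..2 * pi} (\<lambda>t. f (z + s *\<^sub>R w t))"
    by (simp add: submean_def sw)
  also have "\<dots> \<le> integral {0..2 * pi} (\<lambda>t. s * pd v f z * cos t + s * pd (\<i> *s v) f z * sin t + s\<^sup>2 / 2 * A v v z * (cos t)\<^sup>2
      + 2 * (s\<^sup>2 / 2 * A v (\<i> *s v) z) * (cos t * sin t) + s\<^sup>2 / 2 * A (\<i> *s v) (\<i> *s v) z * (sin t)\<^sup>2 + (f z + s\<^sup>2 / 2 * (e / 2)))"
    (is "_ \<le> integral _ ?g")
  proof (rule integral_le)
    show "(\<lambda>t. f (z + s *\<^sub>R w t)) integrable_on {0..2 * pi}"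
      unfolding sw by (intro integrable_continuous_real continuous_on_compose2[OF continuous_on_smooth_fun[OF f, of UNIV]] continuous_intros) auto
    show "?g integrable_on {0..2 * pi}" using circle_quadratic by (rule has_integral_integrable)
    fix t show "f (z + s *\<^sub>R w t) \<le> ?g t"
      using pt[of t] unfolding lin unfolding A_def w_def pd2_circle[OF f] by (simp add: algebra_simps)
  qed
  also have "\<dots> = pi * (s\<^sup>2 / 2 * A v v z + s\<^sup>2 / 2 * A (\<i> *s v) (\<i> *s v) z) + 2 * pi * (f z + s\<^sup>2 / 2 * (e / 2))"
    using circle_quadratic by (rule integral_unique)
  finally have "0 \<le> (pi * s\<^sup>2 / 2) * (A v v z + A (\<i> *s v) (\<i> *s v) z + e)" by (simp add: algebra_simps)
  then have "0 \<le> A v v z + A (\<i> *s v) (\<i> *s v) z + e"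
    using mult_pos_neg[of "pi * s\<^sup>2 / 2"] s0 by (metis half_gt_zero mult_pos_pos not_le pi_gt_zero zero_less_power)
  then show "0 \<le> pd v (pd v f) z + pd (\<i> *s v) (pd (\<i> *s v) f) z + e" by (simp add: A_def)
qed

lemma continuous_extension_Cc:
  fixes w :: "'a::euclidean_space \<Rightarrow> real"
  assumes "compact K" "continuous_on K w"
  shows "\<exists>w'. Cc UNIV w' \<and> (\<forall>x\<in>K. w' x = w x)"
proof (cases "K = {}")
  case True
  then show ?thesis by (intro exI[of _ "\<lambda>x. 0"]) (auto intro: Cc_intro[of _ "{}"])
next
  case False
  have "closedin (top_of_set UNIV) K" using assms(1) by (simp add: compact_imp_closed)
  then obtain g where g: "continuous_on UNIV g" "\<And>x. x \<in> K \<Longrightarrow> g x = w x"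
    using Tietze_unbounded[OF assms(2)] by blast
  let ?w = "\<lambda>x. g x * max 0 (1 - infdist x K)"
  have "bounded K" using assms(1) by (rule compact_imp_bounded)
  then obtain R where R: "\<And>x. x \<in> K \<Longrightarrow> norm x \<le> R" by (auto simp: bounded_iff)
  have "Cc UNIV ?w"
  proof (rule Cc_intro[of _ "cball 0 (R + 1)"])
    show "continuous_on UNIV ?w" by (intro continuous_intros g(1))
    fix x :: 'a assume x: "x \<notin> cball 0 (R + 1)"
    obtain y where y: "y \<in> K" "infdist x K = dist x y"
      using infdist_attains_inf[OF compact_imp_closed[OF assms(1)] False] by blast
    have "norm x \<le> norm y + dist x y" using norm_triangle_ineq2[of x y] by (simp add: dist_norm)
    with x y(1) R[of y] have "dist x y \<ge> 1" by auto
    with y show "?w x = 0" by simp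
  qed auto
  moreover have "?w x = w x" if "x \<in> K" for x using that g(2) by (simp add: infdist_zero)
  ultimately show ?thesis by blast
qed

text \<open>Mollification preserves the sub-mean inequality, which for a smooth function yields a
  nonnegative Levi form. The radius 2r is the sum of the shift by the mollifier and the radius of
  the disc.\<close>

lemma smooth_psh_approx:
  fixes w :: "complex^'n::finite \<Rightarrow> real"
  assumes K: "compact K" and r: "r > 0"
    and cont: "continuous_on {x + y |x y. x \<in> K \<and> y \<in> cball 0 (2 * r)} w"
    and sub: "\<And>x y v. x \<in> K \<Longrightarrow> norm y < r \<Longrightarrow> norm v < r \<Longrightarrow> submean w (x + y) v"
    and e: "e > 0"
  shows "\<exists>f. smooth_fun f \<and> (\<forall>x\<in>K. \<bar>f x - w x\<bar> \<le> e) \<and>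
    (\<forall>x\<in>K. \<forall>v. pd v (pd v f) x + pd (\<i> *s v) (pd (\<i> *s v) f) x \<ge> 0)"
proof -
  define L where "L = {x + y |x y. x \<in> K \<and> y \<in> cball 0 (2 * r)}"
  have L: "compact L" unfolding L_def using K by (intro compact_sums) auto
  have inL: "x + y \<in> L" if "x \<in> K" "norm y \<le> 2 * r" for x y
    unfolding L_def using that by auto
  obtain w' where w': "Cc UNIV w'" "\<And>x. x \<in> L \<Longrightarrow> w' x = w x"
    using continuous_extension_Cc[OF L cont[folded L_def]] by blast
  obtain d where d: "d > 0" "\<And>x y. dist x y < d \<Longrightarrow> \<bar>w' x - w' y\<bar> < e"
    using Cc_uniform_modulus[OF w'(1) e] by blast
  let ?\<kappa> = "min d r"
  have \<kappa>: "?\<kappa> > 0" using d r by simp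
  obtain \<rho> :: "complex^'n \<Rightarrow> real" where \<rho>: "mollifier ?\<kappa> \<rho>" using mollifier_exists[OF \<kappa>] by blast
  let ?f = "conv w' \<rho>"
  have sm: "smooth_fun ?f" using smooth_conv[OF w'(1) mollifierD(1)[OF \<rho>]] .
  have "\<bar>?f x - w x\<bar> \<le> e" if "x \<in> K" for x
  proof (rule conv_close[OF w'(1) \<rho>])
    fix y :: "complex^'n" assume "norm y < ?\<kappa>"
    moreover have "w' x = w x" using inL[OF that, of 0] r w'(2) by simp
    ultimately show "\<bar>w' (x - y) - w x\<bar> \<le> e" using d(2)[of "x - y" x] by (simp add: dist_norm)
  qed
  moreover have "pd v (pd v ?f) x + pd (\<i> *s v) (pd (\<i> *s v) ?f) x \<ge> 0" if "x \<in> K" for x v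
  proof (rule Levi_nonneg_of_submean[OF sm r])
    fix v :: "complex^'n" assume v: "norm v < r"
    show "submean ?f x v"
    proof (rule conv_submean[OF w'(1) \<rho>])
      fix y :: "complex^'n" assume y: "norm y < ?\<kappa>"
      show "submean w' (x - y) v"
      proof (rule submean_cong)
        show "submean w (x - y) v" using sub[OF that, of "- y" v] y v by simp
        fix u assume "dist (x - y) u \<le> norm v"
        then have "norm (u - x) \<le> norm v + norm y"
          using norm_triangle_ineq4[of "u - (x - y)" y] by (simp add: dist_norm norm_minus_commute algebra_simps)
        then have "x + (u - x) \<in> L" using y v by (intro inL[OF that]) linarith
        then show "w u = w' u" using w'(2) by simp
      qed
    qed
  qed
  ultimately show ?thesis using sm by blast
qed

section \<open>Forms, currents and the operator \<open>dd\<^sup>c\<close>\<close>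

definition hess :: "'a::real_normed_vector \<times> 'a \<Rightarrow> ('a \<Rightarrow> real) \<Rightarrow> 'a \<Rightarrow> real" where
  "hess q f = pd (snd q) (pd (fst q) f)"

text \<open>The covector that accompanies \<open>hess q f\<close> in dd^c of a function times
  \<open>\<Gamma>\<close>: d^c contributes \<open>\<i> *s fst q\<close>, the outer d contributes
  \<open>snd q\<close>.\<close>

definition wedge2 :: "(complex^'n) \<times> (complex^'n) \<Rightarrow> ((complex^'n) list \<Rightarrow> real) \<Rightarrow> (complex^'n) list \<Rightarrow> real" where
  "wedge2 q \<Gamma> = wedge1 (snd q) (wedge1 (\<i> *s fst q) \<Gamma>)"

abbreviation Basis2 :: "('a::euclidean_space \<times> 'a) set" where
  "Basis2 \<equiv> Basis \<times> Basis"

lemma sum_Times: "(\<Sum>p\<in>A \<times> B. F p) = (\<Sum>a\<in>A. \<Sum>b\<in>B. F (a, b))"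
  by (simp add: sum.cartesian_product)

text \<open>Derivatives of forms are only computed for finite sums of functions times constant
  covectors; on these d acts on the functions alone, and the vector slots are handled by
  \<open>wedge1\<close>.\<close>

lemma ext_deriv_sum:
  fixes f :: "'i \<Rightarrow> 'a::euclidean_space \<Rightarrow> real"
  assumes "\<And>i. i \<in> I \<Longrightarrow> f i differentiable at z"
  shows "ext_deriv (\<lambda>z vs. \<Sum>i\<in>I. f i z * \<Gamma> i vs) z vs = (\<Sum>i\<in>I. \<Sum>b\<in>Basis. pd b (f i) z * wedge1 b (\<Gamma> i) vs)"
proof -
  have "pd v (\<lambda>x. \<Sum>i\<in>I. f i x * c i) z = (\<Sum>i\<in>I. \<Sum>b\<in>Basis. pd b (f i) z * ((v \<bullet> b) * c i))" for v and c :: "'i \<Rightarrow> real"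
  proof -
    have "pd v (\<lambda>x. \<Sum>i\<in>I. f i x * c i) z = (\<Sum>i\<in>I. c i * pd v (f i) z)"
      using assms by (subst pd_sum) (auto simp: pd_cmult mult.commute[of _ "c _"] intro!: derivative_intros)
    also have "\<dots> = (\<Sum>i\<in>I. \<Sum>b\<in>Basis. pd b (f i) z * ((v \<bullet> b) * c i))"
      using assms by (intro sum.cong refl, subst pd_euclidean) (auto simp: sum_distrib_left algebra_simps)
    finally show ?thesis .
  qed
  then have "ext_deriv (\<lambda>z vs. \<Sum>i\<in>I. f i z * \<Gamma> i vs) z vs = (\<Sum>k<length vs. (- 1) ^ k *
     (\<Sum>i\<in>I. \<Sum>b\<in>Basis. pd b (f i) z * ((vs ! k \<bullet> b) * \<Gamma> i (take k vs @ drop (Suc k) vs))))"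
    unfolding ext_deriv_def pd_def[symmetric] by simp
  also have "\<dots> = (\<Sum>k<length vs. \<Sum>i\<in>I. \<Sum>b\<in>Basis.
      pd b (f i) z * ((- 1) ^ k * (vs ! k \<bullet> b) * \<Gamma> i (take k vs @ drop (Suc k) vs)))"
    by (simp add: sum_distrib_left algebra_simps)
  also have "\<dots> = (\<Sum>i\<in>I. \<Sum>k<length vs. \<Sum>b\<in>Basis.
      pd b (f i) z * ((- 1) ^ k * (vs ! k \<bullet> b) * \<Gamma> i (take k vs @ drop (Suc k) vs)))"
    by (rule sum.swap)
  also have "\<dots> = (\<Sum>i\<in>I. \<Sum>b\<in>Basis. \<Sum>k<length vs.
      pd b (f i) z * ((- 1) ^ k * (vs ! k \<bullet> b) * \<Gamma> i (take k vs @ drop (Suc k) vs)))"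
    by (intro sum.cong refl sum.swap)
  also have "\<dots> = (\<Sum>i\<in>I. \<Sum>b\<in>Basis. pd b (f i) z * wedge1 b (\<Gamma> i) vs)"
    by (simp add: wedge1_def sum_distrib_left)
  finally show ?thesis .
qed

lemma inner_ii_left: "(\<i> *s v) \<bullet> w = - (v \<bullet> (\<i> *s w))" for v w :: "complex^'n"
  unfolding inner_vec_def by (simp add: sum_negf[symmetric] inner_complex_def)

lemma inner_minus_ii: "((- \<i>) *s v) \<bullet> w = v \<bullet> (\<i> *s w)" for v w :: "complex^'n"
  unfolding inner_vec_def by (simp add: inner_complex_def)

text \<open>The inner product moves the rotation by -i from the vectors to the covector, so
  conjugating d by J replaces b by \<open>\<i> *s b\<close>.\<close>

lemma wedge1_pull:
  "wedge1 b (\<lambda>vs. \<Gamma> (map (\<lambda>v. \<i> *s v) vs)) (map (\<lambda>v. (- \<i>) *s v) vs) = wedge1 (\<i> *s b) \<Gamma> (vs :: (complex^'n) list)"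
proof -
  have "map (\<lambda>v. \<i> *s v) (take i (map (\<lambda>v. (- \<i>) *s v) vs) @ drop (Suc i) (map (\<lambda>v. (- \<i>) *s v) vs))
      = take i vs @ drop (Suc i) vs" for i
    by (simp add: take_map drop_map o_def)
  then show ?thesis unfolding wedge1_def
    by (intro sum.cong) (simp_all only: length_map, simp_all only: nth_map inner_minus_ii lessThan_iff)
qed

lemma dc_deriv_sum:
  fixes f :: "'i \<Rightarrow> complex^'n \<Rightarrow> real"
  assumes "\<And>i. i \<in> I \<Longrightarrow> f i differentiable at z"
  shows "dc_deriv (\<lambda>z vs. \<Sum>i\<in>I. f i z * \<Gamma> i vs) z vs = (\<Sum>i\<in>I. \<Sum>b\<in>Basis. pd b (f i) z * wedge1 (\<i> *s b) (\<Gamma> i) vs)"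
proof -
  have "pull_mult \<i> (\<lambda>z vs. \<Sum>i\<in>I. f i z * \<Gamma> i vs) = (\<lambda>z vs. \<Sum>i\<in>I. f i z * (\<lambda>vs. \<Gamma> i (map (\<lambda>v. \<i> *s v) vs)) vs)"
    by (simp add: fun_eq_iff pull_mult_def)
  then show ?thesis unfolding dc_deriv_def
    by (subst pull_mult_def) (simp only: ext_deriv_sum[OF assms] wedge1_pull)
qed

lemma ddc_sum:
  fixes f :: "'i \<Rightarrow> complex^'n \<Rightarrow> real"
  assumes "\<And>i. i \<in> I \<Longrightarrow> smooth_fun (f i)"
  shows "ddc (\<lambda>z vs. \<Sum>i\<in>I. f i z * \<Gamma> i vs) = (\<lambda>z vs. \<Sum>i\<in>I. \<Sum>q\<in>Basis2. hess q (f i) z * wedge2 q (\<Gamma> i) vs)"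
proof (intro ext)
  fix z vs
  have 1: "dc_deriv (\<lambda>z vs. \<Sum>i\<in>I. f i z * \<Gamma> i vs) =
      (\<lambda>z vs. \<Sum>j\<in>I\<times>Basis. pd (snd j) (f (fst j)) z * wedge1 (\<i> *s snd j) (\<Gamma> (fst j)) vs)"
    using assms by (intro ext, subst dc_deriv_sum) (auto simp: smooth_fun_differentiable sum_Times)
  have "ddc (\<lambda>z vs. \<Sum>i\<in>I. f i z * \<Gamma> i vs) z vs = (\<Sum>j\<in>I\<times>Basis. \<Sum>c\<in>Basis. pd c (pd (snd j) (f (fst j))) z *
      wedge1 c (wedge1 (\<i> *s snd j) (\<Gamma> (fst j))) vs)"
    unfolding ddc_def 1 using assms by (intro ext_deriv_sum) (auto simp: smooth_fun_differentiable smooth_fun_pd)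
  also have "\<dots> = (\<Sum>i\<in>I. \<Sum>b\<in>Basis. \<Sum>c\<in>Basis. pd c (pd b (f i)) z * wedge1 c (wedge1 (\<i> *s b) (\<Gamma> i)) vs)"
    by (simp add: sum_Times)
  also have "\<dots> = (\<Sum>i\<in>I. \<Sum>q\<in>Basis2. hess q (f i) z * wedge2 q (\<Gamma> i) vs)"
    by (simp add: sum_Times hess_def wedge2_def)
  finally show "ddc (\<lambda>z vs. \<Sum>i\<in>I. f i z * \<Gamma> i vs) z vs = \<dots>" .
qed

abbreviation cform :: "('a \<Rightarrow> real) \<Rightarrow> ('a list \<Rightarrow> real) \<Rightarrow> 'a dform" where
  "cform f \<Gamma> \<equiv> \<lambda>z vs. f z * \<Gamma> vs"

abbreviation fddc :: "(complex^'n \<Rightarrow> real) \<Rightarrow> (complex^'n \<Rightarrow> real) \<Rightarrow> ((complex^'n) list \<Rightarrow> real) \<Rightarrow> (complex^'n) dform" where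
  "fddc f g \<Gamma> \<equiv> \<lambda>z vs. f z * ddc (cform g \<Gamma>) z vs"

lemma ddc_single:
  fixes f :: "complex^'n \<Rightarrow> real"
  assumes "smooth_fun f"
  shows "ddc (cform f \<Gamma>) = (\<lambda>z vs. \<Sum>q\<in>Basis2. hess q f z * wedge2 q \<Gamma> vs)"
  using ddc_sum[of "{()}" "\<lambda>_. f" "\<lambda>_. \<Gamma>"] assms by simp

lemma alternating_wedge2: "alternating p \<Gamma> \<Longrightarrow> alternating (p + 2) (wedge2 q \<Gamma>)"
  unfolding wedge2_def by (simp add: alternating_wedge1)

lemma alternating_lincomb:
  assumes A: "alternating p \<Gamma>" and B: "alternating p \<Delta>"
  shows "alternating p (\<lambda>vs. a * \<Gamma> vs + b * \<Delta> vs)"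
  unfolding alternating_def
proof (intro conjI allI impI)
  fix us ws :: "'a list" and x y
  show "length us \<noteq> p \<Longrightarrow> a * \<Gamma> us + b * \<Delta> us = 0" by (simp add: alternatingD(1)[OF A] alternatingD(1)[OF B])
  show "linear (\<lambda>v. a * \<Gamma> (v # us) + b * \<Delta> (v # us))"
    using linear_compose_add[OF linear_compose_scale_right[OF alternatingD(2)[OF A], of a]
      linear_compose_scale_right[OF alternatingD(2)[OF B], of b]] by simp
  show "a * \<Gamma> (us @ x # y # ws) + b * \<Delta> (us @ x # y # ws) = - (a * \<Gamma> (us @ y # x # ws) + b * \<Delta> (us @ y # x # ws))"
    using alternatingD(3)[OF A, of us x y ws] alternatingD(3)[OF B, of us x y ws] by simp
qed

lemma alternating_scale: "alternating p \<Gamma> \<Longrightarrow> alternating p (\<lambda>vs. c * \<Gamma> vs)"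
  using alternating_lincomb[of p \<Gamma> \<Gamma> c 0] by simp

lemma alternating_add: "alternating p \<Gamma> \<Longrightarrow> alternating p \<Delta> \<Longrightarrow> alternating p (\<lambda>vs. \<Gamma> vs + \<Delta> vs)"
  using alternating_lincomb[of p \<Gamma> \<Delta> 1 1] by simp

lemma alternating_zero: "alternating p (\<lambda>vs. 0)"
  unfolding alternating_def by (auto intro: linear_zero)

lemma alternating_sum: "(\<And>i. i \<in> I \<Longrightarrow> alternating p (\<Gamma> i)) \<Longrightarrow> alternating p (\<lambda>vs. \<Sum>i\<in>I. c i * \<Gamma> i vs)"
  by (induction I rule: infinite_finite_induct) (simp_all add: alternating_zero alternating_add alternating_scale)

section \<open>Test forms with constant covectors, and currents of order 0 on them\<close>

lemma sum_form_in_cont_test_forms: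
  fixes f :: "'i \<Rightarrow> 'a::euclidean_space \<Rightarrow> real"
  assumes "finite I" "\<And>i. i \<in> I \<Longrightarrow> Cc D (f i)" "\<And>i. i \<in> I \<Longrightarrow> alternating p (\<Gamma> i)"
  shows "(\<lambda>z vs. \<Sum>i\<in>I. f i z * \<Gamma> i vs) \<in> cont_test_forms D p"
  unfolding cont_test_forms_def mem_Collect_eq
proof (intro conjI allI)
  show "alt_covector p (\<lambda>vs. \<Sum>i\<in>I. f i z * \<Gamma> i vs)" for z
    using assms(3) by (intro alternating_imp_alt_covector alternating_sum)
  show "continuous_on UNIV (\<lambda>z. \<Sum>i\<in>I. f i z * \<Gamma> i vs)" for vs
    using assms(2) by (intro continuous_intros Cc_continuous)
  let ?K = "\<Union>i\<in>I. supp (f i)"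
  have K: "compact ?K" "?K \<subseteq> D" using assms(1,2) by (auto simp: Cc_def)
  have "form_support (\<lambda>z vs. \<Sum>i\<in>I. f i z * \<Gamma> i vs) \<subseteq> ?K"
    unfolding form_support_def
  proof (rule closure_minimal)
    show "{z. \<exists>vs. (\<Sum>i\<in>I. f i z * \<Gamma> i vs) \<noteq> 0} \<subseteq> ?K"
      by (auto simp: supp_zero intro!: sum.neutral)
  qed (use K compact_imp_closed in blast)
  moreover have "closed (form_support (\<lambda>z vs. \<Sum>i\<in>I. f i z * \<Gamma> i vs))" by (simp add: form_support_def)
  ultimately show "compact (form_support (\<lambda>z vs. \<Sum>i\<in>I. f i z * \<Gamma> i vs))"
    "form_support (\<lambda>z vs. \<Sum>i\<in>I. f i z * \<Gamma> i vs) \<subseteq> D"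
    using K compact_Int_closed[OF K(1), of "form_support (\<lambda>z vs. \<Sum>i\<in>I. f i z * \<Gamma> i vs)"]
    by (simp_all add: Int_absorb1)
qed

lemma sum_form_in_smooth_test_forms:
  fixes f :: "'i \<Rightarrow> 'a::euclidean_space \<Rightarrow> real"
  assumes "finite I" "\<And>i. i \<in> I \<Longrightarrow> test_fun D (f i)" "\<And>i. i \<in> I \<Longrightarrow> alternating p (\<Gamma> i)"
  shows "(\<lambda>z vs. \<Sum>i\<in>I. f i z * \<Gamma> i vs) \<in> smooth_test_forms D p"
proof -
  have "smooth_fun (\<lambda>z. \<Sum>i\<in>I. f i z * \<Gamma> i vs)" for vs
    using assms(2) by (intro smooth_fun_sum smooth_fun_mult smooth_fun_const) (auto simp: test_fun_def)
  then show ?thesis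
    unfolding smooth_test_forms_def using assms by (auto intro!: sum_form_in_cont_test_forms simp: test_fun_def)
qed

lemma form_in_cont_test_forms:
  fixes f :: "'a::euclidean_space \<Rightarrow> real"
  shows "Cc D f \<Longrightarrow> alternating p \<Gamma> \<Longrightarrow> (cform f \<Gamma>) \<in> cont_test_forms D p"
  using sum_form_in_cont_test_forms[of "{()}" D "\<lambda>_. f" p "\<lambda>_. \<Gamma>"] by simp

lemma form_in_smooth_test_forms:
  fixes f :: "'a::euclidean_space \<Rightarrow> real"
  shows "test_fun D f \<Longrightarrow> alternating p \<Gamma> \<Longrightarrow> (cform f \<Gamma>) \<in> smooth_test_forms D p"
  using sum_form_in_smooth_test_forms[of "{()}" D "\<lambda>_. f" p "\<lambda>_. \<Gamma>"] by simp

lemma current_linear: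
  assumes "order0_current D p T" "\<phi> \<in> cont_test_forms D p" "\<psi> \<in> cont_test_forms D p"
  shows "T (\<lambda>z vs. a * \<phi> z vs + b * \<psi> z vs) = a * T \<phi> + b * T \<psi>"
  using assms unfolding order0_current_def by blast

lemma current_sum:
  fixes f :: "'i \<Rightarrow> 'a::euclidean_space \<Rightarrow> real"
  assumes T: "order0_current D p T" and I: "finite I" "\<And>i. i \<in> I \<Longrightarrow> Cc D (f i)" "\<And>i. i \<in> I \<Longrightarrow> alternating p (\<Gamma> i)"
  shows "T (\<lambda>z vs. \<Sum>i\<in>I. f i z * \<Gamma> i vs) = (\<Sum>i\<in>I. T (\<lambda>z vs. f i z * \<Gamma> i vs))"
  using I
proof (induction I rule: finite_induct)
  case empty
  have "(\<lambda>z vs. 0) \<in> cont_test_forms D p"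
    using sum_form_in_cont_test_forms[of "{}" D "\<lambda>_ _. 0" p "\<lambda>_ _. 0"] by simp
  from current_linear[OF T this this, of 0 0] show ?case by simp
next
  case (insert i I)
  have 1: "(\<lambda>z vs. f i z * \<Gamma> i vs) \<in> cont_test_forms D p"
    using insert by (intro form_in_cont_test_forms) auto
  have 2: "(\<lambda>z vs. \<Sum>i\<in>I. f i z * \<Gamma> i vs) \<in> cont_test_forms D p"
    using insert by (intro sum_form_in_cont_test_forms) auto
  have "T (\<lambda>z vs. \<Sum>i\<in>insert i I. f i z * \<Gamma> i vs) = T (\<lambda>z vs. 1 * (f i z * \<Gamma> i vs) + 1 * (\<Sum>i\<in>I. f i z * \<Gamma> i vs))"
    using insert by simp
  also have "\<dots> = T (\<lambda>z vs. f i z * \<Gamma> i vs) + T (\<lambda>z vs. \<Sum>i\<in>I. f i z * \<Gamma> i vs)"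
    using current_linear[OF T 1 2, of 1 1] by simp
  finally show ?case using insert by simp
qed

lemma current_lincomb:
  fixes f g :: "'a::euclidean_space \<Rightarrow> real"
  assumes T: "order0_current D p T" and "Cc D f" "Cc D g" "alternating p \<Gamma>"
  shows "T (\<lambda>z vs. (a * f z + b * g z) * \<Gamma> vs) = a * T (cform f \<Gamma>) + b * T (cform g \<Gamma>)"
  using current_linear[OF T form_in_cont_test_forms[OF assms(2,4)] form_in_cont_test_forms[OF assms(3,4)], of a b]
  by (simp add: distrib_right mult.assoc)

lemma current_bound:
  fixes T :: "'a::euclidean_space dform \<Rightarrow> real"
  assumes T: "order0_current D p T" and K: "compact K" "K \<subseteq> D" and \<Gamma>: "alternating p \<Gamma>"
  shows "\<exists>C\<ge>0. \<forall>f M. Cc D f \<longrightarrow> supp f \<subseteq> K \<longrightarrow> (\<forall>x. \<bar>f x\<bar> \<le> M) \<longrightarrow> \<bar>T (cform f \<Gamma>)\<bar> \<le> C * M"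
proof -
  obtain B where B: "B \<ge> 0" "\<And>vs. (\<forall>v\<in>set vs. norm v \<le> 1) \<Longrightarrow> \<bar>\<Gamma> vs\<bar> \<le> B"
    using alternating_bounded[OF \<Gamma>] by blast
  have "\<forall>K. compact K \<longrightarrow> K \<subseteq> D \<longrightarrow> (\<exists>C. \<forall>\<phi>\<in>cont_test_forms D p. \<forall>M.
        form_support \<phi> \<subseteq> K \<longrightarrow> (\<forall>z vs. (\<forall>v\<in>set vs. norm v \<le> 1) \<longrightarrow> \<bar>\<phi> z vs\<bar> \<le> M) \<longrightarrow> \<bar>T \<phi>\<bar> \<le> C * M)"
    using T unfolding order0_current_def by blast
  with K obtain C where C: "\<And>\<phi> M. \<phi> \<in> cont_test_forms D p \<Longrightarrow> form_support \<phi> \<subseteq> K \<Longrightarrow>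
     (\<forall>z vs. (\<forall>v\<in>set vs. norm v \<le> 1) \<longrightarrow> \<bar>\<phi> z vs\<bar> \<le> M) \<Longrightarrow> \<bar>T \<phi>\<bar> \<le> C * M" by meson
  have "\<bar>T (cform f \<Gamma>)\<bar> \<le> (\<bar>C\<bar> * B) * M" if f: "Cc D f" "supp f \<subseteq> K" "\<And>x. \<bar>f x\<bar> \<le> M" for f M
  proof -
    have M: "M \<ge> 0" using f(3)[of undefined] by linarith
    have "form_support (cform f \<Gamma>) \<subseteq> supp f"
      unfolding form_support_def supp_def by (rule closure_mono) auto
    moreover have "\<forall>z vs. (\<forall>v\<in>set vs. norm v \<le> 1) \<longrightarrow> \<bar>f z * \<Gamma> vs\<bar> \<le> M * B"
      unfolding abs_mult using f(3) B M by (auto intro!: mult_mono)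
    ultimately have "\<bar>T (cform f \<Gamma>)\<bar> \<le> C * (M * B)"
      using f(2) by (intro C form_in_cont_test_forms[OF f(1) \<Gamma>]) auto
    also have "\<dots> \<le> \<bar>C\<bar> * (M * B)" using M B by (intro mult_right_mono) auto
    finally show ?thesis by (simp add: algebra_simps)
  qed
  then show ?thesis using B(1) by (intro exI[of _ "\<bar>C\<bar> * B"]) auto
qed

section \<open>Symmetry of dd^c (f dd^c g) in f and g\<close>

lemma sum_antisym:
  fixes h :: "'a \<Rightarrow> 'a \<Rightarrow> real"
  assumes "\<And>x y. h x y = - h y x"
  shows "(\<Sum>x\<in>A. \<Sum>y\<in>A. h x y) = 0"
proof -
  have "(\<Sum>x\<in>A. \<Sum>y\<in>A. h x y) = (\<Sum>x\<in>A. \<Sum>y\<in>A. h y x)" by (rule sum.swap)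
  also have "\<dots> = (\<Sum>x\<in>A. \<Sum>y\<in>A. - h x y)" by (intro sum.cong refl assms)
  also have "\<dots> = - (\<Sum>x\<in>A. \<Sum>y\<in>A. h x y)" by (simp add: sum_negf)
  finally show ?thesis by simp
qed

lemma sum4_antisym:
  fixes F :: "'a \<Rightarrow> 'a \<Rightarrow> 'a \<Rightarrow> 'a \<Rightarrow> real"
  assumes "(\<forall>b c b' c'. F b c b' c' = - F b c' b' c) \<or> (\<forall>b c b' c'. F b c b' c' = - F b' c b c')"
  shows "(\<Sum>b\<in>A. \<Sum>c\<in>A. \<Sum>b'\<in>A. \<Sum>c'\<in>A. F b c b' c') = 0"
proof (cases "\<forall>b c b' c'. F b c b' c' = - F b c' b' c")
  case True
  have "(\<Sum>c\<in>A. \<Sum>b'\<in>A. \<Sum>c'\<in>A. F b c b' c') = (\<Sum>b'\<in>A. \<Sum>c\<in>A. \<Sum>c'\<in>A. F b c b' c')" for b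
    by (rule sum.swap)
  moreover have "(\<Sum>c\<in>A. \<Sum>c'\<in>A. F b c b' c') = 0" for b b' using True by (intro sum_antisym) blast
  ultimately show ?thesis by simp
next
  case False
  have "(\<Sum>b\<in>A. \<Sum>c\<in>A. \<Sum>b'\<in>A. \<Sum>c'\<in>A. F b c b' c') = (\<Sum>c\<in>A. \<Sum>b\<in>A. \<Sum>b'\<in>A. \<Sum>c'\<in>A. F b c b' c')"
    by (rule sum.swap)
  moreover have "(\<Sum>b\<in>A. \<Sum>b'\<in>A. \<Sum>c'\<in>A. F b c b' c') = 0" for c
  proof (rule sum_antisym)
    fix x y
    have "F x c y c' = - F y c x c'" for c' using False assms by blast
    then have "(\<Sum>c'\<in>A. F x c y c') = (\<Sum>c'\<in>A. - F y c x c')" by (rule sum.cong[OF refl])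
    then show "(\<Sum>c'\<in>A. F x c y c') = - (\<Sum>c'\<in>A. F y c x c')" by (simp add: sum_negf)
  qed
  ultimately show ?thesis by simp
qed

lemma wedge1_swap13: "wedge1 a (wedge1 b (wedge1 c \<Gamma>)) vs = - wedge1 c (wedge1 b (wedge1 a \<Gamma>)) vs"
proof -
  have s: "wedge1 x (wedge1 y \<Delta>) = (\<lambda>vs. - wedge1 y (wedge1 x \<Delta>) vs)" for x y \<Delta>
    using wedge1_anticommute by blast
  have "wedge1 a (wedge1 b (wedge1 c \<Gamma>)) vs = - wedge1 b (wedge1 a (wedge1 c \<Gamma>)) vs" by (rule wedge1_anticommute)
  also have "\<dots> = wedge1 b (wedge1 c (wedge1 a \<Gamma>)) vs" by (subst s[of a c]) (simp add: wedge1_uminus)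
  also have "\<dots> = - wedge1 c (wedge1 b (wedge1 a \<Gamma>)) vs" by (rule wedge1_anticommute)
  finally show ?thesis .
qed

lemma hess_mult:
  assumes "smooth_fun f" "smooth_fun g"
  shows "hess (b, c) (\<lambda>x. f x * g x) x = f x * pd c (pd b g) x + pd c f x * pd b g x + (pd b f x * pd c g x + pd c (pd b f) x * g x)"
proof -
  have "pd b (\<lambda>x. f x * g x) = (\<lambda>x. f x * pd b g x + pd b f x * g x)"
    using assms by (intro ext pd_mult smooth_fun_differentiable)
  then show ?thesis unfolding hess_def using assms
    by (simp add: pd_add pd_mult smooth_fun_differentiable smooth_fun_mult smooth_fun_pd)
qed

text \<open>Both sides equal dd^c f \<and> dd^c g \<and> \<open>\<Gamma>\<close>: the terms in which
  g is differentiated more than twice cancel, because dd^c g is closed under d and d^c, and the two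
  remaining 2-forms commute.\<close>

lemma ddc_mult_ddc_symmetric:
  fixes f g :: "complex^'n \<Rightarrow> real"
  assumes f: "smooth_fun f" and g: "smooth_fun g"
  shows "ddc (fddc f g \<Gamma>) = ddc (fddc g f \<Gamma>)"
proof -
  have expand: "ddc (fddc f g \<Gamma>) z vs
     = (\<Sum>q\<in>Basis2. \<Sum>r\<in>Basis2. hess q g z * hess r f z * wedge2 r (wedge2 q \<Gamma>) vs)"
    if f: "smooth_fun f" and g: "smooth_fun g" for f g :: "complex^'n \<Rightarrow> real" and z vs
  proof -
    let ?X = "\<lambda>b c b' c'. wedge1 c' (wedge1 (\<i> *s b') (wedge1 c (wedge1 (\<i> *s b) \<Gamma>))) vs"
    have sm: "smooth_fun (hess q g)" for q unfolding hess_def by (intro smooth_fun_pd g)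
    have "(fddc f g \<Gamma>) = (\<lambda>z vs. \<Sum>q\<in>Basis2. (f z * hess q g z) * wedge2 q \<Gamma> vs)"
      by (simp add: ddc_single[OF g] sum_distrib_left mult.assoc)
    then have "ddc (fddc f g \<Gamma>) z vs
      = (\<Sum>q\<in>Basis2. \<Sum>r\<in>Basis2. hess r (\<lambda>z. f z * hess q g z) z * wedge2 r (wedge2 q \<Gamma>) vs)"
      by (simp only: ddc_sum[OF smooth_fun_mult[OF f sm]])
    also have "\<dots> = (\<Sum>b\<in>Basis. \<Sum>c\<in>Basis. \<Sum>b'\<in>Basis. \<Sum>c'\<in>Basis.
        hess (b', c') (\<lambda>z. f z * hess (b, c) g z) z * ?X b c b' c')"
      by (simp add: sum_Times wedge2_def)
    also have "\<dots> = (\<Sum>b\<in>Basis. \<Sum>c\<in>Basis. \<Sum>b'\<in>Basis. \<Sum>c'\<in>Basis. f z * pd c' (pd b' (pd c (pd b g))) z * ?X b c b' c')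
       + (\<Sum>b\<in>Basis. \<Sum>c\<in>Basis. \<Sum>b'\<in>Basis. \<Sum>c'\<in>Basis. pd c' f z * pd b' (pd c (pd b g)) z * ?X b c b' c')
       + (\<Sum>b\<in>Basis. \<Sum>c\<in>Basis. \<Sum>b'\<in>Basis. \<Sum>c'\<in>Basis. pd b' f z * pd c' (pd c (pd b g)) z * ?X b c b' c')
       + (\<Sum>b\<in>Basis. \<Sum>c\<in>Basis. \<Sum>b'\<in>Basis. \<Sum>c'\<in>Basis. hess (b, c) g z * hess (b', c') f z * ?X b c b' c')"
      unfolding hess_mult[OF f sm] by (simp add: hess_def sum.distrib[symmetric] algebra_simps)
    \<comment> \<open>In this and the next two sums a symmetric derivative of g meets an
      antisymmetric covector: symmetric in c and c' here and in the third sum, in b and b' in the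
      second.\<close>
    also have "(\<Sum>b\<in>Basis. \<Sum>c\<in>Basis. \<Sum>b'\<in>Basis. \<Sum>c'\<in>Basis. f z * pd c' (pd b' (pd c (pd b g))) z * ?X b c b' c') = 0"
    proof (intro sum4_antisym disjI1 allI)
      fix b c b' c'
      have "pd c' (pd b' (pd c (pd b g))) = pd c (pd b' (pd c' (pd b g)))"
        by (metis g pd_commute smooth_fun_pd)
      then show "f z * pd c' (pd b' (pd c (pd b g))) z * ?X b c b' c' = - (f z * pd c (pd b' (pd c' (pd b g))) z * ?X b c' b' c)"
        by (subst wedge1_swap13) simp
    qed
    also have "(\<Sum>b\<in>Basis. \<Sum>c\<in>Basis. \<Sum>b'\<in>Basis. \<Sum>c'\<in>Basis. pd c' f z * pd b' (pd c (pd b g)) z * ?X b c b' c') = 0"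
    proof (intro sum4_antisym disjI2 allI)
      fix b c b' c'
      have "pd b' (pd c (pd b g)) = pd b (pd c (pd b' g))"
        by (metis g pd_commute smooth_fun_pd)
      moreover have "wedge1 (\<i> *s b') (wedge1 c (wedge1 (\<i> *s b) \<Gamma>)) = (\<lambda>vs. - wedge1 (\<i> *s b) (wedge1 c (wedge1 (\<i> *s b') \<Gamma>)) vs)"
        by (intro ext wedge1_swap13)
      then have "?X b c b' c' = - ?X b' c b c'" by (simp only: wedge1_uminus)
      ultimately show "pd c' f z * pd b' (pd c (pd b g)) z * ?X b c b' c' = - (pd c' f z * pd b (pd c (pd b' g)) z * ?X b' c b c')"
        by simp
    qed
    also have "(\<Sum>b\<in>Basis. \<Sum>c\<in>Basis. \<Sum>b'\<in>Basis. \<Sum>c'\<in>Basis. pd b' f z * pd c' (pd c (pd b g)) z * ?X b c b' c') = 0"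
    proof (intro sum4_antisym disjI1 allI)
      fix b c b' c'
      have "pd c' (pd c (pd b g)) = pd c (pd c' (pd b g))"
        by (metis g pd_commute smooth_fun_pd)
      then show "pd b' f z * pd c' (pd c (pd b g)) z * ?X b c b' c' = - (pd b' f z * pd c (pd c' (pd b g)) z * ?X b c' b' c)"
        by (subst wedge1_swap13) simp
    qed
    finally show ?thesis by (simp add: sum_Times wedge2_def)
  qed
  have "wedge2 r (wedge2 q \<Gamma>) = wedge2 q (wedge2 r \<Gamma>)" for q r
    unfolding wedge2_def by (rule wedge1_commute4)
  then show ?thesis
    by (intro ext) (simp only: expand[OF f g] expand[OF g f], subst sum.swap, simp add: mult.commute)
qed

lemma test_fun_mult: "smooth_fun f \<Longrightarrow> test_fun D g \<Longrightarrow> test_fun D (\<lambda>x. f x * g x)"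
  for f :: "'a::euclidean_space \<Rightarrow> real"
  unfolding test_fun_def by (auto intro: smooth_fun_mult Cc_mult continuous_on_smooth_fun)

lemma test_fun_mult': "smooth_fun f \<Longrightarrow> test_fun D g \<Longrightarrow> test_fun D (\<lambda>x. g x * f x)"
  for f :: "'a::euclidean_space \<Rightarrow> real"
  using test_fun_mult[of f D g] by (simp add: mult.commute)

lemma smooth_fun_hess: "smooth_fun f \<Longrightarrow> smooth_fun (hess q f)"
  unfolding hess_def by (intro smooth_fun_pd)

lemma test_fun_hess: "test_fun D f \<Longrightarrow> test_fun D (hess q f)"
  unfolding hess_def by (intro test_fun_pd)

lemma supp_hess: "supp (hess q f) \<subseteq> supp f"
  unfolding hess_def using supp_pd by blast

lemma test_fun_Cc: "test_fun D f \<Longrightarrow> Cc D f" and test_fun_smooth: "test_fun D f \<Longrightarrow> smooth_fun f"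
  by (auto simp: test_fun_def)

lemma Cc_mono: "Cc D f \<Longrightarrow> D \<subseteq> E \<Longrightarrow> Cc E f"
  by (auto simp: Cc_def)

lemma Cc_bounded:
  fixes f :: "'a::euclidean_space \<Rightarrow> real"
  assumes "Cc D f"
  shows "\<exists>M\<ge>0. \<forall>x. \<bar>f x\<bar> \<le> M"
proof -
  have "compact (f ` supp f)"
    using assms by (intro compact_continuous_image Cc_continuous) (auto simp: Cc_def)
  then obtain M where M: "\<And>x. x \<in> supp f \<Longrightarrow> \<bar>f x\<bar> \<le> M"
    using compact_imp_bounded by (force simp: bounded_iff)
  have "\<bar>f x\<bar> \<le> max M 0" for x
    using M[of x] supp_zero[of x f] by (cases "x \<in> supp f") auto
  then show ?thesis by (intro exI[of _ "max M 0"]) auto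
qed

section \<open>Integration by parts for Lebesgue measure\<close>

text \<open>Near 0 the convolution of g with a wide plateau is constantly the integral of g. Its
  derivative there is 0, but it is also the convolution with the derivative of g, that is, the
  integral in question.\<close>

lemma integral_pd_zero:
  fixes g :: "'a::euclidean_space \<Rightarrow> real"
  assumes g: "test_fun UNIV g"
  shows "(LINT x|lborel. pd v g x) = 0"
proof -
  have "bounded (supp g)" using g by (auto simp: test_fun_def Cc_def compact_imp_bounded)
  then obtain R where R: "R > 0" "\<And>x. x \<in> supp g \<Longrightarrow> norm x \<le> R" by (auto simp: bounded_pos)
  obtain w :: "'a \<Rightarrow> real" where w: "test_fun (ball 0 (R + 2)) w" "\<And>x. dist 0 x \<le> R + 1 \<Longrightarrow> w x = 1"
    using smooth_plateau[of "R + 1" "R + 2" "0::'a"] R(1) by auto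
  have cw: "continuous_on UNIV w" and Cw: "Cc (ball 0 (R + 2)) w"
    using w(1) by (auto simp: test_fun_def continuous_on_smooth_fun)
  have eq: "conv w h z = (LINT y|lborel. h y)" if h: "test_fun UNIV h" "supp h \<subseteq> supp g" and z: "norm z < 1" for h z
  proof -
    have "conv w h z = (LINT y|lborel. w (z - y) * h y)"
      using h by (intro conv_reflect cw) (auto simp: test_fun_def continuous_on_smooth_fun)
    also have "\<dots> = (LINT y|lborel. h y)"
    proof (rule Bochner_Integration.integral_cong[OF refl])
      fix y
      show "w (z - y) * h y = h y"
      proof (cases "y \<in> supp h")
        case True
        then have "norm (z - y) \<le> R + 1" using h(2) R(2)[of y] z norm_triangle_ineq4[of z y] by auto
        then show ?thesis using w(2)[of "z - y"] by simp
      qed (simp add: supp_zero)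
    qed
    finally show ?thesis .
  qed
  have "(LINT y|lborel. pd v g y) = conv w (pd v g) 0"
    using eq[OF test_fun_pd[OF g] supp_pd, of 0 v] by simp
  also have "\<dots> = pd v (conv w g) 0"
    using pd_eqI[OF conv_has_derivative[OF Cw g]] by simp
  also have "\<dots> = pd v (\<lambda>z. LINT y|lborel. g y) (0::'a)"
    using eq[OF g order_refl] by (intro pd_cong_open[of "ball 0 1"]) auto
  finally show ?thesis by (simp add: pd_const)
qed

lemma integral_by_parts_pd:
  fixes f g :: "'a::euclidean_space \<Rightarrow> real"
  assumes f: "smooth_fun f" and g: "test_fun UNIV g"
  shows "(LINT x|lborel. f x * pd v g x) = - (LINT x|lborel. pd v f x * g x)"
proof -
  have int: "integrable lborel (\<lambda>x. f x * pd v g x)" "integrable lborel (\<lambda>x. pd v f x * g x)"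
    using test_fun_mult[OF f test_fun_pd[OF g]] test_fun_mult[OF smooth_fun_pd[OF f] g]
    by (auto simp: test_fun_def intro: Cc_integrable)
  have "pd v (\<lambda>x. f x * g x) = (\<lambda>x. f x * pd v g x + pd v f x * g x)"
    using f g by (intro ext pd_mult smooth_fun_differentiable) (auto simp: test_fun_def)
  with integral_pd_zero[OF test_fun_mult[OF f g], of v] int show ?thesis by simp
qed

lemma integral_hess:
  fixes f g :: "'a::euclidean_space \<Rightarrow> real"
  assumes f: "smooth_fun f" and g: "test_fun UNIV g"
  shows "(LINT x|lborel. f x * hess q g x) = (LINT x|lborel. g x * hess q f x)"
proof -
  obtain b c where q: "q = (b, c)" by (cases q)
  have "(LINT x|lborel. f x * hess q g x) = (LINT x|lborel. pd b (pd c f) x * g x)"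
    unfolding q hess_def fst_conv snd_conv
    by (simp add: integral_by_parts_pd[OF f test_fun_pd[OF g]] integral_by_parts_pd[OF smooth_fun_pd[OF f] g])
  also have "pd b (pd c f) = pd c (pd b f)" by (rule pd_commute[OF f])
  finally show ?thesis by (simp add: q hess_def mult.commute)
qed

lemma mult_ddc:
  fixes g :: "complex^'n \<Rightarrow> real"
  assumes "smooth_fun g"
  shows "(fddc f g \<Gamma>) = (\<lambda>z vs. \<Sum>q\<in>Basis2. (f z * hess q g z) * wedge2 q \<Gamma> vs)"
  by (simp add: ddc_single[OF assms] sum_distrib_left mult.assoc)

text \<open>The second clause expresses that \<open>T\<close> is \<open>dd\<^sup>c\<close>-closed, in the form of an integration by parts.\<close>

definition pos_closed :: "(complex^'n::finite) set \<Rightarrow> nat \<Rightarrow> ((complex^'n) dform \<Rightarrow> real) \<Rightarrow> bool" where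
  "pos_closed D p T \<longleftrightarrow> order0_current D (2 * p) T \<and>
    (\<forall>f \<eta> \<Gamma> q. smooth_fun f \<longrightarrow> test_fun D \<eta> \<longrightarrow> alternating q \<Gamma> \<longrightarrow> q + 2 = 2 * p \<longrightarrow>
       T (fddc f \<eta> \<Gamma>) = T (fddc \<eta> f \<Gamma>)) \<and>
    (\<forall>f as. Cc D f \<longrightarrow> (\<forall>x. 0 \<le> f x) \<longrightarrow> length as = p \<longrightarrow> 0 \<le> T (cform f (sigs as)))"

lemma pos_closedD:
  assumes "pos_closed D p T"
  shows "order0_current D (2 * p) T"
    "smooth_fun f \<Longrightarrow> test_fun D \<eta> \<Longrightarrow> alternating q \<Gamma> \<Longrightarrow> q + 2 = 2 * p \<Longrightarrow>
       T (fddc f \<eta> \<Gamma>) = T (fddc \<eta> f \<Gamma>)"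
    "Cc D f \<Longrightarrow> (\<And>x. 0 \<le> f x) \<Longrightarrow> length as = p \<Longrightarrow> 0 \<le> T (cform f (sigs as))"
  using assms unfolding pos_closed_def by blast+

section \<open>Nonnegative Levi forms as sums of elementary forms\<close>

lemma linear_of_symmetric:
  assumes "\<And>w. linear (\<lambda>v. Q v w)" "\<And>v w. Q v w = Q w v"
  shows "linear (Q v)"
proof -
  have "Q v = (\<lambda>w. Q w v)" by (intro ext assms(2))
  then show ?thesis by (simp only: assms(1))
qed

lemma psd_Cauchy_Schwarz:
  fixes Q :: "'a::real_vector \<Rightarrow> 'a \<Rightarrow> real"
  assumes lin: "\<And>w. linear (\<lambda>v. Q v w)" and sym: "\<And>v w. Q v w = Q w v" and psd: "\<And>v. Q v v \<ge> 0"
  shows "(Q b v)\<^sup>2 \<le> Q b b * Q v v"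
proof -
  have lin': "linear (Q v)" for v using lin sym by (rule linear_of_symmetric)
  have expand: "Q (s *\<^sub>R v + t *\<^sub>R b) (s *\<^sub>R v + t *\<^sub>R b) = s\<^sup>2 * Q v v + 2 * s * t * Q b v + t\<^sup>2 * Q b b" for s t
    using sym[of v b] by (simp add: linear_add[OF lin] linear_scale[OF lin] linear_add[OF lin'] linear_scale[OF lin']
      power2_eq_square algebra_simps)
  show ?thesis
  proof (cases "Q b b = 0")
    case True
    have "Q b v = 0"
    proof (rule ccontr)
      assume "Q b v \<noteq> 0"
      \<comment> \<open>The coefficient of b is chosen so that the quadratic form takes the value
        -1.\<close>
      then have "2 * (- (Q v v + 1) / (2 * Q b v)) * Q b v = - (Q v v + 1)" by simp
      with psd[of "1 *\<^sub>R v + (- (Q v v + 1) / (2 * Q b v)) *\<^sub>R b"] show False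
        unfolding expand using True by (simp only: mult_zero_right mult_1_right power_one mult_1_left)
    qed
    then show ?thesis by (simp add: True)
  next
    case False
    then have pos: "Q b b > 0" using psd[of b] by simp
    have "0 \<le> (Q b b)\<^sup>2 * Q v v + 2 * Q b b * (- Q b v) * Q b v + (- Q b v)\<^sup>2 * Q b b"
      using psd[of "Q b b *\<^sub>R v + (- Q b v) *\<^sub>R b"] unfolding expand .
    also have "\<dots> = Q b b * (Q b b * Q v v - (Q b v)\<^sup>2)" by (simp add: power2_eq_square algebra_simps)
    finally show ?thesis using pos by (simp add: zero_le_mult_iff)
  qed
qed

text \<open>Completing squares: subtracting Q(b,v) Q(b,w) / Q(b,b) keeps Q nonnegative by
  Cauchy-Schwarz and puts b into the kernel. B holds the basis vectors not yet known to lie in the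
  kernel.\<close>

lemma psd_sum_squares_aux:
  fixes Q :: "'a::euclidean_space \<Rightarrow> 'a \<Rightarrow> real"
  assumes "finite B" "\<And>w. linear (\<lambda>v. Q v w)" "\<And>v w. Q v w = Q w v" "\<And>v. Q v v \<ge> 0"
    "\<And>b v. b \<in> Basis - B \<Longrightarrow> Q b v = 0"
  shows "\<exists>as. \<forall>v w. Q v w = (\<Sum>a\<leftarrow>as. (v \<bullet> a) * (w \<bullet> a))"
  using assms
proof (induction B arbitrary: Q rule: finite_induct)
  case empty
  have "Q v w = 0" for v w
  proof -
    have "Q v w = Q (\<Sum>b\<in>Basis. (v \<bullet> b) *\<^sub>R b) w" by (simp add: euclidean_representation)
    also have "\<dots> = (\<Sum>b\<in>Basis. (v \<bullet> b) * Q b w)"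
      by (simp only: linear_sum[OF empty(1)] linear_scale[OF empty(1)] real_scaleR_def)
    also have "\<dots> = 0" using empty(4) by simp
    finally show ?thesis .
  qed
  then show ?case by (intro exI[of _ "[]"]) simp
next
  case (insert b B)
  note CS = psd_Cauchy_Schwarz[of Q, OF insert.prems(1-3)]
  show ?case
  proof (cases "Q b b = 0")
    case True
    then have "Q b v = 0" for v using CS[of b v] by simp
    then have "Q x v = 0" if "x \<in> Basis - B" for x v
      using that insert.prems(4)[of x v] by (cases "x = b") auto
    then show ?thesis by (intro insert.IH insert.prems(1-3))
  next
    case False
    then have pos: "Q b b > 0" using insert.prems(3)[of b] by simp
    define Q' where "Q' v w = Q v w - Q b v * Q b w / Q b b" for v w
    have lin: "linear (Q v)" for v using insert.prems(1,2) by (rule linear_of_symmetric)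
    have "\<exists>as. \<forall>v w. Q' v w = (\<Sum>a\<leftarrow>as. (v \<bullet> a) * (w \<bullet> a))"
    proof (rule insert.IH)
      show "linear (\<lambda>v. Q' v w)" for w
        unfolding Q'_def by (rule linearI)
          (simp_all add: linear_add[OF insert.prems(1)] linear_scale[OF insert.prems(1)] linear_add[OF lin] linear_scale[OF lin] field_simps add_divide_distrib)
      show "Q' v w = Q' w v" for v w using insert.prems(2)[of v w] by (simp add: Q'_def)
      show "Q' v v \<ge> 0" for v
        using CS[of b v] pos by (simp add: Q'_def power2_eq_square pos_divide_le_eq mult.commute)
      show "Q' x v = 0" if "x \<in> Basis - B" for x v
      proof (cases "x = b")
        case True
        then show ?thesis using pos by (simp add: Q'_def)
      next
        case False
        then have "Q x w = 0" for w using insert.prems(4)[of x w] that by simp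
        moreover from this have "Q b x = 0" using insert.prems(2)[of b x] by simp
        ultimately show ?thesis by (simp add: Q'_def)
      qed
    qed
    then obtain as where as: "\<And>v w. Q' v w = (\<Sum>a\<leftarrow>as. (v \<bullet> a) * (w \<bullet> a))" by blast
    define a where "a = (\<Sum>c\<in>Basis. (Q b c / sqrt (Q b b)) *\<^sub>R c)"
    have a: "v \<bullet> a = Q b v / sqrt (Q b b)" for v
    proof -
      have "Q b v = Q b (\<Sum>c\<in>Basis. (v \<bullet> c) *\<^sub>R c)" by (simp add: euclidean_representation)
      also have "\<dots> = (\<Sum>c\<in>Basis. (v \<bullet> c) * Q b c)" by (simp add: linear_sum[OF lin] linear_scale[OF lin])
      finally show ?thesis
        by (simp add: a_def inner_sum_right sum_divide_distrib mult.commute)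
    qed
    have "Q v w = (\<Sum>a\<leftarrow>a # as. (v \<bullet> a) * (w \<bullet> a))" for v w
      using pos by (simp add: as[symmetric] a Q'_def)
    then show ?thesis by blast
  qed
qed

lemma psd_sum_squares:
  fixes Q :: "'a::euclidean_space \<Rightarrow> 'a \<Rightarrow> real"
  assumes "\<And>w. linear (\<lambda>v. Q v w)" "\<And>v w. Q v w = Q w v" "\<And>v. Q v v \<ge> 0"
  shows "\<exists>as. \<forall>v w. Q v w = (\<Sum>a\<leftarrow>as. (v \<bullet> a) * (w \<bullet> a))"
  by (rule psd_sum_squares_aux[of Basis]) (use assms in auto)

lemma linear_ii: "linear (\<lambda>v::complex^'n. \<i> *s v)"
  by (rule linearI) (simp_all add: vec_eq_iff scaleR_conv_of_real algebra_simps)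

text \<open>A trace does not depend on the slot that is rotated: multiplication by i in one slot
  becomes its adjoint, multiplication by -i, in the other.\<close>

lemma sum_Basis_ii:
  fixes F :: "complex^'n \<Rightarrow> complex^'n \<Rightarrow> real"
  assumes l: "\<And>y. linear (\<lambda>x. F x y)" and r: "\<And>x. linear (F x)"
  shows "(\<Sum>c\<in>Basis. F (\<i> *s c) c) = (\<Sum>c\<in>Basis. F c (- (\<i> *s c)))"
proof -
  have "F (\<i> *s c) c = (\<Sum>d\<in>Basis. ((\<i> *s c) \<bullet> d) * F d c)" for c
    by (subst euclidean_representation[symmetric, of "\<i> *s c"]) (simp only: linear_sum[OF l] linear_scale[OF l] real_scaleR_def)
  then have "(\<Sum>c\<in>Basis. F (\<i> *s c) c) = (\<Sum>d\<in>Basis. \<Sum>c\<in>Basis. ((\<i> *s c) \<bullet> d) * F d c)"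
    by (simp only:) (rule sum.swap)
  moreover have "F d (- (\<i> *s d)) = (\<Sum>c\<in>Basis. ((\<i> *s c) \<bullet> d) * F d c)" for d
  proof -
    have "F d (- (\<i> *s d)) = (\<Sum>c\<in>Basis. (- (\<i> *s d) \<bullet> c) * F d c)"
      by (subst euclidean_representation[symmetric, of "- (\<i> *s d)"]) (simp only: linear_sum[OF r] linear_scale[OF r] real_scaleR_def)
    moreover have "- (\<i> *s d) \<bullet> c = (\<i> *s c) \<bullet> d" for c
      using inner_ii_left[of c d] by (simp add: inner_commute)
    ultimately show ?thesis by (simp only:)
  qed
  ultimately show ?thesis by simp
qed

lemma sum_wedge1_Basis: "(\<Sum>c\<in>Basis. (c \<bullet> a) * wedge1 c \<Gamma> vs) = wedge1 a \<Gamma> vs"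
  for a :: "'a::euclidean_space"
proof -
  have "wedge1 a \<Gamma> vs = wedge1 (\<Sum>c\<in>Basis. (a \<bullet> c) *\<^sub>R c) \<Gamma> vs" by (simp add: euclidean_representation)
  then show ?thesis by (simp add: wedge1_left_simps inner_commute)
qed

lemma linear_wedge1_right_left: "linear (\<lambda>a. wedge1 c (wedge1 a \<Gamma>) vs)"
  using linear_compose_neg[OF linear_wedge1_left[of "wedge1 c \<Gamma>" vs]]
  by (subst wedge1_anticommute)

text \<open>Both rotations are moved from B onto the covectors, where together they merely
  interchange the two slots, and B is symmetric. So the contraction sees only the part of B
  invariant under i, the Levi form.\<close>

lemma sum_wedge2_ii:
  fixes B :: "complex^'n \<Rightarrow> complex^'n \<Rightarrow> real"
  assumes lin: "\<And>w. linear (\<lambda>v. B v w)" and sym: "\<And>v w. B v w = B w v"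
  shows "(\<Sum>q\<in>Basis2. B (\<i> *s fst q) (\<i> *s snd q) * wedge2 q \<Gamma> vs) = (\<Sum>q\<in>Basis2. B (fst q) (snd q) * wedge2 q \<Gamma> vs)"
proof -
  have lin': "linear (B v)" for v using lin sym by (rule linear_of_symmetric)
  have lB: "linear (\<lambda>v. B v w * k)" "linear (\<lambda>w. B v w * k)" for v w k
    by (auto intro!: linearI simp: linear_add[OF lin] linear_scale[OF lin] linear_add[OF lin'] linear_scale[OF lin'] algebra_simps)
  have lW: "linear (\<lambda>c. k * wedge1 c \<Delta> vs)" "linear (\<lambda>b. k * wedge1 c (wedge1 (\<i> *s b) \<Gamma>) vs)" for k c \<Delta>
  proof -
    show "linear (\<lambda>c. k * wedge1 c \<Delta> vs)"
      using linear_compose_scale_right[OF linear_wedge1_left, of k \<Delta> vs] by simp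
    have "linear (\<lambda>b. wedge1 c (wedge1 (\<i> *s b) \<Gamma>) vs)"
      using linear_compose[OF linear_ii linear_wedge1_right_left, of c \<Gamma> vs] by (simp add: o_def)
    from linear_compose_scale_right[OF this, of k] show "linear (\<lambda>b. k * wedge1 c (wedge1 (\<i> *s b) \<Gamma>) vs)" by simp
  qed
  have "(\<Sum>q\<in>Basis2. B (\<i> *s fst q) (\<i> *s snd q) * wedge2 q \<Gamma> vs)
      = (\<Sum>b\<in>Basis. \<Sum>c\<in>Basis. B (\<i> *s b) (\<i> *s c) * wedge1 c (wedge1 (\<i> *s b) \<Gamma>) vs)"
    by (simp add: sum_Times wedge2_def)
  also have "\<dots> = (\<Sum>b\<in>Basis. \<Sum>c\<in>Basis. B (\<i> *s b) c * wedge1 (- (\<i> *s c)) (wedge1 (\<i> *s b) \<Gamma>) vs)"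
    by (intro sum.cong refl sum_Basis_ii[of "\<lambda>x y. B (\<i> *s _) x * wedge1 y (wedge1 (\<i> *s _) \<Gamma>) vs"] lB lW)
  also have "\<dots> = (\<Sum>c\<in>Basis. \<Sum>b\<in>Basis. B (\<i> *s b) c * wedge1 (- (\<i> *s c)) (wedge1 (\<i> *s b) \<Gamma>) vs)"
    by (rule sum.swap)
  also have "\<dots> = (\<Sum>c\<in>Basis. \<Sum>b\<in>Basis. B b c * wedge1 (- (\<i> *s c)) (wedge1 (\<i> *s (- (\<i> *s b))) \<Gamma>) vs)"
    by (intro sum.cong refl sum_Basis_ii[of "\<lambda>x y. B x _ * wedge1 (- (\<i> *s _)) (wedge1 (\<i> *s y) \<Gamma>) vs"] lB lW)
  also have "\<dots> = (\<Sum>c\<in>Basis. \<Sum>b\<in>Basis. B c b * wedge1 b (wedge1 (\<i> *s c) \<Gamma>) vs)"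
  proof (intro sum.cong refl)
    fix b c :: "complex^'n"
    have "\<i> *s (- (\<i> *s b)) = b" by (simp add: vec_eq_iff)
    moreover have "wedge1 (- (\<i> *s c)) (wedge1 b \<Gamma>) vs = wedge1 b (wedge1 (\<i> *s c) \<Gamma>) vs"
      using wedge1_anticommute[of b "\<i> *s c" \<Gamma> vs] by (simp add: wedge1_left_simps)
    ultimately show "B b c * wedge1 (- (\<i> *s c)) (wedge1 (\<i> *s (- (\<i> *s b))) \<Gamma>) vs = B c b * wedge1 b (wedge1 (\<i> *s c) \<Gamma>) vs"
      using sym[of b c] by simp
  qed
  finally show ?thesis by (simp add: sum_Times wedge2_def)
qed

text \<open>Contracting the rank one form of a with a basis rebuilds a in both slots of
  \<open>wedge2\<close>, which gives \<open>sig a\<close>.\<close>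

lemma sum_wedge2_squares:
  assumes "\<And>v w. Q v w = (\<Sum>a\<leftarrow>as. (v \<bullet> a) * (w \<bullet> a))"
  shows "(\<Sum>q\<in>Basis2. Q (fst q) (snd q) * wedge2 q \<Gamma> vs) = (\<Sum>a\<leftarrow>as. sig a \<Gamma> vs)"
proof -
  have "(\<Sum>q\<in>Basis2. ((fst q \<bullet> a) * (snd q \<bullet> a)) * wedge2 q \<Gamma> vs) = sig a \<Gamma> vs" for a
  proof -
    have "(\<Sum>q\<in>Basis2. ((fst q \<bullet> a) * (snd q \<bullet> a)) * wedge2 q \<Gamma> vs) =
       (\<Sum>b\<in>Basis. (b \<bullet> a) * (\<Sum>c\<in>Basis. (c \<bullet> a) * wedge1 c (wedge1 (\<i> *s b) \<Gamma>) vs))"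
      by (simp add: sum_Times wedge2_def sum_distrib_left mult.assoc)
    also have "\<dots> = (\<Sum>b\<in>Basis. (b \<bullet> a) * - wedge1 (\<i> *s b) (wedge1 a \<Gamma>) vs)"
      unfolding sum_wedge1_Basis by (subst wedge1_anticommute) simp
    also have "\<dots> = - wedge1 (\<i> *s (\<Sum>b\<in>Basis. (a \<bullet> b) *\<^sub>R b)) (wedge1 a \<Gamma>) vs"
      by (simp add: linear_sum[OF linear_ii] linear_scale[OF linear_ii] wedge1_left_simps sum_negf inner_commute)
    also have "\<dots> = sig a \<Gamma> vs"
      unfolding euclidean_representation sig_def by (subst wedge1_anticommute) simp
    finally show ?thesis .
  qed
  then show ?thesis
    unfolding assms by (induction as) (simp_all add: distrib_right sum.distrib)
qed

text \<open>By \<open>sum_wedge2_ii\<close> B may be averaged with its rotation by i. The average is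
  positive semidefinite exactly by the Levi condition, hence a sum of squares, and every square
  becomes an elementary form.\<close>

lemma Levi_form_sigs:
  fixes B :: "complex^'n \<Rightarrow> complex^'n \<Rightarrow> real"
  assumes lin: "\<And>w. linear (\<lambda>v. B v w)" and sym: "\<And>v w. B v w = B w v"
    and Levi: "\<And>v. B v v + B (\<i> *s v) (\<i> *s v) \<ge> 0"
  shows "\<exists>ls. \<forall>\<Gamma> vs. (\<Sum>q\<in>Basis2. B (fst q) (snd q) * wedge2 q \<Gamma> vs) = (\<Sum>a\<leftarrow>ls. sig a \<Gamma> vs)"
proof -
  define Q where "Q v w = (B v w + B (\<i> *s v) (\<i> *s w)) / 2" for v w
  have "linear (\<lambda>v. Q v w)" for w
    unfolding Q_def by (rule linearI)
      (simp_all add: linear_add[OF lin] linear_scale[OF lin] linear_add[OF linear_ii] linear_scale[OF linear_ii] field_simps)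
  moreover have "Q v w = Q w v" for v w using sym by (simp add: Q_def)
  moreover have "Q v v \<ge> 0" for v using Levi[of v] by (simp add: Q_def)
  ultimately obtain ls where ls: "\<And>v w. Q v w = (\<Sum>a\<leftarrow>ls. (v \<bullet> a) * (w \<bullet> a))"
    using psd_sum_squares[of Q] by blast
  have "(\<Sum>q\<in>Basis2. B (fst q) (snd q) * wedge2 q \<Gamma> vs) = (\<Sum>q\<in>Basis2. Q (fst q) (snd q) * wedge2 q \<Gamma> vs)" for \<Gamma> vs
    using sum_wedge2_ii[OF lin sym, of \<Gamma> vs]
    by (simp add: Q_def add_divide_distrib distrib_right sum.distrib sum_divide_distrib[symmetric])
  then show ?thesis using sum_wedge2_squares[OF ls] by metis
qed

lemma hess_sym: "smooth_fun f \<Longrightarrow> hess (v, w) f = hess (w, v) f"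
  unfolding hess_def using pd_commute by auto

lemma linear_hess: "smooth_fun f \<Longrightarrow> linear (\<lambda>v. hess (v, w) f z)"
  by (subst hess_sym) (auto simp: hess_def intro: linear_pd smooth_fun_differentiable smooth_fun_pd)

section \<open>Positivity of the Bedford-Taylor currents\<close>

lemma nonneg_of_epsilon:
  fixes x C :: real
  assumes "C \<ge> 0" "\<And>e. e > 0 \<Longrightarrow> x \<ge> - (C * e)"
  shows "x \<ge> 0"
proof (rule ccontr)
  assume "\<not> x \<ge> 0"
  then have "- x / (C + 1) > 0" using assms(1) by (intro divide_pos_pos) auto
  from assms(2)[OF this] have "- x \<le> C * (- x / (C + 1))" by simp
  also have "\<dots> = (C / (C + 1)) * (- x)" by simp
  also have "\<dots> < 1 * (- x)" using \<open>\<not> x \<ge> 0\<close> assms(1) by (intro mult_strict_right_mono) auto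
  finally show False by simp
qed

lemma partition_Cc:
  fixes \<psi> :: "'a::euclidean_space \<Rightarrow> real"
  assumes \<psi>: "Cc D \<psi>" "\<And>x. \<psi> x \<ge> 0" and \<delta>: "\<delta> > 0"
  shows "\<exists>I g. finite I \<and> I \<subseteq> supp \<psi> \<and> (\<forall>i\<in>I. Cc D (g i) \<and> supp (g i) \<subseteq> supp \<psi> \<and>
     (\<forall>x. g i x \<ge> 0 \<and> (g i x \<noteq> 0 \<longrightarrow> dist i x < \<delta>))) \<and> (\<forall>x. (\<Sum>i\<in>I. g i x) = \<psi> x)"
proof -
  have "compact (supp \<psi>)" using \<psi> by (simp add: Cc_def)
  moreover have "supp \<psi> \<subseteq> (\<Union>c\<in>supp \<psi>. ball c \<delta>)" using \<delta> by auto
  ultimately obtain I where I: "I \<subseteq> supp \<psi>" "finite I" "supp \<psi> \<subseteq> (\<Union>c\<in>I. ball c \<delta>)"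
    by (metis compactE_image open_ball)
  define t where "t c x = max 0 (\<delta> - dist c x)" for c x :: 'a
  define S where "S x = (\<Sum>c\<in>I. t c x)" for x
  define W where "W = {x. S x > 0}"
  have t0: "t c x \<ge> 0" for c x by (simp add: t_def)
  have ct: "continuous_on A (t c)" for A c unfolding t_def[abs_def] by (intro continuous_intros)
  have cS: "continuous_on A S" for A unfolding S_def[abs_def] by (intro continuous_intros ct)
  have W: "open W" unfolding W_def by (intro open_Collect_less continuous_on_const cS)
  have KW: "supp \<psi> \<subseteq> W"
  proof
    fix x assume "x \<in> supp \<psi>"
    then obtain c where c: "c \<in> I" "dist c x < \<delta>" using I(3) by auto
    have "0 < t c x" using c by (simp add: t_def)
    also have "\<dots> \<le> S x" unfolding S_def using c I(2) t0 by (intro member_le_sum) auto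
    finally show "x \<in> W" by (simp add: W_def)
  qed
  define g where "g c x = t c x / S x * \<psi> x" for c x
  have "Cc D (g c)" for c unfolding g_def[abs_def]
    by (rule Cc_mult_local[OF \<psi>(1) _ W KW]) (intro continuous_intros ct cS, auto simp: W_def)
  moreover have "supp (g c) \<subseteq> supp \<psi>" for c
    by (rule supp_subset[OF closed_supp]) (simp add: g_def supp_zero)
  moreover have "g c x \<ge> 0" for c x
    unfolding g_def S_def using t0 \<psi>(2) by (intro mult_nonneg_nonneg divide_nonneg_nonneg sum_nonneg) auto
  moreover have "dist c x < \<delta>" if "g c x \<noteq> 0" for c x
    using that by (auto simp: g_def t_def max_def split: if_splits)
  moreover have "(\<Sum>c\<in>I. g c x) = \<psi> x" for x
  proof (cases "x \<in> supp \<psi>")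
    case True
    then have "S x > 0" using KW by (auto simp: W_def)
    moreover have "(\<Sum>c\<in>I. g c x) = (\<Sum>c\<in>I. t c x) / S x * \<psi> x"
      unfolding g_def by (simp add: sum_divide_distrib sum_distrib_right)
    moreover have "(\<Sum>c\<in>I. t c x) = S x" by (simp add: S_def)
    ultimately show ?thesis by simp
  next
    case False
    then show ?thesis by (simp add: g_def supp_zero)
  qed
  ultimately show ?thesis using I(1,2) by (intro exI[of _ I] exI[of _ g]) auto
qed

lemma current_sum_scaled:
  fixes g :: "'i \<Rightarrow> 'a::euclidean_space \<Rightarrow> real"
  assumes T: "order0_current D p T" and "finite I" and g: "\<And>i. i \<in> I \<Longrightarrow> Cc D (g i)" and \<Gamma>: "alternating p \<Gamma>"
  shows "T (\<lambda>z vs. (\<Sum>i\<in>I. c i * g i z) * \<Gamma> vs) = (\<Sum>i\<in>I. c i * T (\<lambda>z vs. g i z * \<Gamma> vs))"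
proof -
  have "T (\<lambda>z vs. (\<Sum>i\<in>I. c i * g i z) * \<Gamma> vs) = T (\<lambda>z vs. \<Sum>i\<in>I. (c i * g i z) * \<Gamma> vs)"
    by (simp add: sum_distrib_right)
  also have "\<dots> = (\<Sum>i\<in>I. T (\<lambda>z vs. (c i * g i z) * \<Gamma> vs))"
    using assms by (intro current_sum[OF T]) (auto intro: Cc_mult)
  also have "\<dots> = (\<Sum>i\<in>I. c i * T (\<lambda>z vs. g i z * \<Gamma> vs))"
    using current_lincomb[OF T g g \<Gamma>, of _ _ _ 0] by (intro sum.cong refl) simp
  finally show ?thesis .
qed

lemma current_diff:
  fixes f g :: "'a::euclidean_space \<Rightarrow> real"
  assumes "order0_current D p T" "Cc D f" "Cc D g" "alternating p \<Gamma>"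
  shows "T (\<lambda>z vs. (f z - g z) * \<Gamma> vs) = T (cform f \<Gamma>) - T (cform g \<Gamma>)"
  using current_lincomb[OF assms, of 1 "-1"] by simp

text \<open>With the Hessian frozen at x, the Levi form splits into finitely many
  \<open>sig a\<close>, and T is nonnegative on each product \<open>sigs (a # as)\<close>.\<close>

lemma pos_closed_const_Levi:
  assumes T: "pos_closed D p T" and as: "Suc (length as) = p" and g: "Cc D g" "\<And>x. g x \<ge> 0"
    and f: "smooth_fun f" and Levi: "\<And>v. hess (v, v) f x + hess (\<i> *s v, \<i> *s v) f x \<ge> 0"
  shows "0 \<le> (\<Sum>q\<in>Basis2. hess q f x * T (cform g (wedge2 q (sigs as))))"
proof -
  note T0 = pos_closedD(1)[OF T]
  have alt: "alternating (2 * p) (wedge2 q (sigs as))" for q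
    using alternating_wedge2[OF alternating_sigs[of as], of q] as by auto
  have sym: "hess (v, w) f x = hess (w, v) f x" for v w by (simp only: hess_sym[OF f, of v w])
  from Levi_form_sigs[of "\<lambda>v w. hess (v, w) f x", OF linear_hess[OF f] sym Levi]
  obtain ls where "\<forall>\<Gamma> vs. (\<Sum>q\<in>Basis2. hess (fst q, snd q) f x * wedge2 q \<Gamma> vs) = (\<Sum>a\<leftarrow>ls. sig a \<Gamma> vs)" ..
  then have ls: "(\<Sum>q\<in>Basis2. hess (fst q, snd q) f x * wedge2 q \<Gamma> vs) = (\<Sum>a\<leftarrow>ls. sig a \<Gamma> vs)" for \<Gamma> vs
    by blast
  have "(\<Sum>q\<in>Basis2. hess q f x * T (cform g (wedge2 q (sigs as))))
      = (\<Sum>q\<in>Basis2. T (\<lambda>z vs. (hess q f x * g z) * wedge2 q (sigs as) vs))"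
    using current_lincomb[OF T0 g(1) g(1) alt, of _ 0] by simp
  also have "\<dots> = T (\<lambda>z vs. \<Sum>q\<in>Basis2. (hess q f x * g z) * wedge2 q (sigs as) vs)"
    using g alt by (intro current_sum[OF T0, symmetric]) (auto intro: Cc_mult)
  also have "(\<lambda>z vs. \<Sum>q\<in>Basis2. (hess q f x * g z) * wedge2 q (sigs as) vs) = (\<lambda>z vs. \<Sum>i<length ls. g z * sigs (ls ! i # as) vs)"
  proof (intro ext)
    fix z vs
    have "(\<Sum>q\<in>Basis2. (hess q f x * g z) * wedge2 q (sigs as) vs) = g z * (\<Sum>q\<in>Basis2. hess (fst q, snd q) f x * wedge2 q (sigs as) vs)"
      by (simp add: sum_distrib_left mult.assoc mult.left_commute)
    also have "\<dots> = (\<Sum>i<length ls. g z * sigs (ls ! i # as) vs)"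
      unfolding ls by (simp add: sum_list_sum_nth sum_distrib_left sigs_Cons atLeast0LessThan)
    finally show "(\<Sum>q\<in>Basis2. (hess q f x * g z) * wedge2 q (sigs as) vs) = \<dots>" .
  qed
  also have "T \<dots> = (\<Sum>i<length ls. T (cform g (sigs (ls ! i # as))))"
  proof (rule current_sum[OF T0])
    show "alternating (2 * p) (sigs (ls ! i # as))" for i using alternating_sigs[of "ls ! i # as"] as by simp
  qed (use g in auto)
  also have "\<dots> \<ge> 0" using g as by (intro sum_nonneg pos_closedD(3)[OF T]) auto
  finally show ?thesis .
qed

text \<open>The splitting into squares need not depend continuously on the point. So \<psi> is cut
  into small pieces, the Hessian is frozen at the centre of each, and the order 0 bound controls the
  error by the uniform continuity of the Hessian on the support.\<close>

lemma pos_closed_Levi: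
  assumes T: "pos_closed D p T" and as: "Suc (length as) = p" and \<psi>: "Cc D \<psi>" "\<And>x. \<psi> x \<ge> 0"
    and f: "smooth_fun f" and Levi: "\<And>x v. x \<in> supp \<psi> \<Longrightarrow> hess (v, v) f x + hess (\<i> *s v, \<i> *s v) f x \<ge> 0"
  shows "0 \<le> T (fddc \<psi> f (sigs as))"
proof -
  note T0 = pos_closedD(1)[OF T]
  let ?W = "\<lambda>q. wedge2 q (sigs as)"
  have alt: "alternating (2 * p) (?W q)" for q
    using alternating_wedge2[OF alternating_sigs[of as], of q] as by auto
  have ch: "continuous_on A (hess q f)" for A q using smooth_fun_hess[OF f] by (rule continuous_on_smooth_fun)
  have K: "compact (supp \<psi>)" "supp \<psi> \<subseteq> D" using \<psi> by (auto simp: Cc_def)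
  obtain M where M: "M \<ge> 0" "\<And>x. \<bar>\<psi> x\<bar> \<le> M" using Cc_bounded[OF \<psi>(1)] by blast
  have "\<exists>C\<ge>0. \<forall>f N. Cc D f \<longrightarrow> supp f \<subseteq> supp \<psi> \<longrightarrow> (\<forall>x. \<bar>f x\<bar> \<le> N) \<longrightarrow> \<bar>T (cform f (?W q))\<bar> \<le> C * N" for q
    using current_bound[OF T0 K alt] .
  then obtain C where C: "\<And>q. C q \<ge> 0"
    "\<And>q f N. Cc D f \<Longrightarrow> supp f \<subseteq> supp \<psi> \<Longrightarrow> (\<And>x. \<bar>f x\<bar> \<le> N) \<Longrightarrow> \<bar>T (cform f (?W q))\<bar> \<le> C q * N" by metis
  have Cch: "Cc D (\<lambda>z. \<psi> z * hess q f z)" for q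
    using Cc_mult[OF \<psi>(1) ch[of UNIV q]] by (simp add: mult.commute)
  have E: "T (fddc \<psi> f (sigs as)) = (\<Sum>q\<in>Basis2. T (\<lambda>z vs. (\<psi> z * hess q f z) * ?W q vs))"
    unfolding mult_ddc[OF f] using Cch alt by (intro current_sum[OF T0]) auto
  show ?thesis
  proof (rule nonneg_of_epsilon)
    show "0 \<le> (\<Sum>q\<in>Basis2. C q * M)" using C(1) M(1) by (intro sum_nonneg mult_nonneg_nonneg) auto
    fix e :: real assume e: "e > 0"
    have "\<exists>\<delta>>0. \<forall>x\<in>supp \<psi>. \<forall>y\<in>supp \<psi>. dist y x < \<delta> \<longrightarrow> dist (hess q f y) (hess q f x) < e" for q
      using compact_uniformly_continuous[OF ch K(1), of q] e unfolding uniformly_continuous_on_def by blast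
    then obtain \<delta> where \<delta>: "\<And>q. \<delta> q > 0"
      "\<And>q x y. x \<in> supp \<psi> \<Longrightarrow> y \<in> supp \<psi> \<Longrightarrow> dist y x < \<delta> q \<Longrightarrow> dist (hess q f y) (hess q f x) < e" by metis
    define d where "d = Min (\<delta> ` Basis2)"
    have fin: "finite (\<delta> ` Basis2)" "\<delta> ` Basis2 \<noteq> {}" by auto
    have d: "d > 0" using \<delta>(1) fin by (simp add: d_def)
    have d_le: "d \<le> \<delta> q" if "q \<in> Basis2" for q unfolding d_def using that fin by (intro Min_le) auto
    obtain I g where I: "finite I" "I \<subseteq> supp \<psi>" and g: "\<And>i. i \<in> I \<Longrightarrow> Cc D (g i)" "\<And>i. i \<in> I \<Longrightarrow> supp (g i) \<subseteq> supp \<psi>"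
      "\<And>i x. i \<in> I \<Longrightarrow> g i x \<ge> 0" "\<And>i x. i \<in> I \<Longrightarrow> g i x \<noteq> 0 \<Longrightarrow> dist i x < d" "\<And>x. (\<Sum>i\<in>I. g i x) = \<psi> x"
      using partition_Cc[OF \<psi> d] by metis
    let ?h = "\<lambda>q z. \<Sum>i\<in>I. hess q f i * g i z"
    have gz: "g i x = 0" if "i \<in> I" "x \<notin> supp \<psi>" for i x
      using that(2) g(2)[OF that(1)] supp_zero[of x "g i"] by auto
    have Ch: "Cc D (?h q)" for q
    proof (rule Cc_intro[OF _ K])
      show "continuous_on UNIV (?h q)" by (intro continuous_intros Cc_continuous[of D] g(1))
      show "?h q x = 0" if "x \<notin> supp \<psi>" for x
        using gz that by (intro sum.neutral) auto
    qed
    have "0 \<le> (\<Sum>i\<in>I. \<Sum>q\<in>Basis2. hess q f i * T (\<lambda>z vs. g i z * ?W q vs))"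
      using I g Levi by (intro sum_nonneg pos_closed_const_Levi[OF T as]) (auto intro: f)
    also have "\<dots> = (\<Sum>q\<in>Basis2. \<Sum>i\<in>I. hess q f i * T (\<lambda>z vs. g i z * ?W q vs))" by (rule sum.swap)
    also have "\<dots> = (\<Sum>q\<in>Basis2. T (\<lambda>z vs. ?h q z * ?W q vs))"
      by (intro sum.cong refl current_sum_scaled[OF T0 I(1) g(1) alt, symmetric])
    finally have N: "0 \<le> \<dots>" .
    have "T (\<lambda>z vs. ?h q z * ?W q vs) - T (\<lambda>z vs. (\<psi> z * hess q f z) * ?W q vs) \<le> C q * (M * e)" if q: "q \<in> Basis2" for q
    proof -
      have "T (\<lambda>z vs. ?h q z * ?W q vs) - T (\<lambda>z vs. (\<psi> z * hess q f z) * ?W q vs)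
        = T (\<lambda>z vs. (?h q z - \<psi> z * hess q f z) * ?W q vs)"
        by (rule current_diff[OF T0 Ch Cch alt, symmetric])
      also have "\<dots> \<le> \<bar>\<dots>\<bar>" by simp
      also have "\<dots> \<le> C q * (M * e)"
      proof (rule C(2))
        show "Cc D (\<lambda>z. ?h q z - \<psi> z * hess q f z)"
        proof (rule Cc_intro[OF _ K])
          show "continuous_on UNIV (\<lambda>z. ?h q z - \<psi> z * hess q f z)"
            by (intro continuous_intros Cc_continuous[OF Ch] Cc_continuous[OF Cch])
          show "?h q x - \<psi> x * hess q f x = 0" if "x \<notin> supp \<psi>" for x
            using that gz by (simp add: supp_zero)
        qed
        show "supp (\<lambda>z. ?h q z - \<psi> z * hess q f z) \<subseteq> supp \<psi>"
        proof (rule supp_subset[OF closed_supp])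
          show "?h q x - \<psi> x * hess q f x = 0" if "x \<notin> supp \<psi>" for x
            using that gz by (simp add: supp_zero)
        qed
        fix x
        have "?h q x - \<psi> x * hess q f x = (\<Sum>i\<in>I. g i x * (hess q f i - hess q f x))"
          unfolding g(5)[symmetric] by (simp add: sum_distrib_left right_diff_distrib sum_subtractf mult.commute)
        also have "\<bar>\<dots>\<bar> \<le> (\<Sum>i\<in>I. g i x * e)"
        proof (rule order_trans[OF sum_abs], rule sum_mono)
          fix i assume i: "i \<in> I"
          show "\<bar>g i x * (hess q f i - hess q f x)\<bar> \<le> g i x * e"
          proof (cases "g i x = 0")
            case False
            then have "x \<in> supp \<psi>" using g(2)[OF i] supp_zero[of x "g i"] by blast
            moreover have "dist i x < \<delta> q" using g(4)[OF i False] d_le[OF q] by simp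
            ultimately have "\<bar>hess q f i - hess q f x\<bar> \<le> e" using \<delta>(2)[of x i q] I i by (auto simp: dist_real_def)
            then show ?thesis using g(3)[OF i, of x] by (simp add: abs_mult mult_left_mono)
          qed simp
        qed
        also have "\<dots> = \<psi> x * e" by (simp add: sum_distrib_right[symmetric] g(5))
        also have "\<dots> \<le> M * e" using M(2)[of x] e by (intro mult_right_mono) auto
        finally show "\<bar>?h q x - \<psi> x * hess q f x\<bar> \<le> M * e" .
      qed
      finally show ?thesis .
    qed
    then have "(\<Sum>q\<in>Basis2. T (\<lambda>z vs. ?h q z * ?W q vs) - T (\<lambda>z vs. (\<psi> z * hess q f z) * ?W q vs)) \<le> (\<Sum>q\<in>Basis2. C q * (M * e))"
      by (rule sum_mono)
    with N show "T (fddc \<psi> f (sigs as)) \<ge> - ((\<Sum>q\<in>Basis2. C q * M) * e)"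
      unfolding E by (simp add: sum_subtractf sum_distrib_right mult.assoc)
  qed
qed

text \<open>Mollification of \<open>w\<close> makes \<open>dd\<^sup>c w\<close> a nonnegative form that can be paired with \<open>T\<close>; since \<open>T\<close> has
  order \<open>0\<close>, only uniform convergence of the mollified functions is needed.\<close>

lemma pos_closed_psh:
  fixes w :: "complex^'n::finite \<Rightarrow> real"
  assumes T: "pos_closed D p T" and as: "Suc (length as) = p" and \<psi>: "test_fun D \<psi>" "\<And>x. \<psi> x \<ge> 0" and r: "r > 0"
    and cont: "continuous_on {x + y |x y. x \<in> supp \<psi> \<and> y \<in> cball 0 (2 * r)} w"
    and sub: "\<And>x y v. x \<in> supp \<psi> \<Longrightarrow> norm y < r \<Longrightarrow> norm v < r \<Longrightarrow> submean w (x + y) v"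
  shows "0 \<le> T (fddc w \<psi> (sigs as))"
proof -
  note T0 = pos_closedD(1)[OF T]
  let ?W = "\<lambda>q. wedge2 q (sigs as)"
  have alt: "alternating (2 * p) (?W q)" for q
    using alternating_wedge2[OF alternating_sigs[of as], of q] as by auto
  have sm: "smooth_fun \<psi>" and Cp: "Cc D \<psi>" using \<psi> by (auto simp: test_fun_def)
  have K: "compact (supp \<psi>)" "supp \<psi> \<subseteq> D" using Cp by (auto simp: Cc_def)
  define V where "V = (\<Union>x\<in>supp \<psi>. ball x r)"
  have V: "open V" "supp \<psi> \<subseteq> V" unfolding V_def using r by auto
  have "V \<subseteq> {x + y |x y. x \<in> supp \<psi> \<and> y \<in> cball 0 (2 * r)}"
  proof
    fix z assume "z \<in> V"
    then obtain x where x: "x \<in> supp \<psi>" "dist x z < r" by (auto simp: V_def)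
    then have "z - x \<in> cball 0 (2 * r)" using r by (simp add: dist_norm norm_minus_commute)
    then show "z \<in> {x + y |x y. x \<in> supp \<psi> \<and> y \<in> cball 0 (2 * r)}"
      using x(1) by (intro CollectI exI[of _ x] exI[of _ "z - x"]) auto
  qed
  then have cV: "continuous_on V w" using cont continuous_on_subset by blast
  have Ch: "Cc D (hess q \<psi>)" for q using test_fun_hess[OF \<psi>(1)] by (simp add: test_fun_def)
  have sh: "supp (hess q \<psi>) \<subseteq> supp \<psi>" for q by (rule supp_hess)
  have Cwh: "Cc D (\<lambda>z. w z * hess q \<psi> z)" for q
    using sh[of q] V(2) by (intro Cc_mult_local[OF Ch cV V(1)]) blast
  have "\<exists>M\<ge>0. \<forall>x. \<bar>hess q \<psi> x\<bar> \<le> M" for q using Cc_bounded[OF Ch] .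
  then obtain M where M: "\<And>q. M q \<ge> 0" "\<And>q x. \<bar>hess q \<psi> x\<bar> \<le> M q" by metis
  have "\<exists>C\<ge>0. \<forall>f N. Cc D f \<longrightarrow> supp f \<subseteq> supp \<psi> \<longrightarrow> (\<forall>x. \<bar>f x\<bar> \<le> N) \<longrightarrow> \<bar>T (cform f (?W q))\<bar> \<le> C * N" for q
    using current_bound[OF T0 K alt] .
  then obtain C where C: "\<And>q. C q \<ge> 0"
    "\<And>q f N. Cc D f \<Longrightarrow> supp f \<subseteq> supp \<psi> \<Longrightarrow> (\<And>x. \<bar>f x\<bar> \<le> N) \<Longrightarrow> \<bar>T (cform f (?W q))\<bar> \<le> C q * N" by metis
  show ?thesis
  proof (rule nonneg_of_epsilon)
    show "0 \<le> (\<Sum>q\<in>Basis2. C q * M q)" using C(1) M(1) by (intro sum_nonneg mult_nonneg_nonneg) auto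
    fix e :: real assume e: "e > 0"
    obtain f where f: "smooth_fun f" "\<And>x. x \<in> supp \<psi> \<Longrightarrow> \<bar>f x - w x\<bar> \<le> e"
      "\<And>x v. x \<in> supp \<psi> \<Longrightarrow> pd v (pd v f) x + pd (\<i> *s v) (pd (\<i> *s v) f) x \<ge> 0"
      using smooth_psh_approx[OF K(1) r cont sub e] by metis
    have Cfh: "Cc D (\<lambda>z. f z * hess q \<psi> z)" for q
      using Cc_mult[OF Ch continuous_on_smooth_fun[OF f(1)]] .
    have "0 \<le> T (fddc \<psi> f (sigs as))"
      using f by (intro pos_closed_Levi[OF T as Cp \<psi>(2) f(1)]) (simp add: hess_def)
    \<comment> \<open>Closedness of T moves dd^c from the approximant to the cutoff. From here on
      only values of f enter, so uniform closeness to w suffices although the derivatives of f are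
      uncontrolled.\<close>
    also have "\<dots> = T (fddc f \<psi> (sigs as))"
      using as by (intro pos_closedD(2)[OF T f(1) \<psi>(1) alternating_sigs, symmetric]) auto
    also have "\<dots> = (\<Sum>q\<in>Basis2. T (\<lambda>z vs. (f z * hess q \<psi> z) * ?W q vs))"
      unfolding mult_ddc[OF sm] using Cfh alt by (intro current_sum[OF T0]) auto
    finally have N: "0 \<le> \<dots>" .
    have E: "T (fddc w \<psi> (sigs as)) = (\<Sum>q\<in>Basis2. T (\<lambda>z vs. (w z * hess q \<psi> z) * ?W q vs))"
      unfolding mult_ddc[OF sm] using Cwh alt by (intro current_sum[OF T0]) auto
    have "T (\<lambda>z vs. (f z * hess q \<psi> z) * ?W q vs) - T (\<lambda>z vs. (w z * hess q \<psi> z) * ?W q vs) \<le> C q * (M q * e)" for q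
    proof -
      have z: "f x * hess q \<psi> x - w x * hess q \<psi> x = 0" if "x \<notin> supp \<psi>" for x
        using that sh[of q] supp_zero[of x "hess q \<psi>"] by auto
      have "T (\<lambda>z vs. (f z * hess q \<psi> z) * ?W q vs) - T (\<lambda>z vs. (w z * hess q \<psi> z) * ?W q vs)
         = T (\<lambda>z vs. (f z * hess q \<psi> z - w z * hess q \<psi> z) * ?W q vs)"
        by (rule current_diff[OF T0 Cfh Cwh alt, symmetric])
      also have "\<dots> \<le> \<bar>\<dots>\<bar>" by simp
      also have "\<dots> \<le> C q * (M q * e)"
      proof (rule C(2))
        show "Cc D (\<lambda>z. f z * hess q \<psi> z - w z * hess q \<psi> z)"
          using z by (intro Cc_intro[OF _ K] continuous_intros Cc_continuous[OF Cfh] Cc_continuous[OF Cwh])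
        show "supp (\<lambda>z. f z * hess q \<psi> z - w z * hess q \<psi> z) \<subseteq> supp \<psi>" using z by (rule supp_subset[OF closed_supp])
        fix x
        show "\<bar>f x * hess q \<psi> x - w x * hess q \<psi> x\<bar> \<le> M q * e"
        proof (cases "x \<in> supp \<psi>")
          case True
          have "\<bar>f x * hess q \<psi> x - w x * hess q \<psi> x\<bar> = \<bar>hess q \<psi> x\<bar> * \<bar>f x - w x\<bar>"
            by (simp add: abs_mult[symmetric] algebra_simps)
          also have "\<dots> \<le> M q * e" using M f(2)[OF True] by (intro mult_mono) auto
          finally show ?thesis .
        next
          case False
          show ?thesis unfolding z[OF False] using M(1)[of q] e by simp
        qed
      qed
      finally show ?thesis .
    qed
    then have "(\<Sum>q\<in>Basis2. T (\<lambda>z vs. (f z * hess q \<psi> z) * ?W q vs) - T (\<lambda>z vs. (w z * hess q \<psi> z) * ?W q vs)) \<le> (\<Sum>q\<in>Basis2. C q * (M q * e))"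
      by (rule sum_mono)
    with N show "T (fddc w \<psi> (sigs as)) \<ge> - ((\<Sum>q\<in>Basis2. C q * M q) * e)"
      unfolding E by (simp add: sum_subtractf sum_distrib_right mult.assoc)
  qed
qed

lemma pos_closed_psh_open:
  fixes w :: "complex^'n::finite \<Rightarrow> real"
  assumes T: "pos_closed D p T" and as: "Suc (length as) = p" and \<psi>: "test_fun D \<psi>" "\<And>x. \<psi> x \<ge> 0"
    and V: "open V" "supp \<psi> \<subseteq> V" "continuous_on V w" and sub: "\<And>z v. cball z (norm v) \<subseteq> V \<Longrightarrow> submean w z v"
  shows "0 \<le> T (fddc w \<psi> (sigs as))"
proof -
  have K: "compact (supp \<psi>)" using \<psi> by (auto simp: test_fun_def Cc_def)
  obtain R where R: "R > 0" "(\<Union>x\<in>supp \<psi>. cball x R) \<subseteq> V"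
    using compact_subset_open_imp_cball_epsilon_subset[OF K V(1,2)] by metis
  have inV: "y \<in> V" if "x \<in> supp \<psi>" "dist x y \<le> R" for x y using R(2) that by (auto simp: UN_subset_iff subset_eq)
  show ?thesis
  proof (rule pos_closed_psh[OF T as \<psi>, of "R / 2"])
    show "R / 2 > 0" using R by simp
    show "continuous_on {x + y |x y. x \<in> supp \<psi> \<and> y \<in> cball 0 (2 * (R / 2))} w"
      by (rule continuous_on_subset[OF V(3)]) (auto intro!: inV simp: dist_norm)
    fix x y v :: "complex^'n" assume xyv: "x \<in> supp \<psi>" "norm y < R / 2" "norm v < R / 2"
    show "submean w (x + y) v"
    proof (rule sub, rule subsetI)
      fix z assume "z \<in> cball (x + y) (norm v)"
      then have "dist x z \<le> R" using xyv dist_triangle[of x z "x + y"] by (simp add: dist_norm)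
      then show "z \<in> V" using inV xyv(1) by blast
    qed
  qed
qed

section \<open>From plurisubharmonicity to positivity along the recursion\<close>

text \<open>For continuous u the positive and the negative part have finite integrals over the
  circle, so the extended real difference in \<open>circle_mean\<close> is an ordinary
  integral.\<close>

lemma submean_of_plurisubharmonic:
  fixes u :: "complex^'n::finite \<Rightarrow> real"
  assumes psh: "plurisubharmonic_on D (\<lambda>z. ereal (u z))" and cont: "continuous_on D u"
    and disc: "\<And>y. dist z y \<le> norm v \<Longrightarrow> y \<in> D"
  shows "submean u z v"
proof -
  have inD: "z + \<zeta> *s v \<in> D" if "cmod \<zeta> \<le> 1" for \<zeta>
    using that by (intro disc) (simp add: dist_norm norm_scaleC mult_left_le_one_le)
  let ?I = "{0..2 * pi}" and ?g = "\<lambda>t. u (z + cis t *s v)"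
  have cg: "continuous_on ?I ?g"
    by (rule continuous_on_compose2[OF cont]) (auto intro!: continuous_intros inD)
  define h where "h t = indicator ?I t *\<^sub>R ?g t" for t
  have inth: "integrable lborel h" unfolding h_def using cg by (intro borel_integrable_compact) auto
  have "integral ?I ?g = (LINT t|lborel. h t)"
  proof -
    have "integral ?I ?g = integral UNIV (\<lambda>t. if t \<in> ?I then ?g t else 0)" by (simp only: integral_restrict_UNIV)
    also have "(\<lambda>t. if t \<in> ?I then ?g t else 0) = h" by (auto simp: h_def fun_eq_iff)
    finally show ?thesis using integral_lborel[OF inth] by simp
  qed
  define A B where "A = (\<integral>\<^sup>+t. ennreal (h t) \<partial>lborel)" and "B = (\<integral>\<^sup>+t. ennreal (- h t) \<partial>lborel)"
  have fin: "A < \<infinity>" "B < \<infinity>"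
    using inth unfolding A_def B_def real_integrable_def by (auto simp: less_top)
  have LI: "(LINT t|lborel. h t) = enn2real A - enn2real B"
    unfolding A_def B_def by (rule real_lebesgue_integral_def[OF inth])
  have eA: "(\<integral>\<^sup>+t\<in>?I. e2ennreal (ereal (?g t)) \<partial>lborel) = A"
    unfolding A_def by (rule nn_integral_cong) (auto simp: h_def indicator_def e2ennreal_ereal)
  have eB: "(\<integral>\<^sup>+t\<in>?I. e2ennreal (- ereal (?g t)) \<partial>lborel) = B"
    unfolding B_def by (rule nn_integral_cong) (auto simp: h_def indicator_def e2ennreal_ereal)
  have "ereal (u z) \<le> circle_mean (\<lambda>z. ereal (u z)) z v"
    using psh inD unfolding plurisubharmonic_on_def by blast
  also have "\<dots> = ereal (1 / (2 * pi)) * (enn2ereal A - enn2ereal B)"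
    unfolding circle_mean_def eA eB ..
  also have "enn2ereal A - enn2ereal B = ereal (enn2real A - enn2real B)"
    using fin by (cases A; cases B) (auto simp: enn2ereal_ennreal)
  finally have "u z \<le> 1 / (2 * pi) * (enn2real A - enn2real B)" by simp
  then have "2 * pi * u z \<le> enn2real A - enn2real B" by (simp add: field_simps)
  then show ?thesis unfolding submean_def \<open>integral ?I ?g = (LINT t|lborel. h t)\<close> LI .
qed

lemma integrate_top_form_sum:
  fixes f :: "'i \<Rightarrow> complex^'n::finite \<Rightarrow> real"
  assumes "\<And>i. i \<in> I \<Longrightarrow> Cc D (f i)"
  shows "integrate_top_form (\<lambda>z vs. \<Sum>i\<in>I. f i z * \<Gamma> i vs) = (\<Sum>i\<in>I. \<Gamma> i std_frame * (LINT z|lborel. f i z))"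
  unfolding integrate_top_form_def
  by (subst Bochner_Integration.integral_sum) (auto intro!: Cc_integrable[OF assms] simp: mult.commute)

lemma pos_closed_Lebesgue:
  fixes T :: "(complex^'n::finite) dform \<Rightarrow> real"
  assumes T: "MA_current D u 0 T"
  shows "pos_closed D CARD('n) T"
  unfolding pos_closed_def
proof (intro conjI allI impI)
  have T0: "order0_current D (2 * CARD('n)) T" and
    TI: "\<And>\<phi>. \<phi> \<in> cont_test_forms D (2 * CARD('n)) \<Longrightarrow> T \<phi> = integrate_top_form \<phi>" using T by auto
  show "order0_current D (2 * CARD('n)) T" by (rule T0)
  fix f \<eta> :: "complex^'n \<Rightarrow> real" and \<Gamma> :: "(complex^'n) list \<Rightarrow> real" and q assume f: "smooth_fun f" and \<eta>: "test_fun D \<eta>" and \<Gamma>: "alternating q \<Gamma>" and q: "q + 2 = 2 * CARD('n)"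
  have alt: "alternating (2 * CARD('n)) (wedge2 r \<Gamma>)" for r using alternating_wedge2[OF \<Gamma>, of r] q by simp
  have 1: "Cc D (\<lambda>z. f z * hess r \<eta> z)" for r
    using test_fun_mult[OF f test_fun_hess[OF \<eta>]] by (rule test_fun_Cc)
  have 2: "Cc D (\<lambda>z. \<eta> z * hess r f z)" for r
    using test_fun_mult'[OF smooth_fun_hess[OF f] \<eta>] by (rule test_fun_Cc)
  have U: "test_fun UNIV \<eta>" using \<eta> by (auto simp: test_fun_def intro: Cc_mono)
  have "T (fddc f \<eta> \<Gamma>) = (\<Sum>r\<in>Basis2. wedge2 r \<Gamma> std_frame * (LINT z|lborel. f z * hess r \<eta> z))"
    unfolding mult_ddc[OF test_fun_smooth[OF \<eta>]] using 1 alt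
    by (subst TI) (auto intro!: sum_form_in_cont_test_forms integrate_top_form_sum)
  also have "\<dots> = (\<Sum>r\<in>Basis2. wedge2 r \<Gamma> std_frame * (LINT z|lborel. \<eta> z * hess r f z))"
    by (simp only: integral_hess[OF f U])
  also have "\<dots> = T (fddc \<eta> f \<Gamma>)"
    unfolding mult_ddc[OF f] using 2 alt
    by (subst TI) (auto intro!: sum_form_in_cont_test_forms integrate_top_form_sum[symmetric])
  finally show "T (fddc f \<eta> \<Gamma>) = T (fddc \<eta> f \<Gamma>)" .
next
  fix f :: "complex^'n \<Rightarrow> real" and as :: "(complex^'n) list"
  assume f: "Cc D f" "\<forall>x. 0 \<le> f x" and as: "length as = CARD('n)"
  have "T (cform f (sigs as)) = integrate_top_form (cform f (sigs as))"
    using T f(1) alternating_sigs[of as] as by (auto intro!: form_in_cont_test_forms)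
  also have "\<dots> \<ge> 0" unfolding integrate_top_form_def
    using f(2) sigs_std_frame_nonneg[OF as] by (intro Bochner_Integration.integral_nonneg) auto
  finally show "0 \<le> T (cform f (sigs as))" .
qed

text \<open>Induction along the recursion. Closedness of T needs no derivative of u: after inserting
  the definition, it is the symmetry of dd^c (f dd^c \<eta>) under S. Positivity on smooth
  coefficients is \<open>pos_closed_psh_open\<close> for S and u; order 0 extends it to continuous
  coefficients.\<close>

lemma pos_closed_MA_current:
  fixes D :: "(complex^'n::finite) set"
  assumes D: "open D" and cont: "continuous_on D u"
    and sub: "\<And>z v. (\<And>y. dist z y \<le> norm v \<Longrightarrow> y \<in> D) \<Longrightarrow> submean u z v"
  shows "m \<le> CARD('n) \<Longrightarrow> MA_current D u m T \<Longrightarrow> pos_closed D (CARD('n) - m) T"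
proof (induction m arbitrary: T)
  case 0
  then show ?case using pos_closed_Lebesgue by simp
next
  case (Suc m)
  let ?p = "CARD('n) - Suc m"
  have p: "CARD('n) - m = Suc ?p" using Suc.prems(1) by simp
  from Suc.prems(2) obtain S where S: "MA_current D u m S" and T0: "order0_current D (2 * ?p) T"
    and TS: "\<And>\<phi>. \<phi> \<in> smooth_test_forms D (2 * ?p) \<Longrightarrow> T \<phi> = S (\<lambda>z vs. u z * ddc \<phi> z vs)" by auto
  have pS: "pos_closed D (Suc ?p) S" using Suc.IH[OF _ S] Suc.prems(1) p by simp
  show ?case unfolding pos_closed_def
  proof (intro conjI allI impI)
    show "order0_current D (2 * ?p) T" by (rule T0)
    fix f \<eta> :: "complex^'n \<Rightarrow> real" and \<Gamma> :: "(complex^'n) list \<Rightarrow> real" and q assume f: "smooth_fun f" and \<eta>: "test_fun D \<eta>" and \<Gamma>: "alternating q \<Gamma>" and q: "q + 2 = 2 * ?p"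
    have alt: "alternating (2 * ?p) (wedge2 r \<Gamma>)" for r using alternating_wedge2[OF \<Gamma>, of r] q by simp
    have 1: "(fddc f \<eta> \<Gamma>) \<in> smooth_test_forms D (2 * ?p)"
      unfolding mult_ddc[OF test_fun_smooth[OF \<eta>]]
      using alt by (intro sum_form_in_smooth_test_forms test_fun_mult f test_fun_hess \<eta>) auto
    have 2: "(fddc \<eta> f \<Gamma>) \<in> smooth_test_forms D (2 * ?p)"
      unfolding mult_ddc[OF f]
      using alt by (intro sum_form_in_smooth_test_forms test_fun_mult' smooth_fun_hess f \<eta>) auto
    show "T (fddc f \<eta> \<Gamma>) = T (fddc \<eta> f \<Gamma>)"
      unfolding TS[OF 1] TS[OF 2] ddc_mult_ddc_symmetric[OF f test_fun_smooth[OF \<eta>]] ..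
  next
    fix f :: "complex^'n \<Rightarrow> real" and as :: "(complex^'n) list"
    assume f: "Cc D f" "\<forall>x. 0 \<le> f x" and as: "length as = ?p"
    have alt: "alternating (2 * ?p) (sigs as)" using alternating_sigs[of as] as by simp
    have smooth: "0 \<le> T (cform g (sigs as))" if g: "test_fun D g" "\<And>x. 0 \<le> g x" for g
    proof -
      have "0 \<le> S (fddc u g (sigs as))"
      proof (rule pos_closed_psh_open[OF pS _ g D _ cont])
        show "Suc (length as) = Suc ?p" using as by simp
        show "supp g \<subseteq> D" using g by (simp add: test_fun_def Cc_def)
        show "submean u z v" if "cball z (norm v) \<subseteq> D" for z v using that by (intro sub) auto
      qed
      then show ?thesis using TS[OF form_in_smooth_test_forms[OF g(1) alt]] by simp
    qed
    obtain K where K: "compact K" "K \<subseteq> D" "supp f \<subseteq> K"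
      "\<And>e. e > 0 \<Longrightarrow> \<exists>g. test_fun D g \<and> supp g \<subseteq> K \<and> (\<forall>x. g x \<ge> 0 \<and> \<bar>g x - f x\<bar> \<le> e)"
      using smooth_approx_nonneg[OF f(1) _ D] f(2) by blast
    obtain C where C: "C \<ge> 0" "\<And>h M. Cc D h \<Longrightarrow> supp h \<subseteq> K \<Longrightarrow> (\<And>x. \<bar>h x\<bar> \<le> M) \<Longrightarrow> \<bar>T (cform h (sigs as))\<bar> \<le> C * M"
      using current_bound[OF T0 K(1,2) alt] by blast
    show "0 \<le> T (cform f (sigs as))"
    proof (rule nonneg_of_epsilon[OF C(1)])
      fix e :: real assume "e > 0"
      then obtain g where g: "test_fun D g" "supp g \<subseteq> K" "\<And>x. g x \<ge> 0" "\<And>x. \<bar>g x - f x\<bar> \<le> e" using K(4) by blast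
      have z: "g x - f x = 0" if "x \<notin> K" for x
      proof -
        have "x \<notin> supp g" "x \<notin> supp f" using that g(2) K(3) by blast+
        then show ?thesis by (simp add: supp_zero)
      qed
      have cg: "Cc D g" using g by (simp add: test_fun_def)
      have "T (cform g (sigs as)) - T (cform f (sigs as)) = T (\<lambda>z vs. (g z - f z) * sigs as vs)"
        by (rule current_diff[OF T0 cg f(1) alt, symmetric])
      also have "\<dots> \<le> \<bar>\<dots>\<bar>" by simp
      also have "\<dots> \<le> C * e"
      proof (rule C(2))
        show "Cc D (\<lambda>x. g x - f x)"
          using z by (intro Cc_intro[OF _ K(1,2)] continuous_intros Cc_continuous[OF cg] Cc_continuous[OF f(1)])
        show "supp (\<lambda>x. g x - f x) \<subseteq> K" using z K(1) by (intro supp_subset compact_imp_closed)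
      qed (rule g(4))
      finally show "- (C * e) \<le> T (cform f (sigs as))" using smooth[OF g(1,3)] by linarith
    qed
  qed
qed

section \<open>Quadratic comparison functions\<close>

lemma continuous_on_circle_comp:
  fixes w :: "complex^'n \<Rightarrow> real"
  assumes "continuous_on (cball z (norm v)) w"
  shows "continuous_on A (\<lambda>t. w (z + cis t *s v))"
  by (rule continuous_on_compose2[OF assms]) (auto intro!: continuous_intros simp: dist_norm norm_scaleC)

lemma submean_add:
  fixes u w :: "complex^'n \<Rightarrow> real"
  assumes "continuous_on (cball z (norm v)) u" "continuous_on (cball z (norm v)) w" "submean u z v" "submean w z v"
  shows "submean (\<lambda>z. u z + w z) z v"
proof -
  have "integral {0..2 * pi} (\<lambda>t. u (z + cis t *s v) + w (z + cis t *s v)) =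
      integral {0..2 * pi} (\<lambda>t. u (z + cis t *s v)) + integral {0..2 * pi} (\<lambda>t. w (z + cis t *s v))"
    by (intro integral_add integrable_continuous_real continuous_on_circle_comp assms)
  with assms(3,4) show ?thesis by (simp add: submean_def distrib_left)
qed

lemma submean_max:
  fixes u w :: "complex^'n \<Rightarrow> real"
  assumes "continuous_on (cball z (norm v)) u" "continuous_on (cball z (norm v)) w" "submean u z v" "submean w z v"
  shows "submean (\<lambda>z. max (u z) (w z)) z v"
proof -
  have "integral {0..2 * pi} (\<lambda>t. u (z + cis t *s v)) \<le> integral {0..2 * pi} (\<lambda>t. max (u (z + cis t *s v)) (w (z + cis t *s v)))"
    "integral {0..2 * pi} (\<lambda>t. w (z + cis t *s v)) \<le> integral {0..2 * pi} (\<lambda>t. max (u (z + cis t *s v)) (w (z + cis t *s v)))"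
    by (intro integral_le integrable_continuous_real continuous_intros continuous_on_circle_comp assms; simp)+
  with assms(3,4) show ?thesis by (auto simp: submean_def max_def)
qed

section \<open>Quadratic polynomials and their dd^c\<close>

definition quad :: "real \<Rightarrow> 'a::euclidean_space \<Rightarrow> ('a \<Rightarrow> 'a \<Rightarrow> real) \<Rightarrow> 'a \<Rightarrow> 'a \<Rightarrow> real" where
  "quad \<beta> l q p z = \<beta> + (z - p) \<bullet> l + q (z - p) (z - p)"

definition sym_bilinear :: "('a::real_vector \<Rightarrow> 'a \<Rightarrow> real) \<Rightarrow> bool" where
  "sym_bilinear q \<longleftrightarrow> (\<forall>w. linear (\<lambda>v. q v w)) \<and> (\<forall>v w. q v w = q w v)"

lemma sym_bilinearD:
  assumes "sym_bilinear q"
  shows "linear (\<lambda>v. q v w)" "q v w = q w v" "linear (q v)"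
proof -
  show 1: "linear (\<lambda>v. q v w)" for w using assms by (auto simp: sym_bilinear_def)
  show 2: "q v w = q w v" for v w using assms unfolding sym_bilinear_def by blast
  show "linear (q v)" using 1 2 by (rule linear_of_symmetric)
qed

lemma sym_bilinear_lincomb:
  assumes "sym_bilinear q" "sym_bilinear q'"
  shows "sym_bilinear (\<lambda>v w. s * q v w + t * q' v w)"
  unfolding sym_bilinear_def
proof (intro conjI allI)
  show "linear (\<lambda>v. s * q v w + t * q' v w)" for w
    using linear_compose_add[OF linear_compose_scale_right[OF sym_bilinearD(1)[OF assms(1)], of s]
      linear_compose_scale_right[OF sym_bilinearD(1)[OF assms(2)], of t]] by simp
  show "s * q v w + t * q' v w = s * q w v + t * q' w v" for v w
    by (simp only: sym_bilinearD(2)[OF assms(1), of v w] sym_bilinearD(2)[OF assms(2), of v w])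
qed

lemma sym_bilinear_sum: "(\<And>i. i \<in> I \<Longrightarrow> sym_bilinear (q i)) \<Longrightarrow> sym_bilinear (\<lambda>v w. \<Sum>i\<in>I. q i v w)"
proof (induction I rule: infinite_finite_induct)
  case (insert i I)
  then show ?case using sym_bilinear_lincomb[of "q i" "\<lambda>v w. \<Sum>i\<in>I. q i v w" 1 1] by simp
qed (simp_all add: sym_bilinear_def linear_zero)

context
  fixes q :: "'a::euclidean_space \<Rightarrow> 'a \<Rightarrow> real"
  assumes q: "sym_bilinear q"
begin

lemma pd_quad: "pd v (quad \<beta> l q p) = (\<lambda>z. v \<bullet> l + 2 * q (z - p) v)"
proof
  fix z
  have "bilinear q" unfolding bilinear_def using sym_bilinearD[OF q] by blast
  then interpret bounded_bilinear q by (simp add: bilinear_conv_bounded_bilinear)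
  have "(quad \<beta> l q p has_derivative (\<lambda>v. v \<bullet> l + 2 * q (z - p) v)) (at z)"
    unfolding quad_def[abs_def]
    by (rule derivative_eq_intros FDERIV refl)+ (use sym_bilinearD(2)[OF q] in \<open>auto simp: fun_eq_iff\<close>)
  then show "pd v (quad \<beta> l q p) z = v \<bullet> l + 2 * q (z - p) v" by (rule pd_eqI)
qed

lemma hess_quad: "hess (b, c) (quad \<beta> l q p) z = 2 * q b c"
proof -
  have "((\<lambda>z. b \<bullet> l + 2 * q (z - p) b) has_derivative (\<lambda>v. 2 * q v b)) (at z)"
  proof -
    have "bounded_linear (\<lambda>v. q v b)" using sym_bilinearD(1)[OF q] by (simp add: linear_conv_bounded_linear)
    then have "((\<lambda>z. q (z - p) b) has_derivative (\<lambda>v. q v b)) (at z)"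
      by (rule bounded_linear.has_derivative) (auto intro!: derivative_eq_intros)
    then show ?thesis by (auto intro!: derivative_eq_intros)
  qed
  then show ?thesis unfolding hess_def fst_conv snd_conv pd_quad
    using pd_eqI sym_bilinearD(2)[OF q, of c b] by fastforce
qed

lemma smooth_quad: "smooth_fun (quad \<beta> l q p)"
proof -
  have lin: "smooth_fun (\<lambda>z. (z - p) \<bullet> b)" for b
  proof -
    have "smooth_fun (\<lambda>z. z \<bullet> b - p \<bullet> b)"
      by (intro smooth_fun_diff smooth_fun_const smooth_fun_bounded_linear bounded_linear_inner_left)
    then show ?thesis by (simp add: inner_diff_left)
  qed
  have "q x x = (\<Sum>b\<in>Basis. \<Sum>c\<in>Basis. q c b * ((x \<bullet> b) * (x \<bullet> c)))" for x
  proof -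
    have "q x x = q (\<Sum>b\<in>Basis. (x \<bullet> b) *\<^sub>R b) (\<Sum>b\<in>Basis. (x \<bullet> b) *\<^sub>R b)" by (simp add: euclidean_representation)
    also have "\<dots> = (\<Sum>b\<in>Basis. \<Sum>c\<in>Basis. q c b * ((x \<bullet> b) * (x \<bullet> c)))"
      by (simp only: linear_sum[OF sym_bilinearD(1)[OF q]] linear_scale[OF sym_bilinearD(1)[OF q]]
        linear_sum[OF sym_bilinearD(3)[OF q]] linear_scale[OF sym_bilinearD(3)[OF q]] real_scaleR_def sum_distrib_left)
        (simp add: algebra_simps)
    finally show ?thesis .
  qed
  then have "quad \<beta> l q p = (\<lambda>z. (\<beta> + (z - p) \<bullet> l) + (\<Sum>b\<in>Basis. \<Sum>c\<in>Basis. q c b * (((z - p) \<bullet> b) * ((z - p) \<bullet> c))))"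
    by (simp add: quad_def fun_eq_iff)
  moreover have "smooth_fun \<dots>"
    by (intro smooth_fun_add smooth_fun_const lin smooth_fun_sum smooth_fun_cmult smooth_fun_mult)
  ultimately show ?thesis by simp
qed

end

lemma submean_quad:
  fixes q :: "complex^'n \<Rightarrow> complex^'n \<Rightarrow> real"
  assumes q: "sym_bilinear q" and nn: "q v v + q (\<i> *s v) (\<i> *s v) \<ge> 0"
  shows "submean (quad \<beta> l q p) z v"
proof -
  let ?x = "z - p"
  note l1 = sym_bilinearD(1)[OF q] and l2 = sym_bilinearD(3)[OF q]
  have "quad \<beta> l q p (z + cis t *s v) = (v \<bullet> l + 2 * q ?x v) * cos t + ((\<i> *s v) \<bullet> l + 2 * q ?x (\<i> *s v)) * sin t
     + q v v * (cos t)\<^sup>2 + 2 * q v (\<i> *s v) * (cos t * sin t) + q (\<i> *s v) (\<i> *s v) * (sin t)\<^sup>2 + quad \<beta> l q p z" for t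
  proof -
    have "z + cis t *s v - p = ?x + (cos t *\<^sub>R v + sin t *\<^sub>R (\<i> *s v))" by (simp add: cis_scale)
    moreover have "q v ?x = q ?x v" "q (\<i> *s v) ?x = q ?x (\<i> *s v)" "q (\<i> *s v) v = q v (\<i> *s v)"
      by (rule sym_bilinearD(2)[OF q])+
    ultimately show ?thesis
      unfolding quad_def
      by (simp only: inner_add_left inner_scaleR_left linear_add[OF l1] linear_scale[OF l1] linear_add[OF l2] linear_scale[OF l2] real_scaleR_def)
        (simp add: power2_eq_square algebra_simps)
  qed
  then have "integral {0..2 * pi} (\<lambda>t. quad \<beta> l q p (z + cis t *s v)) =
     pi * (q v v + q (\<i> *s v) (\<i> *s v)) + 2 * pi * quad \<beta> l q p z"
    using circle_quadratic by (simp only:) (rule integral_unique)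
  with nn show ?thesis by (simp add: submean_def)
qed

text \<open>The real part of the hermitian form of the functional \<ell> attached to a; on the
  diagonal it is |\<ell>(v)|^2.\<close>

definition herm :: "complex^'n \<Rightarrow> complex^'n \<Rightarrow> complex^'n \<Rightarrow> real" where
  "herm a v w = (v \<bullet> a) * (w \<bullet> a) + (v \<bullet> (\<i> *s a)) * (w \<bullet> (\<i> *s a))"

lemma sym_bilinear_herm: "sym_bilinear (herm a)"
  unfolding sym_bilinear_def herm_def by (auto intro!: linearI simp: inner_simps algebra_simps)

lemma herm_nonneg: "herm a v v \<ge> 0"
  by (simp add: herm_def)

lemma sum_wedge2_herm: "(\<Sum>r\<in>Basis2. herm a (fst r) (snd r) * wedge2 r \<Gamma> vs) = 2 * sig a \<Gamma> vs"
proof -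
  have "herm a v w = (\<Sum>a\<leftarrow>[a, \<i> *s a]. (v \<bullet> a) * (w \<bullet> a))" for v w by (simp add: herm_def)
  from sum_wedge2_squares[of "herm a", OF this, of \<Gamma> vs] show ?thesis by (simp add: sig_scale)
qed

text \<open>Rotation by i leaves the contraction unchanged but reverses the sign of q.\<close>

lemma sum_wedge2_pluriharmonic:
  assumes q: "sym_bilinear q" and J: "\<And>v w. q (\<i> *s v) (\<i> *s w) = - q v w"
  shows "(\<Sum>r\<in>Basis2. q (fst r) (snd r) * wedge2 r \<Gamma> vs) = 0"
proof -
  have "(\<Sum>r\<in>Basis2. - q (fst r) (snd r) * wedge2 r \<Gamma> vs) = (\<Sum>r\<in>Basis2. q (fst r) (snd r) * wedge2 r \<Gamma> vs)"
    using sum_wedge2_ii[OF sym_bilinearD(1,2)[OF q], of \<Gamma> vs] unfolding J .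
  then show ?thesis by (simp add: sum_negf)
qed

lemma ddc_quad:
  fixes q :: "complex^'n \<Rightarrow> complex^'n \<Rightarrow> real"
  assumes q: "sym_bilinear q"
  shows "ddc (\<lambda>z vs. quad \<beta> l q p z * \<Gamma> vs) = (\<lambda>z vs. 2 * (\<Sum>r\<in>Basis2. q (fst r) (snd r) * wedge2 r \<Gamma> vs))"
proof -
  have "hess r (quad \<beta> l q p) z = 2 * q (fst r) (snd r)" for r z
    using hess_quad[OF q, of "fst r" "snd r"] by simp
  then show ?thesis by (simp add: ddc_single[OF smooth_quad[OF q]] sum_distrib_left mult.assoc)
qed

lemma pos_closed_linear:
  fixes f g :: "complex^'n::finite \<Rightarrow> real"
  assumes T: "pos_closed D p T" and \<Gamma>: "alternating n \<Gamma>" "n + 2 = 2 * p" and \<psi>: "test_fun D \<psi>"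
    and V: "open V" "supp \<psi> \<subseteq> V" and f: "continuous_on V f" and g: "continuous_on V g"
  shows "T (\<lambda>z vs. (f z + c * g z) * ddc (cform \<psi> \<Gamma>) z vs) =
    T (fddc f \<psi> \<Gamma>) + c * T (fddc g \<psi> \<Gamma>)"
proof -
  have alt: "alternating (2 * p) (wedge2 r \<Gamma>)" for r using alternating_wedge2[OF \<Gamma>(1), of r] \<Gamma>(2) by simp
  have "(fddc h \<psi> \<Gamma>) \<in> cont_test_forms D (2 * p)" if "continuous_on V h" for h
    unfolding mult_ddc[OF test_fun_smooth[OF \<psi>]]
  proof (rule sum_form_in_cont_test_forms)
    show "Cc D (\<lambda>z. h z * hess r \<psi> z)" for r
      using supp_hess[of r \<psi>] V(2) by (intro Cc_mult_local[OF test_fun_Cc[OF test_fun_hess[OF \<psi>]] that V(1)]) blast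
  qed (use alt in auto)
  from current_linear[OF pos_closedD(1)[OF T] this[OF f] this[OF g], of 1 c]
  show ?thesis by (simp add: distrib_right mult.assoc)
qed

lemma pd_lincomb:
  assumes "smooth_fun f" "smooth_fun g"
  shows "pd v (\<lambda>x. f x + c * g x) x = pd v f x + c * pd v g x"
  using pd_add[OF smooth_fun_differentiable[OF assms(1)] smooth_fun_differentiable[OF smooth_fun_cmult[OF assms(2)]]]
    pd_cmult[OF smooth_fun_differentiable[OF assms(2)]] by metis

text \<open>The role of the maximum \<open>w\<close> of \<open>u\<close> (plus a term annihilated by \<open>sigs as\<close>) and the quadratic polynomial
  \<open>G\<close>: it differs from \<open>u\<close> only where the cutoff function is constant, so \<open>dd\<^sup>c w \<and> S\<close> has mass zero as
  \<open>dd\<^sup>c u \<and> S\<close> has. Being positive, it vanishes, while near \<open>p\<close> it is \<open>dd\<^sup>c G \<and> S\<close>, a multiple of \<open>sig a \<and> S\<close>.\<close>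

lemma descent_step:
  fixes u :: "complex^'n::finite \<Rightarrow> real"
  assumes S: "pos_closed D (Suc (length as)) S" and D: "open D" and cont: "continuous_on D u"
    and sub: "\<And>z v. cball z (norm v) \<subseteq> D \<Longrightarrow> submean u z v"
    and zero: "\<And>\<psi>. test_fun (ball p \<delta>) \<psi> \<Longrightarrow> (\<And>x. 0 \<le> \<psi> x \<and> \<psi> x \<le> 1) \<Longrightarrow>
        S (fddc u \<psi> (sigs as)) = 0"
    and \<delta>: "0 < \<delta>\<^sub>1" "\<delta>\<^sub>1 < \<delta>\<^sub>2" "\<delta>\<^sub>2 \<le> \<delta>" "ball p \<delta> \<subseteq> D"
    and q: "sym_bilinear q" "\<And>v w. q (\<i> *s v) (\<i> *s w) = - q v w"
    and bs: "bs \<subseteq> set as" and pos: "\<epsilon> > 0" "M \<ge> 0"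
    and shell: "\<And>z. \<delta>\<^sub>1 \<le> dist p z \<Longrightarrow> dist p z < \<delta>\<^sub>2 \<Longrightarrow>
        quad \<beta> l (\<lambda>v w. q v w + \<epsilon> * herm a v w) p z < u z + M * (\<Sum>b\<in>bs. herm b (z - p) (z - p))"
    and centre: "u p < \<beta>"
  shows "\<exists>\<eta>>0. \<eta> \<le> \<delta> \<and> (\<forall>\<psi>. test_fun (ball p \<eta>) \<psi> \<longrightarrow> (\<forall>x. 0 \<le> \<psi> x \<and> \<psi> x \<le> 1) \<longrightarrow>
      S (cform \<psi> (sigs (a # as))) = 0)"
proof -
  let ?\<Gamma> = "sigs as"
  have alt: "alternating (2 * length as) ?\<Gamma>" by (rule alternating_sigs)
  define G where "G = quad \<beta> l (\<lambda>v w. q v w + \<epsilon> * herm a v w) p"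
  define R where "R = quad 0 0 (\<lambda>v w. \<Sum>b\<in>bs. herm b v w) p"
  have sG: "sym_bilinear (\<lambda>v w. q v w + \<epsilon> * herm a v w)"
    using sym_bilinear_lincomb[OF q(1) sym_bilinear_herm, of 1 \<epsilon> a] by simp
  have sR: "sym_bilinear (\<lambda>v w. \<Sum>b\<in>bs. herm b v w)" by (intro sym_bilinear_sum sym_bilinear_herm)
  have smG: "smooth_fun G" and smR: "smooth_fun R"
    unfolding G_def R_def by (rule smooth_quad[OF sG], rule smooth_quad[OF sR])
  have ddcG: "ddc (cform G ?\<Gamma>) = (\<lambda>z vs. 4 * \<epsilon> * sigs (a # as) vs)"
  proof -
    have "(\<Sum>r\<in>Basis2. (q (fst r) (snd r) + \<epsilon> * herm a (fst r) (snd r)) * wedge2 r ?\<Gamma> vs)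
      = (\<Sum>r\<in>Basis2. q (fst r) (snd r) * wedge2 r ?\<Gamma> vs) + \<epsilon> * (\<Sum>r\<in>Basis2. herm a (fst r) (snd r) * wedge2 r ?\<Gamma> vs)" for vs
      by (simp add: distrib_right sum.distrib sum_distrib_left mult.assoc)
    then show ?thesis
      unfolding G_def ddc_quad[OF sG] by (simp add: sum_wedge2_pluriharmonic[OF q] sum_wedge2_herm sigs_Cons mult.assoc)
  qed
  have ddcR: "ddc (cform R ?\<Gamma>) = (\<lambda>z vs. 0)"
  proof -
    have "sig b ?\<Gamma> = (\<lambda>vs. 0)" if "b \<in> bs" for b
      using sigs_Cons_span[of b as] that bs by (simp add: sigs_Cons vec.span_base subset_eq)
    then have "(\<Sum>b\<in>bs. \<Sum>r\<in>Basis2. herm b (fst r) (snd r) * wedge2 r ?\<Gamma> vs) = 0" for vs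
      by (simp add: sum_wedge2_herm)
    moreover have "(\<Sum>r\<in>Basis2. (\<Sum>b\<in>bs. herm b (fst r) (snd r)) * wedge2 r ?\<Gamma> vs)
       = (\<Sum>b\<in>bs. \<Sum>r\<in>Basis2. herm b (fst r) (snd r) * wedge2 r ?\<Gamma> vs)" for vs
      unfolding sum_distrib_right by (rule sum.swap)
    ultimately show ?thesis unfolding R_def ddc_quad[OF sR] by simp
  qed
  \<comment> \<open>The penalty lifts u off the common zero set of \<open>bs\<close>, so the shell
    inequality gives G < u' on the whole shell; against \<open>sigs as\<close> its dd^c vanishes by
    \<open>ddcR\<close>.\<close>
  define u' where "u' z = u z + M * R z" for z
  define w where "w z = max (u' z) (G z)" for z
  have R_eq: "R z = (\<Sum>b\<in>bs. herm b (z - p) (z - p))" for z by (simp add: R_def quad_def)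
  have cR: "continuous_on A R" and cG: "continuous_on A G" for A
    by (rule continuous_on_smooth_fun[OF smR], rule continuous_on_smooth_fun[OF smG])
  have cu': "continuous_on D u'" unfolding u'_def[abs_def] by (intro continuous_intros cont cR)
  have cw: "continuous_on D w" unfolding w_def[abs_def] by (intro continuous_intros cu' cG)
  have subw: "submean w z v" if z: "cball z (norm v) \<subseteq> D" for z v
    unfolding w_def[abs_def]
  proof (rule submean_max)
    have "submean (\<lambda>z. M * R z) z v"
    proof -
      have "submean R z v" unfolding R_def
        by (intro submean_quad sR add_nonneg_nonneg sum_nonneg herm_nonneg)
      then have "M * (2 * pi * R z) \<le> M * integral {0..2 * pi} (\<lambda>t. R (z + cis t *s v))"
        unfolding submean_def using pos by (intro mult_left_mono) auto
      then show ?thesis by (simp add: submean_def mult.left_commute)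
    qed
    then show "submean u' z v" unfolding u'_def[abs_def]
      by (intro submean_add sub z continuous_on_subset[OF cont z] continuous_intros cR)
    have "q v v + q (\<i> *s v) (\<i> *s v) = 0" using q(2)[of v v] by simp
    then have "q v v + \<epsilon> * herm a v v + (q (\<i> *s v) (\<i> *s v) + \<epsilon> * herm a (\<i> *s v) (\<i> *s v)) \<ge> 0"
      using pos(1) herm_nonneg[of a v] herm_nonneg[of a "\<i> *s v"] by (simp add: q(2))
    then show "submean G z v" unfolding G_def by (intro submean_quad sG)
    show "continuous_on (cball z (norm v)) u'" using cu' z by (rule continuous_on_subset)
  qed (rule cG)
  have mainD: "test_fun D \<psi>" if "test_fun (ball p s) \<psi>" "s \<le> \<delta>" for \<psi> s
    using that \<delta>(4) unfolding test_fun_def by (meson Cc_mono subset_ball subset_trans)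
  have suppD: "supp \<psi> \<subseteq> D" if "test_fun D \<psi>" for \<psi> using that by (simp add: test_fun_def Cc_def)
  have nonneg: "0 \<le> S (fddc w \<psi> ?\<Gamma>)" if "test_fun D \<psi>" "\<And>x. 0 \<le> \<psi> x" for \<psi>
    by (rule pos_closed_psh_open[OF S refl that D suppD[OF that(1)] cw subw])
  define s where "s = (\<delta>\<^sub>1 + \<delta>\<^sub>2) / 2"
  have s: "0 < s" "\<delta>\<^sub>1 < s" "s < \<delta>\<^sub>2" using \<delta> by (auto simp: s_def)
  obtain \<psi>\<^sub>0 where \<psi>\<^sub>0: "test_fun (ball p \<delta>\<^sub>2) \<psi>\<^sub>0" "\<And>x. 0 \<le> \<psi>\<^sub>0 x \<and> \<psi>\<^sub>0 x \<le> 1" "\<And>x. dist p x \<le> s \<Longrightarrow> \<psi>\<^sub>0 x = 1"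
    using smooth_plateau[OF s(1,3)] by metis
  have \<psi>\<^sub>0D: "test_fun D \<psi>\<^sub>0" using mainD[OF \<psi>\<^sub>0(1) \<delta>(3)] .
  have zero0: "S (fddc w \<psi>\<^sub>0 ?\<Gamma>) = 0"
  proof -
    have "w z * hess r \<psi>\<^sub>0 z = (u z + M * R z) * hess r \<psi>\<^sub>0 z" for r z
    proof -
      \<comment> \<open>The cutoff is constant inside, \<open>w\<close> equals u' on the shell, and
        the cutoff vanishes outside. So \<open>w\<close> and u' have the same pairing with its
        dd^c.\<close>
      consider "dist p z < \<delta>\<^sub>1" | "\<delta>\<^sub>1 \<le> dist p z" "dist p z < \<delta>\<^sub>2" | "\<delta>\<^sub>2 \<le> dist p z" by linarith
      then show ?thesis
      proof cases
        case 1
        have "pd (fst r) \<psi>\<^sub>0 y = pd (fst r) (\<lambda>_. 1) y" if "y \<in> ball p s" for y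
          using that \<psi>\<^sub>0(3) by (intro pd_cong_open[of "ball p s"]) auto
        then have "hess r \<psi>\<^sub>0 z = pd (snd r) (\<lambda>_. 0) z"
          using 1 s unfolding hess_def by (intro pd_cong_open[of "ball p s"]) (auto simp: pd_const)
        then show ?thesis by (simp add: pd_const)
      next
        case 2
        then have "G z < u' z" using shell[OF 2] by (simp add: G_def u'_def R_eq)
        then show ?thesis by (simp add: w_def u'_def)
      next
        case 3
        then have "z \<notin> supp (hess r \<psi>\<^sub>0)"
          using supp_hess[of r \<psi>\<^sub>0] \<psi>\<^sub>0(1) by (auto simp: test_fun_def Cc_def)
        then show ?thesis by (simp add: supp_zero)
      qed
    qed
    then have "S (fddc w \<psi>\<^sub>0 ?\<Gamma>) = S (\<lambda>z vs. (u z + M * R z) * ddc (cform \<psi>\<^sub>0 ?\<Gamma>) z vs)"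
      unfolding mult_ddc[OF test_fun_smooth[OF \<psi>\<^sub>0D]] by (simp only:)
    also have "\<dots> = S (fddc u \<psi>\<^sub>0 ?\<Gamma>) + M * S (fddc R \<psi>\<^sub>0 ?\<Gamma>)"
      by (rule pos_closed_linear[OF S alt _ \<psi>\<^sub>0D D suppD[OF \<psi>\<^sub>0D] cont cR]) simp
    \<comment> \<open>Moving dd^c onto R makes the penalty disappear.\<close>
    also have "S (fddc R \<psi>\<^sub>0 ?\<Gamma>) = S (fddc \<psi>\<^sub>0 R ?\<Gamma>)"
      by (rule pos_closedD(2)[OF S smR \<psi>\<^sub>0D alt]) simp
    also have "\<dots> = S (\<lambda>z vs. 0 * ddc (cform \<psi>\<^sub>0 ?\<Gamma>) z vs)" unfolding ddcR by simp
    also have "\<dots> = 0"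
      using pos_closed_linear[OF S alt _ \<psi>\<^sub>0D D suppD[OF \<psi>\<^sub>0D], of "\<lambda>_. 0" "\<lambda>_. 0" 1] by simp
    also have "S (fddc u \<psi>\<^sub>0 ?\<Gamma>) = 0"
    proof (rule zero[OF _ \<psi>\<^sub>0(2)])
      show "test_fun (ball p \<delta>) \<psi>\<^sub>0" using \<psi>\<^sub>0(1) \<delta>(3) unfolding test_fun_def by (meson Cc_mono subset_ball)
    qed
    finally show ?thesis by simp
  qed
  have pD: "p \<in> D" using \<delta> by auto
  have "R p = 0" by (simp add: R_eq herm_def)
  moreover have "G p = \<beta>"
    using linear_0[OF sym_bilinearD(1)[OF sG, of 0]] by (simp add: G_def quad_def)
  ultimately have "u' p - G p < 0" using centre by (simp add: u'_def)
  moreover have "isCont (\<lambda>z. u' z - G z) p"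
    using cu' cG[of D] pD D by (intro continuous_intros) (auto simp: continuous_on_eq_continuous_at)
  ultimately obtain \<eta>\<^sub>0 where \<eta>\<^sub>0: "\<eta>\<^sub>0 > 0" "\<And>z. dist z p < \<eta>\<^sub>0 \<Longrightarrow> u' z - G z < 0"
  proof -
    assume a: "u' p - G p < 0" "isCont (\<lambda>z. u' z - G z) p"
      and th: "\<And>\<eta>\<^sub>0. 0 < \<eta>\<^sub>0 \<Longrightarrow> (\<And>z. dist z p < \<eta>\<^sub>0 \<Longrightarrow> u' z - G z < 0) \<Longrightarrow> thesis"
    from a(2)[unfolded continuous_at_eps_delta, rule_format, of "- (u' p - G p)"] a(1)
    obtain d where "d > 0" "\<And>z. dist z p < d \<Longrightarrow> dist (u' z - G z) (u' p - G p) < - (u' p - G p)" by auto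
    then show thesis by (intro th[of d]) (auto simp: dist_real_def abs_less_iff)
  qed
  define \<eta> where "\<eta> = min \<eta>\<^sub>0 \<delta>\<^sub>1"
  have \<eta>: "\<eta> > 0" "\<eta> \<le> \<delta>" "\<eta> \<le> \<eta>\<^sub>0" "\<eta> \<le> s" using \<eta>\<^sub>0 \<delta> s by (auto simp: \<eta>_def)
  have "S (cform \<psi> (sigs (a # as))) = 0" if \<psi>: "test_fun (ball p \<eta>) \<psi>" "\<And>x. 0 \<le> \<psi> x \<and> \<psi> x \<le> 1" for \<psi>
  proof -
    have \<psi>D: "test_fun D \<psi>" using mainD[OF \<psi>(1) \<eta>(2)] .
    have sup: "supp \<psi> \<subseteq> ball p \<eta>" using \<psi>(1) by (simp add: test_fun_def Cc_def)
    \<comment> \<open>Both \<psi> and \<open>?\<phi>\<close> are nonnegative, since the cutoff is 1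
      wherever \<psi> lives. Their masses are nonnegative and add up to the mass of the cutoff,
      which is 0, so each of them is 0.\<close>
    let ?\<phi> = "\<lambda>x. \<psi>\<^sub>0 x + (- 1) * \<psi> x"
    have dD: "test_fun D ?\<phi>"
    proof -
      have "smooth_fun ?\<phi>" using \<psi>\<^sub>0D \<psi>D by (intro smooth_fun_add smooth_fun_cmult test_fun_smooth)
      moreover have "Cc D ?\<phi>"
      proof (rule Cc_intro[of _ "supp \<psi>\<^sub>0 \<union> supp \<psi>"])
        show "continuous_on UNIV ?\<phi>" using calculation by (rule continuous_on_smooth_fun)
      qed (use \<psi>\<^sub>0D \<psi>D in \<open>auto simp: test_fun_def Cc_def supp_zero\<close>)
      ultimately show ?thesis by (simp add: test_fun_def)
    qed
    have d0: "0 \<le> ?\<phi> x" for x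
    proof (cases "x \<in> ball p \<eta>")
      case True
      then show ?thesis using \<psi>\<^sub>0(3)[of x] \<psi>(2)[of x] \<eta>(4) by auto
    next
      case False
      then have "\<psi> x = 0" using sup supp_zero[of x \<psi>] by blast
      then show ?thesis using \<psi>\<^sub>0(2)[of x] by simp
    qed
    have H: "hess r ?\<phi> z = hess r \<psi>\<^sub>0 z + (- 1) * hess r \<psi> z" for r z
    proof -
      have "pd v (\<lambda>x. f x + (- 1) * g x) = (\<lambda>x. pd v f x + (- 1) * pd v g x)" if "smooth_fun f" "smooth_fun g"
        for v and f g :: "complex^'n \<Rightarrow> real"
        using that by (intro ext pd_lincomb)
      then show ?thesis unfolding hess_def using \<psi>\<^sub>0D \<psi>D by (simp only: test_fun_smooth smooth_fun_pd)
    qed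
    have "(fddc w ?\<phi> ?\<Gamma>) =
       (\<lambda>z vs. 1 * (w z * ddc (cform \<psi>\<^sub>0 ?\<Gamma>) z vs) + (- 1) * (w z * ddc (cform \<psi> ?\<Gamma>) z vs))"
      unfolding ddc_single[OF test_fun_smooth[OF dD]] ddc_single[OF test_fun_smooth[OF \<psi>\<^sub>0D]]
        ddc_single[OF test_fun_smooth[OF \<psi>D]] H
      by (simp add: left_diff_distrib right_diff_distrib sum_subtractf)
    moreover have form: "(fddc w \<phi> ?\<Gamma>) \<in> cont_test_forms D (2 * Suc (length as))" if \<phi>: "test_fun D \<phi>" for \<phi>
      unfolding mult_ddc[OF test_fun_smooth[OF \<phi>]]
    proof (rule sum_form_in_cont_test_forms)
      show "Cc D (\<lambda>z. w z * hess r \<phi> z)" for r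
        using supp_hess[of r \<phi>] suppD[OF \<phi>] by (intro Cc_mult_local[OF test_fun_Cc[OF test_fun_hess[OF \<phi>]] cw D]) blast
      show "alternating (2 * Suc (length as)) (wedge2 r ?\<Gamma>)" for r using alternating_wedge2[OF alt, of r] by simp
    qed simp
    ultimately have "S (fddc w ?\<phi> ?\<Gamma>) = 0 - S (fddc w \<psi> ?\<Gamma>)"
      using current_linear[OF pos_closedD(1)[OF S] form[OF \<psi>\<^sub>0D] form[OF \<psi>D], of 1 "- 1"] zero0 by simp
    with nonneg[OF dD d0] nonneg[OF \<psi>D] \<psi>(2)
    have z: "S (fddc w \<psi> ?\<Gamma>) = 0" by force
    \<comment> \<open>On the support of \<psi> the maximum is attained by G, whose dd^c is known
      exactly.\<close>
    have "w z * hess r \<psi> z = G z * hess r \<psi> z" for r z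
    proof (cases "z \<in> ball p \<eta>")
      case True
      then have "u' z < G z" using \<eta>\<^sub>0(2)[of z] \<eta>(3) by (simp add: dist_commute)
      then show ?thesis by (simp add: w_def)
    next
      case False
      then have "z \<notin> supp (hess r \<psi>)" using sup supp_hess[of r \<psi>] by blast
      then show ?thesis by (simp add: supp_zero)
    qed
    then have "S (fddc w \<psi> ?\<Gamma>) = S (fddc G \<psi> ?\<Gamma>)"
      unfolding mult_ddc[OF test_fun_smooth[OF \<psi>D]] by (simp only:)
    also have "\<dots> = S (fddc \<psi> G ?\<Gamma>)"
      by (rule pos_closedD(2)[OF S smG \<psi>D alt]) simp
    also have "\<dots> = S (\<lambda>z vs. (4 * \<epsilon> * \<psi> z + 0 * \<psi> z) * sigs (a # as) vs)"
      unfolding ddcG by (simp add: mult_ac)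
    also have "\<dots> = 4 * \<epsilon> * S (cform \<psi> (sigs (a # as)))"
      using current_lincomb[OF pos_closedD(1)[OF S] test_fun_Cc[OF \<psi>D] test_fun_Cc[OF \<psi>D], of "sigs (a # as)" "4 * \<epsilon>" 0]
        alternating_sigs[of "a # as"] by simp
    finally show ?thesis using z pos(1) by simp
  qed
  with \<eta> show ?thesis by blast
qed

section \<open>Faces of the sublevel set\<close>

text \<open>Where f is not positive, h is, and on that compact set it has a positive minimum. This
  is the one compactness argument behind all constants in \<open>shell_peak\<close>.\<close>

lemma compact_domination:
  fixes f h :: "'a::metric_space \<Rightarrow> real"
  assumes X: "compact X" and f: "continuous_on X f" and h: "continuous_on X h"
    and nn: "\<And>x. x \<in> X \<Longrightarrow> h x \<ge> 0" and pos: "\<And>x. x \<in> X \<Longrightarrow> h x = 0 \<Longrightarrow> f x > 0"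
  shows "\<exists>M>0. \<forall>x\<in>X. f x + M * h x > 0"
proof -
  define Z where "Z = {x \<in> X. f x \<le> 0}"
  have Z: "compact Z" unfolding Z_def
    using continuous_closedin_preimage[OF f closed_atMost[of 0]] closedin_compact[OF X]
    by (simp add: vimage_def Int_def)
  show ?thesis
  proof (cases "Z = {}")
    case True
    then show ?thesis using nn by (intro exI[of _ 1]) (force simp: Z_def intro: add_pos_nonneg)
  next
    case False
    have ZX: "Z \<subseteq> X" by (auto simp: Z_def)
    obtain x0 where x0: "x0 \<in> Z" "\<And>x. x \<in> Z \<Longrightarrow> h x0 \<le> h x"
      using continuous_attains_inf[OF Z False continuous_on_subset[OF h ZX]] by blast
    obtain x1 where x1: "x1 \<in> Z" "\<And>x. x \<in> Z \<Longrightarrow> f x1 \<le> f x"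
      using continuous_attains_inf[OF Z False continuous_on_subset[OF f ZX]] by blast
    have c: "h x0 > 0" using nn[of x0] pos[of x0] x0(1) unfolding Z_def by force
    have F: "f x1 \<le> 0" using x1(1) by (simp add: Z_def)
    \<comment> \<open>On Z the term M h is at least 1 - f x1, which compensates the minimum of f and
      leaves 1.\<close>
    define M where "M = (1 - f x1) / h x0"
    have M: "M > 0" unfolding M_def using c F by (intro divide_pos_pos) auto
    have "f x + M * h x > 0" if x: "x \<in> X" for x
    proof (cases "x \<in> Z")
      case True
      have "1 - f x1 = M * h x0" unfolding M_def using c by simp
      also have "\<dots> \<le> M * h x" using M x0(2)[OF True] by simp
      finally show ?thesis using x1(2)[OF True] by linarith
    next
      case False
      then have "f x > 0" using x by (simp add: Z_def)
      then show ?thesis using M nn[OF x] by (simp add: add_pos_nonneg)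
    qed
    with M show ?thesis by blast
  qed
qed

section \<open>Face directions and the maximum principle\<close>

text \<open>For convex B and p in B, the direction space of the smallest face of B that contains
  p.\<close>

definition facial_dirs :: "'a::real_vector set \<Rightarrow> 'a \<Rightarrow> 'a set" where
  "facial_dirs B p = {v. \<exists>e>0. p + e *\<^sub>R v \<in> B \<and> p - e *\<^sub>R v \<in> B}"

lemma convex_towards:
  assumes "convex B" "p \<in> B" "p + v \<in> B" "0 \<le> t" "t \<le> 1"
  shows "p + t *\<^sub>R v \<in> B"
proof -
  have "(1 - t) *\<^sub>R p + t *\<^sub>R (p + v) \<in> B" using assms by (intro convexD) auto
  then show ?thesis by (simp add: algebra_simps)
qed

lemma facial_dirs_shrink:
  assumes "convex B" "p \<in> B" "p + e *\<^sub>R v \<in> B" "0 < d" "d \<le> e"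
  shows "p + d *\<^sub>R v \<in> B"
  using convex_towards[OF assms(1-3), of "d / e"] assms(4,5) by simp

lemma subspace_facial_dirs:
  assumes B: "convex B" "p \<in> B"
  shows "subspace (facial_dirs B p)"
proof (rule subspaceI)
  show "0 \<in> facial_dirs B p" using B(2) by (auto simp: facial_dirs_def intro: exI[of _ 1])
  fix v w assume "v \<in> facial_dirs B p" "w \<in> facial_dirs B p"
  then obtain d e where d: "d > 0" "p + d *\<^sub>R v \<in> B" "p + d *\<^sub>R (- v) \<in> B"
    and e: "e > 0" "p + e *\<^sub>R w \<in> B" "p + e *\<^sub>R (- w) \<in> B" by (auto simp: facial_dirs_def)
  let ?m = "min d e"
  have "p + ?m *\<^sub>R v \<in> B" "p + ?m *\<^sub>R w \<in> B" "p + ?m *\<^sub>R (- v) \<in> B" "p + ?m *\<^sub>R (- w) \<in> B"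
    using facial_dirs_shrink[OF B d(2)] facial_dirs_shrink[OF B e(2)]
      facial_dirs_shrink[OF B d(3)] facial_dirs_shrink[OF B e(3)] d(1) e(1) by simp_all
  \<comment> \<open>The midpoint of the points reached along v and w with a common step realises the
    direction v + w, and likewise for the negatives.\<close>
  then have "(1 / 2) *\<^sub>R (p + ?m *\<^sub>R v) + (1 / 2) *\<^sub>R (p + ?m *\<^sub>R w) \<in> B"
    "(1 / 2) *\<^sub>R (p + ?m *\<^sub>R (- v)) + (1 / 2) *\<^sub>R (p + ?m *\<^sub>R (- w)) \<in> B"
    by (intro convexD[OF B(1)]; simp)+
  moreover have "(1 / 2) *\<^sub>R (p + ?m *\<^sub>R x) + (1 / 2) *\<^sub>R (p + ?m *\<^sub>R y) = p + (?m / 2) *\<^sub>R (x + y)" for x y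
    by (simp add: scaleR_add_right scaleR_add_left[symmetric] flip: scaleR_half_double)
  ultimately have "p + (?m / 2) *\<^sub>R (v + w) \<in> B" "p + (?m / 2) *\<^sub>R (- v + - w) \<in> B" by (simp_all only:)
  moreover have "p + (?m / 2) *\<^sub>R (- v + - w) = p - (?m / 2) *\<^sub>R (v + w)" by (simp add: algebra_simps)
  ultimately have "p + (?m / 2) *\<^sub>R (v + w) \<in> B" "p - (?m / 2) *\<^sub>R (v + w) \<in> B" by (simp_all only:)
  moreover have "?m / 2 > 0" using d e by simp
  ultimately show "v + w \<in> facial_dirs B p" unfolding facial_dirs_def by blast
next
  fix c :: real and v assume "v \<in> facial_dirs B p"
  then obtain d where d: "d > 0" "p + d *\<^sub>R v \<in> B" "p - d *\<^sub>R v \<in> B" by (auto simp: facial_dirs_def)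
  show "c *\<^sub>R v \<in> facial_dirs B p"
  proof (cases "c = 0")
    case True
    then show ?thesis using B(2) by (auto simp: facial_dirs_def intro: exI[of _ 1])
  next
    case False
    have "(d / \<bar>c\<bar>) *\<^sub>R (c *\<^sub>R v) = (if c > 0 then d *\<^sub>R v else - (d *\<^sub>R v))" using False by auto
    moreover have "d / \<bar>c\<bar> > 0" using False d by simp
    ultimately show ?thesis using d unfolding facial_dirs_def by (intro CollectI exI[of _ "d / \<bar>c\<bar>"]) auto
  qed
qed

lemma vec_subspace_imp_subspace: "vec.subspace L \<Longrightarrow> subspace (L :: (complex^'n) set)"
proof (rule subspaceI)
  fix c :: real and v assume "vec.subspace L" "v \<in> L"
  then have "complex_of_real c *s v \<in> L" by (rule vec.subspace_scale)
  moreover have "complex_of_real c *s v = c *\<^sub>R v" by (simp add: vec_eq_iff complex_eq_iff)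
  ultimately show "c *\<^sub>R v \<in> L" by simp
qed (auto intro: vec.subspace_0 vec.subspace_add)

text \<open>The sub-mean inequality makes the integral of a nonnegative continuous function
  nonpositive, so it vanishes on the circle; t = 0 is the point p + v.\<close>

lemma constant_on_disc_of_max:
  fixes u :: "complex^'n \<Rightarrow> real"
  assumes sub: "submean u p v" and cont: "continuous_on (cball p (norm v)) u"
    and le: "\<And>t. u (p + cis t *s v) \<le> u p"
  shows "u (p + v) = u p"
proof -
  let ?f = "\<lambda>t. u p - u (p + cis t *s v)"
  have cf: "continuous_on {0..2 * pi} ?f" by (intro continuous_intros continuous_on_circle_comp cont)
  have "integral {0..2 * pi} ?f = integral {0..2 * pi} (\<lambda>t. u p) - integral {0..2 * pi} (\<lambda>t. u (p + cis t *s v))"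
    by (intro integral_diff integrable_continuous_real continuous_intros continuous_on_circle_comp cont)
  also have "\<dots> \<le> 0" using sub by (simp add: submean_def)
  finally have "integral {0..2 * pi} ?f \<le> 0" .
  moreover have "integral {0..2 * pi} ?f \<ge> 0"
    using cf le by (intro Henstock_Kurzweil_Integration.integral_nonneg integrable_continuous_real) auto
  ultimately have "integral {0..2 * pi} ?f = 0" by simp
  then have "\<forall>t\<in>{0..2 * pi}. ?f t = 0"
    using integral_eq_0_iff[OF cf] le by auto
  then have "?f 0 = 0" by (rule bspec) simp
  then show ?thesis by simp
qed

text \<open>Facial directions reach both sides of p, so the slice of the sublevel set by p + L spans
  p + L and has p in its relative interior. L being complex, it contains, near p, the whole circle
  through each of its points.\<close>

lemma complex_slice_of_facial_dirs:
  fixes u :: "complex^'n::finite \<Rightarrow> real"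
  assumes D: "open D" and cont: "continuous_on D u" and sub: "\<And>z v. cball z (norm v) \<subseteq> D \<Longrightarrow> submean u z v"
    and conv: "convex {z \<in> D. u z \<le> u p}" and p: "p \<in> D"
    and L: "vec.subspace L" "L \<subseteq> facial_dirs {z \<in> D. u z \<le> u p} p"
  shows "\<exists>C. complex_dim_convex (vec.dim L) C \<and> C \<subseteq> {z \<in> D. u z = u p} \<and> p \<in> rel_interior C"
proof -
  let ?B = "{z \<in> D. u z \<le> u p}" and ?A = "(+) p ` L"
  have sL: "subspace L" using L(1) by (rule vec_subspace_imp_subspace)
  have pB: "p \<in> ?B" using p by simp
  have aA: "affine ?A" using affine_translation[of L p] subspace_imp_affine[OF sL] by simp
  define C where "C = ?A \<inter> ?B"
  have pC: "p \<in> C" using pB subspace_0[OF sL] by (force simp: C_def)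
  have cC: "convex C" unfolding C_def using affine_imp_convex[OF aA] conv by (rule convex_Int)
  have hullC: "affine hull C \<subseteq> ?A" unfolding C_def using aA by (intro hull_minimal) auto
  have "p \<in> rel_interior C"
  proof (subst convex_rel_interior_iff2[OF cC], use pC in blast, rule ballI)
    fix x assume "x \<in> affine hull C"
    then obtain v where v: "v \<in> L" "x = p + v" using hullC by auto
    then obtain d where d: "d > 0" "p - d *\<^sub>R v \<in> ?B" using L(2) by (auto simp: facial_dirs_def)
    \<comment> \<open>The segment from x through p is prolonged beyond p, in direction -v.\<close>
    have "(1 - (1 + d)) *\<^sub>R x + (1 + d) *\<^sub>R p = p + (- d) *\<^sub>R v" by (simp add: v algebra_simps)
    moreover have "p + (- d) *\<^sub>R v \<in> ?A" using subspace_scale[OF sL v(1), of "- d"] by (rule imageI)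
    ultimately show "\<exists>e>1. (1 - e) *\<^sub>R x + e *\<^sub>R p \<in> C"
      using d unfolding C_def by (intro exI[of _ "1 + d"]) auto
  qed
  then obtain e1 where e1: "e1 > 0" "ball p e1 \<inter> affine hull C \<subseteq> C" by (auto simp: mem_rel_interior_ball)
  obtain e2 where e2: "e2 > 0" "ball p e2 \<subseteq> D" using D p open_contains_ball by blast
  define e where "e = min e1 e2"
  have e: "e > 0" "ball p e \<inter> affine hull C \<subseteq> C" "ball p e \<subseteq> D" using e1 e2 by (auto simp: e_def)
  have "?A \<subseteq> affine hull C"
  proof
    fix x assume "x \<in> ?A"
    then obtain v where v: "v \<in> L" "x = p + v" by auto
    then obtain d where d: "d > 0" "p + d *\<^sub>R v \<in> ?B" using L(2) by (auto simp: facial_dirs_def)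
    then have "p + d *\<^sub>R v \<in> C" unfolding C_def using subspace_scale[OF sL v(1), of d] by auto
    then have "(1 - 1 / d) *\<^sub>R p + (1 / d) *\<^sub>R (p + d *\<^sub>R v) \<in> affine hull C"
      using pC hull_inc[of _ C affine] by (intro mem_affine[OF affine_affine_hull]) auto
    moreover have "(1 - 1 / d) *\<^sub>R p + (1 / d) *\<^sub>R (p + d *\<^sub>R v) = x"
      using d by (simp add: v algebra_simps)
    ultimately show "x \<in> affine hull C" by simp
  qed
  with hullC have hull: "affine hull C = ?A" by blast
  \<comment> \<open>In this ball every point of p + L belongs to C and lies in D, so u is at most u
    p on all circles needed for the maximum principle.\<close>
  let ?C = "C \<inter> ball p e"
  have hull': "affine hull ?C = ?A"
  proof -
    have "C \<inter> ball p e \<noteq> {}" using pC e(1) centre_in_ball by blast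
    then show ?thesis using affine_hull_convex_Int_open[OF cC open_ball] hull by simp
  qed
  have "complex_dim_convex (vec.dim L) ?C"
    unfolding complex_dim_convex_def complex_affine_subspace_def hull' using cC L(1) by (auto intro: convex_Int)
  moreover have "p \<in> rel_interior ?C"
    unfolding mem_rel_interior_ball hull' using pC e hull by auto
  moreover have "?C \<subseteq> {z \<in> D. u z = u p}"
  proof
    fix x assume x: "x \<in> ?C"
    then obtain v where v: "v \<in> L" "x = p + v" by (auto simp: C_def)
    have nv: "norm v < e" using x by (simp add: v(2) dist_norm)
    then have cb: "cball p (norm v) \<subseteq> D" using e(3) by (auto simp: subset_eq)
    have "u (p + cis t *s v) \<le> u p" for t
    proof -
      have "p + cis t *s v \<in> ball p e" using nv by (simp add: dist_norm norm_scaleC)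
      moreover have "p + cis t *s v \<in> affine hull C" unfolding hull using vec.subspace_scale[OF L(1) v(1)] by blast
      ultimately show ?thesis using e(2) by (auto simp: C_def)
    qed
    then have "u (p + v) = u p"
      by (rule constant_on_disc_of_max[OF sub[OF cb] continuous_on_subset[OF cont cb]])
    then show "x \<in> {z \<in> D. u z = u p}" using x by (simp add: C_def v(2))
  qed
  ultimately show ?thesis by blast
qed

section \<open>A pluriharmonic polynomial that separates p from the contact set\<close>

definition tensor :: "complex^'n \<Rightarrow> complex^'n \<Rightarrow> complex^'n^'n" where
  "tensor x y = (\<chi> i j. x $ i * y $ j)"

lemma tensor_simps:
  "tensor (x + x') y = tensor x y + tensor x' y" "tensor x (y + y') = tensor x y + tensor x y'"
  "tensor (c *\<^sub>R x) y = c *\<^sub>R tensor x y" "tensor x (c *\<^sub>R y) = c *\<^sub>R tensor x y"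
  "tensor (\<i> *s x) (\<i> *s y) = - tensor x y"
  by (simp_all add: tensor_def vec_eq_iff complex_eq_iff algebra_simps)

lemma scaleR_complex_nth: "(r *\<^sub>R v) $ m = complex_of_real r * (v $ m)" for v :: "complex^'n"
  by (simp only: vector_scaleR_component) (simp add: scaleR_conv_of_real)

lemma scaleR_tensor_nth: "(r *\<^sub>R tensor x y) $ m $ j = complex_of_real r * (x $ m * y $ j)"
  by (simp only: vector_scaleR_component) (simp add: tensor_def scaleR_conv_of_real)

lemma hermitian_sum: "(\<Sum>j\<in>UNIV. x $ j * cnj (c $ j)) = Complex (x \<bullet> c) (x \<bullet> (\<i> *s c))"
  by (simp add: complex_eq_iff inner_vec_def inner_complex_def)

text \<open>Coefficients of the quadratic polynomial are a functional separating \<open>0\<close> from the convex hull of the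
  points \<open>(x, x \<otimes> x)\<close>. If \<open>0\<close> were the centre of mass of such points, then contracting \<open>\<Sum>\<mu>\<^sub>i x\<^sub>i \<otimes> x\<^sub>i = 0\<close> with
  \<open>cnj c\<close> gives vectors \<open>w\<^sub>1\<close>, \<open>w\<^sub>2\<close> in the face with \<open>w\<^sub>1 + \<i>w\<^sub>2 = 0\<close>, hence \<open>w\<^sub>1 = 0\<close>.\<close>

lemma pluriharmonic_peak:
  fixes B X :: "(complex^'n::finite) set"
  assumes B: "convex B" "p \<in> B" and X: "compact X" "0 \<notin> X" "\<And>x. x \<in> X \<Longrightarrow> p + x \<in> B"
    and F: "\<And>x b. x \<in> X \<Longrightarrow> b \<in> F \<Longrightarrow> x \<bullet> b = 0 \<and> x \<bullet> (\<i> *s b) = 0"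
    and sep: "\<And>v. v \<in> facial_dirs B p \<Longrightarrow> \<i> *s v \<in> facial_dirs B p \<Longrightarrow>
      (\<And>b. b \<in> F \<Longrightarrow> v \<bullet> b = 0 \<and> v \<bullet> (\<i> *s b) = 0) \<Longrightarrow> v = 0"
  shows "\<exists>\<beta> l q. \<beta> > 0 \<and> sym_bilinear q \<and> (\<forall>v w. q (\<i> *s v) (\<i> *s w) = - q v w) \<and> (\<forall>x\<in>X. \<beta> + x \<bullet> l + q x x < 0)"
proof -
  let ?\<Phi> = "\<lambda>x. (x, tensor x x)"
  let ?V = "facial_dirs B p"
  have sV: "subspace ?V" using B by (rule subspace_facial_dirs)
  have "continuous_on X ?\<Phi>" unfolding tensor_def by (intro continuous_intros)
  then have "compact (?\<Phi> ` X)" using X(1) by (rule compact_continuous_image)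
  then have hull: "compact (convex hull (?\<Phi> ` X))" by (rule compact_convex_hull)
  have "0 \<notin> convex hull (?\<Phi> ` X)"
  proof
    assume "0 \<in> convex hull (?\<Phi> ` X)"
    then have "\<exists>k \<mu> y. (\<forall>i\<in>{1..k::nat}. 0 \<le> \<mu> i \<and> y i \<in> ?\<Phi> ` X) \<and> sum \<mu> {1..k} = 1 \<and> (\<Sum>i=1..k. \<mu> i *\<^sub>R y i) = 0"
      unfolding convex_hull_indexed mem_Collect_eq .
    then obtain k :: nat and \<mu> :: "nat \<Rightarrow> real" and y where ky: "\<And>i. i \<in> {1..k} \<Longrightarrow> 0 \<le> \<mu> i \<and> y i \<in> ?\<Phi> ` X"
      "sum \<mu> {1..k} = 1" "(\<Sum>i=1..k. \<mu> i *\<^sub>R y i) = 0" by blast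
    let ?I = "{1..k}"
    define x where "x i = fst (y i)" for i
    have x: "x i \<in> X" "y i = (x i, tensor (x i) (x i))" if "i \<in> ?I" for i
      using ky(1)[OF that] by (auto simp: x_def)
    have sx: "(\<Sum>i\<in>?I. \<mu> i *\<^sub>R x i) = 0"
    proof -
      have "(\<Sum>i\<in>?I. \<mu> i *\<^sub>R x i) = fst (\<Sum>i\<in>?I. \<mu> i *\<^sub>R y i)" by (simp add: fst_sum x_def)
      then show ?thesis using ky(3) by simp
    qed
    have st: "(\<Sum>i\<in>?I. \<mu> i *\<^sub>R tensor (x i) (x i)) = 0"
    proof -
      have "(\<Sum>i\<in>?I. \<mu> i *\<^sub>R tensor (x i) (x i)) = snd (\<Sum>i\<in>?I. \<mu> i *\<^sub>R y i)" by (simp add: snd_sum x(2))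
      then show ?thesis using ky(3) by simp
    qed
    have inV: "x i \<in> ?V" if i: "i \<in> ?I" and l0: "\<mu> i > 0" for i
    proof -
      have l1: "\<mu> i \<le> 1" using member_le_sum[of i ?I \<mu>] i ky(1,2) by auto
      have "p + \<mu> i *\<^sub>R x i \<in> B" using convex_towards[OF B X(3)[OF x(1)[OF i]]] l0 l1 by simp
      moreover have "p - \<mu> i *\<^sub>R x i \<in> B"
      proof -
        \<comment> \<open>Since the weighted sum of all x is 0, p -
          \<open>\<mu> i *\<^sub>R x i\<close> is the same convex combination with the i-th vector
          replaced by 0, hence a point of B.\<close>
        define x' where "x' j = (if j = i then 0 else x j)" for j
        have "(\<Sum>j\<in>?I. \<mu> j *\<^sub>R (p + x' j)) \<in> B"
          using ky(1,2) B X(3) x(1) by (intro convex_sum) (auto simp: x'_def)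
        moreover have "(\<Sum>j\<in>?I. \<mu> j *\<^sub>R (p + x' j)) = p + (\<Sum>j\<in>?I. \<mu> j *\<^sub>R x' j)"
          using ky(2) by (simp add: scaleR_add_right sum.distrib scaleR_sum_left[symmetric])
        moreover have "(\<Sum>j\<in>?I. \<mu> j *\<^sub>R x' j) = (\<Sum>j\<in>?I. \<mu> j *\<^sub>R x j) - \<mu> i *\<^sub>R x i"
        proof -
          have r: "sum f ?I = f i + sum f (?I - {i})" for f :: "nat \<Rightarrow> complex^'n"
            by (rule sum.remove[OF finite_atLeastAtMost i])
          have "(\<Sum>j\<in>?I - {i}. \<mu> j *\<^sub>R x' j) = (\<Sum>j\<in>?I - {i}. \<mu> j *\<^sub>R x j)"
            by (intro sum.cong) (auto simp: x'_def)
          then show ?thesis unfolding r[of "\<lambda>j. \<mu> j *\<^sub>R x' j"] r[of "\<lambda>j. \<mu> j *\<^sub>R x j"] by (simp add: x'_def)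
        qed
        ultimately show ?thesis using sx by simp
      qed
      ultimately show ?thesis using l0 by (auto simp: facial_dirs_def)
    qed
    have inV': "(\<mu> i * c) *\<^sub>R x i \<in> ?V" if "i \<in> ?I" for i c
      using ky(1)[OF that] inV[OF that] subspace_scale[OF sV] subspace_0[OF sV] by (cases "\<mu> i = 0") auto
    have zero: "(\<Sum>i\<in>?I. (\<mu> i * (x i \<bullet> c)) *\<^sub>R x i) = 0" for c
    proof (rule sep)
      let ?w1 = "\<Sum>i\<in>?I. (\<mu> i * (x i \<bullet> c)) *\<^sub>R x i" and ?w2 = "\<Sum>i\<in>?I. (\<mu> i * (x i \<bullet> (\<i> *s c))) *\<^sub>R x i"
      show w1: "?w1 \<in> ?V" by (intro subspace_sum[OF sV] inV')
      have w2: "?w2 \<in> ?V" by (intro subspace_sum[OF sV] inV')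
      \<comment> \<open>The vanishing sum of tensors is contracted with the conjugate of c in its
        second index; \<open>hermitian_sum\<close> splits the contraction into the real weights of
        \<open>?w1\<close> and \<open>?w2\<close>.\<close>
      have "?w1 $ m + \<i> * ?w2 $ m = 0" for m
      proof -
        have "0 = (\<Sum>j\<in>UNIV. (\<Sum>i\<in>?I. \<mu> i *\<^sub>R tensor (x i) (x i)) $ m $ j * cnj (c $ j))" unfolding st by simp
        also have "\<dots> = (\<Sum>j\<in>UNIV. \<Sum>i\<in>?I. complex_of_real (\<mu> i) * (x i $ m) * (x i $ j * cnj (c $ j)))"
          by (simp only: sum_component scaleR_tensor_nth sum_distrib_right mult.assoc)
        also have "\<dots> = (\<Sum>i\<in>?I. \<Sum>j\<in>UNIV. complex_of_real (\<mu> i) * (x i $ m) * (x i $ j * cnj (c $ j)))"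
          by (rule sum.swap)
        also have "\<dots> = (\<Sum>i\<in>?I. complex_of_real (\<mu> i) * (x i $ m) * Complex (x i \<bullet> c) (x i \<bullet> (\<i> *s c)))"
          by (simp add: sum_distrib_left[symmetric] hermitian_sum)
        also have "\<dots> = ?w1 $ m + \<i> * ?w2 $ m"
          by (simp only: sum_component scaleR_complex_nth sum_distrib_left sum.distrib[symmetric] Complex_eq)
            (simp add: algebra_simps)
        finally show ?thesis by simp
      qed
      then have "?w2 $ m = (\<i> *s ?w1) $ m" for m
        by (simp add: vector_smult_component add_eq_0_iff) (metis (no_types, lifting) add_eq_0_iff complex_i_mult_minus minus_equation_iff mult_minus_right)
      then have "\<i> *s ?w1 = ?w2" by (simp add: vec_eq_iff)
      then show "\<i> *s ?w1 \<in> ?V" using w2 by simp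
      fix b assume "b \<in> F"
      then show "?w1 \<bullet> b = 0 \<and> ?w1 \<bullet> (\<i> *s b) = 0" using F x(1) by (simp add: inner_sum_left)
    qed
    \<comment> \<open>Taking c = x j and pairing \<open>zero\<close> with x j gives a vanishing sum
      of nonnegative terms, among them a positive multiple of |x j|^4.\<close>
    obtain j where j: "j \<in> ?I" "\<mu> j \<noteq> 0" using ky(2) by (metis sum.neutral zero_neq_one)
    have "(\<Sum>i\<in>?I. \<mu> i * (x i \<bullet> x j)\<^sup>2) = (\<Sum>i\<in>?I. (\<mu> i * (x i \<bullet> x j)) *\<^sub>R x i) \<bullet> x j"
      by (simp add: inner_sum_left power2_eq_square mult.assoc)
    also have "\<dots> = 0" by (simp only: zero inner_zero_left)
    finally have "\<mu> j * (x j \<bullet> x j)\<^sup>2 = 0"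
      using j(1) ky(1) by (subst (asm) sum_nonneg_eq_0_iff) auto
    then have "x j = 0" using j(2) by simp
    then show False using x(1)[OF j(1)] X(2) by simp
  qed
  then obtain a b where ab: "0 < b" "\<And>y. y \<in> convex hull (?\<Phi> ` X) \<Longrightarrow> a \<bullet> y > b"
    using separating_hyperplane_closed_point[OF convex_convex_hull compact_imp_closed[OF hull], of 0] by auto
  obtain a1 a2 where a: "a = (a1, a2)" by (cases a)
  \<comment> \<open>The separating functional on tensors, symmetrised and negated. It is
    automatically pluriharmonic because rotating both factors by i negates the tensor.\<close>
  define q where "q v w = - (1 / 2) * (a2 \<bullet> tensor v w + a2 \<bullet> tensor w v)" for v w
  have "sym_bilinear q" unfolding sym_bilinear_def q_def
    by (auto intro!: linearI simp: tensor_simps inner_simps algebra_simps add_divide_distrib)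
  moreover have "q (\<i> *s v) (\<i> *s w) = - q v w" for v w by (simp add: q_def tensor_simps field_simps)
  moreover have "b + x \<bullet> (- a1) + q x x < 0" if "x \<in> X" for x
    using ab(2)[OF hull_inc[OF imageI[OF that]]] by (simp add: a q_def inner_commute)
  ultimately show ?thesis using ab(1) by blast
qed

section \<open>Choice of the functionals\<close>

text \<open>A nonzero a in L gives a functional that does not vanish at a, so its zero space in L
  has smaller dimension; iterate.\<close>

lemma separating_vectors:
  fixes L :: "(complex^'n) set"
  assumes "vec.subspace L"
  shows "\<exists>F. finite F \<and> card F \<le> vec.dim L \<and> (\<forall>v\<in>L. (\<forall>b\<in>F. v \<bullet> b = 0 \<and> v \<bullet> (\<i> *s b) = 0) \<longrightarrow> v = 0)"
  using assms
proof (induction "vec.dim L" arbitrary: L rule: less_induct)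
  case less
  show ?case
  proof (cases "L \<subseteq> {0}")
    case True
    then show ?thesis by (intro exI[of _ "{}"]) auto
  next
    case False
    then obtain a where a: "a \<in> L" "a \<noteq> 0" by blast
    define L' where "L' = {v \<in> L. v \<bullet> a = 0 \<and> v \<bullet> (\<i> *s a) = 0}"
    have ia: "(\<i> *s v) \<bullet> a = - (v \<bullet> (\<i> *s a))" "(\<i> *s v) \<bullet> (\<i> *s a) = v \<bullet> a" for v
      by (simp_all add: inner_ii_left ii_scale)
    have sL': "vec.subspace L'"
    proof (rule vec.subspaceI)
      show "0 \<in> L'" using less.prems by (simp add: L'_def vec.subspace_0)
      show "x + y \<in> L'" if "x \<in> L'" "y \<in> L'" for x y
        using that less.prems by (simp add: L'_def vec.subspace_add inner_add_left)
      show "c *s x \<in> L'" if "x \<in> L'" for c x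
      proof -
        have "c *s x \<in> L" using that less.prems by (simp add: L'_def vec.subspace_scale)
        moreover have "(c *s x) \<bullet> w = Re c * (x \<bullet> w) + Im c * ((\<i> *s x) \<bullet> w)" for w
          by (subst complex_scale_real) (simp add: inner_add_left)
        ultimately show ?thesis using that by (simp add: L'_def ia)
      qed
    qed
    have "a \<notin> L'" using a by (simp add: L'_def)
    moreover have "L' \<subseteq> L" by (auto simp: L'_def)
    ultimately have "L' \<subset> L" using a by blast
    then have "vec.span L' \<subset> vec.span L"
      using sL' less.prems by (simp add: vec.span_eq_iff[THEN iffD2])
    then have d: "vec.dim L' < vec.dim L" by (rule vec.dim_psubset)
    obtain F where F: "finite F" "card F \<le> vec.dim L'"
      "\<And>v. v \<in> L' \<Longrightarrow> (\<forall>b\<in>F. v \<bullet> b = 0 \<and> v \<bullet> (\<i> *s b) = 0) \<Longrightarrow> v = 0"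
      using less.hyps[OF d sL'] by blast
    have "card (insert a F) \<le> vec.dim L" using F(1,2) d by (simp add: card_insert_if)
    moreover have "v = 0" if "v \<in> L" "\<forall>b\<in>insert a F. v \<bullet> b = 0 \<and> v \<bullet> (\<i> *s b) = 0" for v
      using that by (intro F(3)) (auto simp: L'_def)
    ultimately show ?thesis using F(1) by (intro exI[of _ "insert a F"]) auto
  qed
qed

lemma orthogonal_span:
  fixes x :: "complex^'n"
  assumes "s \<in> vec.span T" "\<And>b. b \<in> T \<Longrightarrow> x \<bullet> b = 0 \<and> x \<bullet> (\<i> *s b) = 0"
  shows "x \<bullet> s = 0 \<and> x \<bullet> (\<i> *s s) = 0"
  using assms(1)
proof (induction rule: vec.span_induct_alt)
  case base
  then show ?case by (simp add: vec.scale_zero_right)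
next
  case (step c b y)
  have "x \<bullet> (c *s b) = 0" using assms(2)[OF step(1)] by (subst complex_scale_real) (simp add: inner_add_right)
  moreover have "x \<bullet> (\<i> *s (c *s b)) = 0"
  proof -
    have "\<i> *s (c *s b) = (\<i> * c) *s b" by (simp add: vec_eq_iff)
    then show ?thesis using assms(2)[OF step(1)] by (simp only:, subst complex_scale_real) (simp add: inner_add_right inner_diff_right)
  qed
  ultimately show ?case using step by (simp add: inner_add_right vec.scale_right_distrib)
qed

text \<open>A basis of the span of S is placed at the end of the list, where at least n - k places
  remain after dropping k entries. The order matters because only the first k entries will be traded
  for factors dd^c u.\<close>

lemma basis_list_with_tail:
  fixes S :: "(complex^'n) set"
  assumes S: "finite S" "card S \<le> CARD('n) - k" and k: "k \<le> CARD('n)"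
  shows "\<exists>as. distinct as \<and> length as = CARD('n) \<and> vec.span (set as) = UNIV \<and> S \<subseteq> vec.span (set (drop k as))"
proof -
  obtain S0 where S0: "S0 \<subseteq> S" "vec.independent S0" "S \<subseteq> vec.span S0" by (rule vec.maximal_independent_subset) (rule that)
  obtain B where B: "S0 \<subseteq> B" "vec.independent B" "UNIV \<subseteq> vec.span B"
    by (rule vec.maximal_independent_subset_extend[OF subset_UNIV S0(2)]) (rule that)
  have fB: "finite B" using vec.finiteI_independent[OF B(2)] .
  have cB: "card B = CARD('n)"
    using vec.dim_eq_card[of B UNIV] B by (simp add: vec.dim_UNIV card_cart_basis top_unique)
  obtain xs where xs: "set xs = B - S0" "distinct xs" using finite_distinct_list[of "B - S0"] fB by auto
  obtain ys where ys: "set ys = S0" "distinct ys" using finite_distinct_list[of S0] finite_subset[OF S0(1) S(1)] by auto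
  have dist: "distinct (xs @ ys)" and set: "set (xs @ ys) = B" using xs ys B(1) by auto
  have len: "length (xs @ ys) = CARD('n)" using distinct_card[OF dist] set cB by simp
  have "length ys \<le> CARD('n) - k" using distinct_card[OF ys(2)] ys(1) card_mono[OF S(1) S0(1)] S(2) by simp
  then have "k \<le> length xs" using len k by simp
  then have "S0 \<subseteq> set (drop k (xs @ ys))" using ys by auto
  then have "S \<subseteq> vec.span (set (drop k (xs @ ys)))" using S0(3) vec.span_mono by blast
  then show ?thesis using dist len set B(3) by (intro exI[of _ "xs @ ys"]) auto
qed

text \<open>With empty interior p may lie in the relative interior, where no proper support exists;
  then B lies in a hyperplane, whose normal serves.\<close>

lemma supporting_functional:
  fixes B :: "'a::euclidean_space set"
  assumes B: "convex B" "p \<in> B" "p \<notin> interior B"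
  shows "\<exists>a. a \<noteq> 0 \<and> (\<forall>x\<in>B. a \<bullet> x \<le> a \<bullet> p)"
proof (cases "interior B = {}")
  case True
  then obtain a b where "a \<noteq> 0" "B \<subseteq> {x. a \<bullet> x = b}" using empty_interior_subset_hyperplane[OF B(1)] by blast
  then show ?thesis using B(2) by (intro exI[of _ a]) (auto simp: subset_eq)
next
  case False
  then have "rel_interior B = interior B" by (rule rel_interior_nonempty_interior)
  then have "p \<notin> rel_interior B" using B(3) by simp
  then obtain a where "a \<noteq> 0" "\<And>y. y \<in> B \<Longrightarrow> a \<bullet> p \<le> a \<bullet> y"
    by (rule supporting_hyperplane_rel_boundary[OF B(1,2)]) (rule that)
  then show ?thesis by (intro exI[of _ "- a"]) auto
qed

section \<open>Comparison on a shell and exchange of the factors\<close>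

text \<open>The inequality is extended outwards in three steps, each by a constant from
  \<open>compact_domination\<close>: from the contact set K to the part X of the shell where the
  functionals of T vanish, and from X to the full shell Y.\<close>

lemma shell_peak:
  fixes u :: "complex^'n::finite \<Rightarrow> real"
  assumes cont: "continuous_on D u" and p: "p \<in> D"
    and conv: "convex {z \<in> D. u z \<le> u p}"
    and T: "finite T" and \<delta>: "0 < \<delta>\<^sub>1" "cball p \<delta>\<^sub>2 \<subseteq> D"
    and ge: "\<And>x. p + x \<in> D \<Longrightarrow> (\<And>b. b \<in> T \<Longrightarrow> x \<bullet> b = 0 \<and> x \<bullet> (\<i> *s b) = 0) \<Longrightarrow> u p \<le> u (p + x)"
    and sep: "\<And>v. v \<in> facial_dirs {z \<in> D. u z \<le> u p} p \<Longrightarrow> \<i> *s v \<in> facial_dirs {z \<in> D. u z \<le> u p} p \<Longrightarrow>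
      (\<And>b. b \<in> T \<Longrightarrow> v \<bullet> b = 0 \<and> v \<bullet> (\<i> *s b) = 0) \<Longrightarrow> v = 0"
  shows "\<exists>\<beta> l q \<epsilon> M. sym_bilinear q \<and> (\<forall>v w. q (\<i> *s v) (\<i> *s w) = - q v w) \<and> \<epsilon> > 0 \<and> M \<ge> 0 \<and> u p < \<beta> \<and>
     (\<forall>z. \<delta>\<^sub>1 \<le> dist p z \<longrightarrow> dist p z \<le> \<delta>\<^sub>2 \<longrightarrow>
        quad \<beta> l (\<lambda>v w. q v w + \<epsilon> * herm a v w) p z < u z + M * (\<Sum>b\<in>T. herm b (z - p) (z - p)))"
proof -
  define Y where "Y = cball (0 :: complex^'n) \<delta>\<^sub>2 - ball 0 \<delta>\<^sub>1"
  define X where "X = {x \<in> Y. \<forall>b\<in>T. x \<bullet> b = 0 \<and> x \<bullet> (\<i> *s b) = 0}"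
  define K where "K = {x \<in> X. u (p + x) \<le> u p}"
  have Y: "compact Y" unfolding Y_def by (intro compact_diff compact_cball open_ball)
  have inD: "p + x \<in> D" if "x \<in> Y" for x using that \<delta>(2) by (auto simp: Y_def dist_norm subset_eq)
  have "X = Y \<inter> (\<Inter>b\<in>T. {x. x \<bullet> b = 0} \<inter> {x. x \<bullet> (\<i> *s b) = 0})" by (auto simp: X_def)
  moreover have "closed (\<Inter>b\<in>T. {x. x \<bullet> b = 0} \<inter> {x. x \<bullet> (\<i> *s b) = 0})"
    by (intro closed_INT ballI closed_Int closed_Collect_eq continuous_intros)
  ultimately have X: "compact X" by (simp only: compact_Int_closed[OF Y])
  have XY: "X \<subseteq> Y" and KX: "K \<subseteq> X" by (auto simp: X_def K_def)
  have cu: "continuous_on Y (\<lambda>x. u (p + x))"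
    by (rule continuous_on_compose2[OF cont]) (auto intro!: continuous_intros inD)
  have K: "compact K" unfolding K_def
    using continuous_closedin_preimage[OF continuous_on_subset[OF cu XY] closed_atMost[of "u p"]] closedin_compact[OF X]
    by (simp add: vimage_def Int_def)
  have "\<exists>\<beta> l q. \<beta> > 0 \<and> sym_bilinear q \<and> (\<forall>v w. q (\<i> *s v) (\<i> *s w) = - q v w) \<and> (\<forall>x\<in>K. \<beta> + x \<bullet> l + q x x < 0)"
  proof (rule pluriharmonic_peak[OF conv _ K])
    show "p \<in> {z \<in> D. u z \<le> u p}" using p by simp
    show "0 \<notin> K" using \<delta>(1) by (auto simp: K_def X_def Y_def)
    show "p + x \<in> {z \<in> D. u z \<le> u p}" if "x \<in> K" for x using that inD XY KX by (auto simp: K_def)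
    show "x \<bullet> b = 0 \<and> x \<bullet> (\<i> *s b) = 0" if "x \<in> K" "b \<in> T" for x b using that by (auto simp: K_def X_def)
  qed (rule sep)
  then obtain \<beta> l q where q: "\<beta> > 0" "sym_bilinear q" "\<And>v w. q (\<i> *s v) (\<i> *s w) = - q v w"
    and neg: "\<And>x. x \<in> K \<Longrightarrow> \<beta> + x \<bullet> l + q x x < 0" by blast
  have ch: "continuous_on A (\<lambda>x. herm b x x)" for A b unfolding herm_def by (intro continuous_intros)
  have cg: "continuous_on A (\<lambda>x. \<beta> + x \<bullet> l + q x x)" for A
    using continuous_on_smooth_fun[OF smooth_quad[OF q(2), of \<beta> l 0], of A] by (simp add: quad_def)
  \<comment> \<open>Its inverse is a coefficient for the square of the functional of a so small that
    the polynomial stays negative on K.\<close>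
  have "\<exists>M>0. \<forall>x\<in>K. - herm a x x + M * - (\<beta> + x \<bullet> l + q x x) > 0"
  proof (rule compact_domination[OF K])
    show "continuous_on K (\<lambda>x. - herm a x x)" "continuous_on K (\<lambda>x. - (\<beta> + x \<bullet> l + q x x))"
      by (intro continuous_on_minus ch cg)+
    show "0 \<le> - (\<beta> + x \<bullet> l + q x x)" if "x \<in> K" for x using neg[OF that] by linarith
    show "0 < - herm a x x" if "x \<in> K" "- (\<beta> + x \<bullet> l + q x x) = 0" for x using neg[OF that(1)] that(2) by linarith
  qed
  then obtain M1 where M1: "M1 > 0" "\<And>x. x \<in> K \<Longrightarrow> - herm a x x + M1 * - (\<beta> + x \<bullet> l + q x x) > 0" by blast
  define g where "g x = \<beta> + x \<bullet> l + q x x + (1 / M1) * herm a x x" for x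
  have cg': "continuous_on A g" for A unfolding g_def[abs_def] by (intro continuous_intros ch cg)
  have gneg: "g x < 0" if "x \<in> K" for x
  proof -
    have "M1 * g x < 0" using M1(2)[OF that] M1(1) by (simp add: g_def algebra_simps)
    then show ?thesis using M1(1) by (simp add: mult_less_0_iff)
  qed
  \<comment> \<open>On X the difference u(p + x) - u(p) is nonnegative and vanishes only on K, where
    g < 0. So 1/M2 times g lies below it.\<close>
  have "\<exists>M>0. \<forall>x\<in>X. - g x + M * (u (p + x) - u p) > 0"
  proof (rule compact_domination[OF X])
    show "continuous_on X (\<lambda>x. - g x)" by (intro continuous_intros cg')
    show "continuous_on X (\<lambda>x. u (p + x) - u p)" by (intro continuous_intros continuous_on_subset[OF cu XY])
    show "0 \<le> u (p + x) - u p" if "x \<in> X" for x using ge[of x] inD[of x] that by (auto simp: X_def)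
    show "0 < - g x" if "x \<in> X" "u (p + x) - u p = 0" for x using that gneg[of x] by (simp add: K_def)
  qed
  then obtain M2 where M2: "M2 > 0" "\<And>x. x \<in> X \<Longrightarrow> - g x + M2 * (u (p + x) - u p) > 0" by blast
  \<comment> \<open>The penalty vanishes exactly on X, where the inequality holds already.\<close>
  have "\<exists>M>0. \<forall>x\<in>Y. (u (p + x) - u p - (1 / M2) * g x) + M * (\<Sum>b\<in>T. herm b x x) > 0"
  proof (rule compact_domination[OF Y])
    show "continuous_on Y (\<lambda>x. u (p + x) - u p - (1 / M2) * g x)" by (intro continuous_intros cu cg')
    show "continuous_on Y (\<lambda>x. \<Sum>b\<in>T. herm b x x)" by (intro continuous_intros ch)
    show "0 \<le> (\<Sum>b\<in>T. herm b x x)" for x by (intro sum_nonneg herm_nonneg)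
    show "0 < u (p + x) - u p - (1 / M2) * g x" if x: "x \<in> Y" and z: "(\<Sum>b\<in>T. herm b x x) = 0" for x
    proof -
      have "\<forall>b\<in>T. herm b x x = 0" using z T by (subst (asm) sum_nonneg_eq_0_iff) (auto intro: herm_nonneg)
      then have "x \<in> X" using x by (simp add: X_def herm_def add_nonneg_eq_0_iff)
      then show ?thesis using M2(2)[of x] M2(1) by (simp add: field_simps)
    qed
  qed
  then obtain M where M: "M > 0" "\<And>x. x \<in> Y \<Longrightarrow> (u (p + x) - u p - (1 / M2) * g x) + M * (\<Sum>b\<in>T. herm b x x) > 0" by blast
  let ?q = "\<lambda>v w. (1 / M2) * q v w"
  have "sym_bilinear ?q" using sym_bilinear_lincomb[OF q(2) q(2), of "1 / M2" 0] by simp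
  moreover have "\<forall>v w. ?q (\<i> *s v) (\<i> *s w) = - ?q v w" by (simp add: q(3))
  moreover have "1 / (M1 * M2) > 0" "M \<ge> 0" "u p < u p + \<beta> / M2" using M1(1) M2(1) M(1) q(1) by simp_all
  moreover have "quad (u p + \<beta> / M2) ((1 / M2) *\<^sub>R l) (\<lambda>v w. ?q v w + 1 / (M1 * M2) * herm a v w) p z
      < u z + M * (\<Sum>b\<in>T. herm b (z - p) (z - p))" if "\<delta>\<^sub>1 \<le> dist p z" "dist p z \<le> \<delta>\<^sub>2" for z
  proof -
    have "z - p \<in> Y" using that by (simp add: Y_def dist_norm norm_minus_commute)
    from M(2)[OF this] have "u p + (1 / M2) * g (z - p) < u z + M * (\<Sum>b\<in>T. herm b (z - p) (z - p))" by simp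
    moreover have "quad (u p + \<beta> / M2) ((1 / M2) *\<^sub>R l) (\<lambda>v w. ?q v w + 1 / (M1 * M2) * herm a v w) p z = u p + (1 / M2) * g (z - p)"
      by (simp add: quad_def g_def add_divide_distrib)
    ultimately show ?thesis by simp
  qed
  ultimately show ?thesis by blast
qed

lemma ball_integral_pos:
  fixes p :: "'a::euclidean_space"
  assumes \<psi>: "Cc D \<psi>" "\<And>x. 0 \<le> \<psi> x" and s: "0 < s" "\<And>x. dist p x \<le> s \<Longrightarrow> \<psi> x = 1"
  shows "(LINT x|lborel. \<psi> x) > 0"
proof -
  have fin: "emeasure lborel (ball p s) < \<infinity>" using emeasure_lborel_ball_finite[of p s] by (simp add: less_top)
  have "0 < measure lborel (ball p s)" using content_ball_pos[OF s(1), of p] by simp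
  also have "\<dots> = (LINT x|lborel. indicator (ball p s) x)" using fin by simp
  also have "\<dots> \<le> (LINT x|lborel. \<psi> x)"
  proof (rule integral_mono)
    show "integrable lborel (\<lambda>x. indicator (ball p s) x :: real)" using fin by auto
    show "integrable lborel \<psi>" using \<psi>(1) by (rule Cc_integrable)
    show "indicator (ball p s) x \<le> \<psi> x" for x using s(2)[of x] \<psi>(2)[of x] by (simp add: indicator_def)
  qed
  finally show ?thesis .
qed

lemma no_separating_frame:
  fixes D :: "(complex^'n::finite) set"
  assumes D: "open D" and cont: "continuous_on D u" and p: "p \<in> D"
    and sub: "\<And>z v. cball z (norm v) \<subseteq> D \<Longrightarrow> submean u z v"
    and MA: "MA_current D u k (\<lambda>\<phi>. 0)" and k: "k \<le> CARD('n)"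
    and conv: "convex {z \<in> D. u z \<le> u p}"
    and as: "distinct as" "length as = CARD('n)" "vec.span (set as) = UNIV"
    and ge: "\<And>x. p + x \<in> D \<Longrightarrow> (\<And>b. b \<in> set (drop k as) \<Longrightarrow> x \<bullet> b = 0 \<and> x \<bullet> (\<i> *s b) = 0) \<Longrightarrow> u p \<le> u (p + x)"
    and sep: "\<And>v. v \<in> facial_dirs {z \<in> D. u z \<le> u p} p \<Longrightarrow> \<i> *s v \<in> facial_dirs {z \<in> D. u z \<le> u p} p \<Longrightarrow>
      (\<And>b. b \<in> set (drop k as) \<Longrightarrow> v \<bullet> b = 0 \<and> v \<bullet> (\<i> *s b) = 0) \<Longrightarrow> v = 0"
  shows False
proof -
  let ?n = "CARD('n)"
  \<comment> \<open>\<open>P m\<close> says that (dd^c u)^m wedged with the last n - m elementary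
    forms vanishes near p. The range [0, 1] of the test functions lets them be subtracted from the
    plateau cutoff of \<open>descent_step\<close>.\<close>
  define P where "P m S \<delta> \<longleftrightarrow> MA_current D u m S \<and> 0 < \<delta> \<and> cball p \<delta> \<subseteq> D \<and>
     (\<forall>\<psi>. test_fun (ball p \<delta>) \<psi> \<longrightarrow> (\<forall>x. 0 \<le> \<psi> x \<and> \<psi> x \<le> 1) \<longrightarrow> S (cform \<psi> (sigs (drop m as))) = 0)" for m S \<delta>
  have sub': "submean u z v" if "\<And>y. dist z y \<le> norm v \<Longrightarrow> y \<in> D" for z v
    using that by (intro sub) auto
  obtain \<delta>\<^sub>0 where \<delta>\<^sub>0: "\<delta>\<^sub>0 > 0" "cball p \<delta>\<^sub>0 \<subseteq> D" using D p open_contains_cball by blast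
  have step: "\<exists>S \<delta>. P m S \<delta>" if m: "Suc m \<le> k" and PS: "P (Suc m) T \<delta>" for m T \<delta>
  proof -
    let ?as = "drop (Suc m) as"
    from PS obtain S where S: "MA_current D u m S" and
      TS: "\<And>\<phi>. \<phi> \<in> smooth_test_forms D (2 * (?n - Suc m)) \<Longrightarrow> T \<phi> = S (\<lambda>z vs. u z * ddc \<phi> z vs)"
      and \<delta>: "\<delta> > 0" "cball p \<delta> \<subseteq> D"
      and T0: "\<And>\<psi>. test_fun (ball p \<delta>) \<psi> \<Longrightarrow> (\<And>x. 0 \<le> \<psi> x \<and> \<psi> x \<le> 1) \<Longrightarrow> T (cform \<psi> (sigs ?as)) = 0"
      by (auto simp: P_def)
    have len: "length ?as = ?n - Suc m" using as(2) by simp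
    have dm: "drop m as = as ! m # ?as" using as(2) m k by (simp add: Cons_nth_drop_Suc)
    have bD: "ball p \<delta> \<subseteq> D" using \<delta>(2) ball_subset_cball by blast
    have pS: "pos_closed D (Suc (length ?as)) S"
      using pos_closed_MA_current[OF D cont sub' _ S] m k len by (simp add: Suc_diff_Suc)
    have zero: "S (fddc u \<psi> (sigs ?as)) = 0"
      if \<psi>: "test_fun (ball p \<delta>) \<psi>" "\<And>x. 0 \<le> \<psi> x \<and> \<psi> x \<le> 1" for \<psi>
    proof -
      have "test_fun D \<psi>" using \<psi>(1) bD unfolding test_fun_def by (meson Cc_mono)
      then have "(cform \<psi> (sigs ?as)) \<in> smooth_test_forms D (2 * (?n - Suc m))"
        using alternating_sigs[of ?as] len by (intro form_in_smooth_test_forms) auto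
      from TS[OF this] T0[OF \<psi>] show ?thesis by simp
    qed
    have cb: "cball p (\<delta> / 2) \<subseteq> D" using \<delta> by (auto simp: subset_eq)
    have d4: "0 < \<delta> / 4" using \<delta> by simp
    from shell_peak[OF cont p conv finite_set d4 cb ge sep, where a = "as ! m"]
    obtain \<beta> l q \<epsilon> M where pk: "sym_bilinear q" "\<forall>v w. q (\<i> *s v) (\<i> *s w) = - q v w" "\<epsilon> > 0" "M \<ge> 0" "u p < \<beta>"
      "\<forall>z. \<delta> / 4 \<le> dist p z \<longrightarrow> dist p z \<le> \<delta> / 2 \<longrightarrow>
        quad \<beta> l (\<lambda>v w. q v w + \<epsilon> * herm (as ! m) v w) p z < u z + M * (\<Sum>b\<in>set (drop k as). herm b (z - p) (z - p))"
      by blast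
    have "\<exists>\<eta>>0. \<eta> \<le> \<delta> \<and> (\<forall>\<psi>. test_fun (ball p \<eta>) \<psi> \<longrightarrow> (\<forall>x. 0 \<le> \<psi> x \<and> \<psi> x \<le> 1) \<longrightarrow>
      S (cform \<psi> (sigs (as ! m # ?as))) = 0)"
    proof (rule descent_step[where \<delta>\<^sub>2 = "\<delta> / 2" and q = q and \<epsilon> = \<epsilon> and M = M and l = l and \<beta> = \<beta>, OF pS D cont sub zero d4 _ _ bD pk(1)])
      \<comment> \<open>As m < k, all functionals in the penalty are factors of
        \<open>sigs ?as\<close>, as its annihilation requires.\<close>
      show "set (drop k as) \<subseteq> set ?as" using m by (rule set_drop_subset_set_drop)
    qed (use \<delta> pk in auto)
    then obtain \<eta> where "\<eta> > 0" "\<eta> \<le> \<delta>" "\<forall>\<psi>. test_fun (ball p \<eta>) \<psi> \<longrightarrow> (\<forall>x. 0 \<le> \<psi> x \<and> \<psi> x \<le> 1) \<longrightarrow>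
      S (cform \<psi> (sigs (as ! m # ?as))) = 0" by blast
    then have "P m S \<eta>" unfolding P_def dm using S \<delta>(2) subset_cball[of \<eta> \<delta> p] by blast
    then show ?thesis by blast
  qed
  have "\<exists>S \<delta>. P (k - j) S \<delta>" if "j \<le> k" for j
    using that
  proof (induction j)
    case 0
    have "P k (\<lambda>\<phi>. 0) \<delta>\<^sub>0" using MA \<delta>\<^sub>0 by (simp add: P_def)
    then show ?case by auto
  next
    case (Suc j)
    then obtain S \<delta> where "P (Suc (k - Suc j)) S \<delta>" by (auto simp: Suc_diff_Suc)
    then show ?case using step[of "k - Suc j"] Suc.prems by simp
  qed
  from this[of k] obtain S \<delta> where S: "P 0 S \<delta>" by auto
  then have "\<delta> > 0" by (simp add: P_def)
  then obtain \<psi> where \<psi>: "test_fun (ball p \<delta>) \<psi>" "\<And>x. 0 \<le> \<psi> x \<and> \<psi> x \<le> 1" "\<And>x. dist p x \<le> \<delta> / 2 \<Longrightarrow> \<psi> x = 1"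
    using smooth_plateau[of "\<delta> / 2" \<delta> p] by auto
  have \<psi>D: "Cc D \<psi>" using \<psi>(1) S ball_subset_cball unfolding P_def test_fun_def by (meson Cc_mono subset_trans)
  have "0 = S (cform \<psi> (sigs as))" using S \<psi>(1,2) by (simp add: P_def)
  also have "\<dots> = integrate_top_form (cform \<psi> (sigs as))"
    using S \<psi>D alternating_sigs[of as] as(2) by (auto simp: P_def intro!: form_in_cont_test_forms)
  also have "\<dots> = (LINT z|lborel. \<psi> z) * sigs as std_frame" by (simp add: integrate_top_form_def)
  also have "\<dots> > 0"
  proof (rule mult_pos_pos)
    show "(LINT z|lborel. \<psi> z) > 0"
      by (rule ball_integral_pos[where p = p and s = "\<delta> / 2", OF \<psi>D _ _ \<psi>(3)]) (use \<psi>(2) \<open>\<delta> > 0\<close> in auto)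
    show "sigs as std_frame > 0" by (rule sigs_std_frame_pos[OF as])
  qed
  finally show False by simp
qed

theorem theorem1:
  fixes D :: "(complex^'n::finite) set" and u :: "complex^'n \<Rightarrow> real" and k :: nat and r :: real
  assumes "open D" and "connected D" and "D \<noteq> {}"
    and "plurisubharmonic_on D (\<lambda>z. ereal (u z))" and "continuous_on D u"
    and "1 \<le> k" and "k \<le> CARD('n) - 1"
    and "MA_current D u k (\<lambda>\<phi>. 0)"
    and "convex {z \<in> D. u z \<le> r}"
  shows "\<forall>p \<in> {z \<in> D. u z = r}. \<exists>C. complex_dim_convex (CARD('n) - k) C \<and>
           C \<subseteq> {z \<in> D. u z = r} \<and> p \<in> rel_interior C"
proof
  fix p assume "p \<in> {z \<in> D. u z = r}"
  then have p: "p \<in> D" and r: "r = u p" by auto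
  let ?B = "{z \<in> D. u z \<le> u p}" and ?n = "CARD('n)"
  have conv: "convex ?B" using assms(9) r by simp
  have pB: "p \<in> ?B" using p by simp
  have sub: "submean u z v" if "cball z (norm v) \<subseteq> D" for z v
    using that by (intro submean_of_plurisubharmonic[OF assms(4,5)]) auto
  define L where "L = {v \<in> facial_dirs ?B p. \<i> *s v \<in> facial_dirs ?B p}"
  have sV: "subspace (facial_dirs ?B p)" using conv pB by (rule subspace_facial_dirs)
  have L: "vec.subspace L"
  proof (rule vec.subspaceI)
    show "0 \<in> L" using subspace_0[OF sV] by (simp add: L_def)
    show "x + y \<in> L" if "x \<in> L" "y \<in> L" for x y
      using that subspace_add[OF sV] by (simp add: L_def vec.scale_right_distrib)
    show "c *s x \<in> L" if "x \<in> L" for c x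
    proof -
      have "\<i> *s (c *s x) = Re c *\<^sub>R (\<i> *s x) + Im c *\<^sub>R (- x)"
        by (simp add: vec_eq_iff complex_eq_iff)
      moreover have "c *s x = Re c *\<^sub>R x + Im c *\<^sub>R (\<i> *s x)" by (rule complex_scale_real)
      ultimately show ?thesis
        using that subspace_add[OF sV] subspace_scale[OF sV] subspace_neg[OF sV] unfolding L_def by (simp del: scaleR_minus_right)
    qed
  qed
  show "\<exists>C. complex_dim_convex (?n - k) C \<and> C \<subseteq> {z \<in> D. u z = r} \<and> p \<in> rel_interior C"
  proof (cases "?n - k \<le> vec.dim L")
    case True
    obtain A where A: "A \<subseteq> L" "vec.independent A" "L \<subseteq> vec.span A" "card A = vec.dim L"
      by (rule vec.basis_exists) (rule that)
    have "?n - k \<le> card A" using True A(4) by simp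
    then obtain A' where A': "A' \<subseteq> A" "card A' = ?n - k" by (rule obtain_subset_with_card_n) (rule that)
    have "vec.independent A'" using A(2) A'(1) by (rule vec.independent_mono)
    then have dim: "vec.dim (vec.span A') = ?n - k" using A'(2) by (simp add: vec.dim_span vec.dim_eq_card_independent)
    have "vec.span A' \<subseteq> L" using A(1) A'(1) L by (intro vec.span_minimal) auto
    then have "vec.span A' \<subseteq> facial_dirs ?B p" by (auto simp: L_def)
    from complex_slice_of_facial_dirs[OF assms(1,5) sub conv p vec.subspace_span this]
    show ?thesis by (simp only: dim r)
  next
    case False
    obtain F where F: "finite F" "card F \<le> vec.dim L" "\<And>v. v \<in> L \<Longrightarrow> (\<forall>b\<in>F. v \<bullet> b = 0 \<and> v \<bullet> (\<i> *s b) = 0) \<Longrightarrow> v = 0"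
      using separating_vectors[OF L] by blast
    \<comment> \<open>At an interior point every direction would be facial and L the whole space,
      contrary to the case assumption.\<close>
    have "p \<notin> interior ?B"
    proof
      assume "p \<in> interior ?B"
      then obtain e where e: "e > 0" "ball p e \<subseteq> ?B" using mem_interior by blast
      have "v \<in> facial_dirs ?B p" for v
      proof -
        define d where "d = e / (norm v + 1)"
        have nv: "norm v + 1 > 0" using norm_ge_zero[of v] by linarith
        have "d > 0" unfolding d_def using e(1) nv by simp
        moreover have "d * norm v < e"
        proof -
          have "d * norm v < d * (norm v + 1)" using \<open>d > 0\<close> by simp
          also have "\<dots> = e" unfolding d_def using nv by simp
          finally show ?thesis .
        qed
        then have "p + d *\<^sub>R v \<in> ball p e" "p - d *\<^sub>R v \<in> ball p e" using \<open>d > 0\<close> by (simp_all add: dist_norm)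
        ultimately show ?thesis using e(2) unfolding facial_dirs_def by blast
      qed
      then have "L = UNIV" by (auto simp: L_def)
      then show False using False by (simp add: vec.dim_UNIV card_cart_basis)
    qed
    then obtain a where a: "a \<noteq> 0" "\<And>x. x \<in> ?B \<Longrightarrow> a \<bullet> x \<le> a \<bullet> p" using supporting_functional[OF conv pB] by blast
    have kn: "k \<le> ?n" using assms(7) by linarith
    \<comment> \<open>Since F has at most dim L < n - k elements, there is room for one more
      functional, the supporting one.\<close>
    have "card (insert a F) \<le> ?n - k" using F(1,2) False by (simp add: card_insert_if)
    then obtain as where as: "distinct as" "length as = ?n" "vec.span (set as) = UNIV" "insert a F \<subseteq> vec.span (set (drop k as))"
      using basis_list_with_tail[of "insert a F" k] F(1) kn by auto
    have False
    proof (rule no_separating_frame[OF assms(1,5) p sub assms(8) _ conv as(1-3)])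
      show "k \<le> ?n" by (rule kn)
    next
      fix x assume x: "p + x \<in> D" "\<And>b. b \<in> set (drop k as) \<Longrightarrow> x \<bullet> b = 0 \<and> x \<bullet> (\<i> *s b) = 0"
      have ax: "a \<bullet> x = 0" using orthogonal_span[of a _ x, OF _ x(2)] as(4) by (auto simp: inner_commute)
      show "u p \<le> u (p + x)"
      \<comment> \<open>The point p + x lies on the supporting hyperplane; pushed slightly along a
        it leaves the sublevel set, so u exceeds u p there, and continuity gives the weak inequality
        in the limit.\<close>
      proof (rule tendsto_lowerbound)
        have "isCont u (p + x)" using assms(1,5) x(1) by (simp add: continuous_on_eq_continuous_at)
        moreover have "((\<lambda>t. p + x + t *\<^sub>R a) \<longlongrightarrow> p + x + 0 *\<^sub>R a) (at_right 0)" by (intro tendsto_intros)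
        ultimately show "((\<lambda>t. u (p + x + t *\<^sub>R a)) \<longlongrightarrow> u (p + x)) (at_right 0)"
          using isCont_tendsto_compose by fastforce
        have "eventually (\<lambda>t. p + x + t *\<^sub>R a \<in> D) (at_right (0::real))"
        proof (rule topological_tendstoD)
          show "((\<lambda>t. p + x + t *\<^sub>R a) \<longlongrightarrow> p + x) (at_right 0)"
            using \<open>((\<lambda>t. p + x + t *\<^sub>R a) \<longlongrightarrow> p + x + 0 *\<^sub>R a) (at_right 0)\<close> by simp
        qed (use assms(1) x(1) in auto)
        moreover have "eventually (\<lambda>t. t > 0) (at_right (0::real))" by (rule eventually_at_right_less)
        ultimately show "eventually (\<lambda>t. u p \<le> u (p + x + t *\<^sub>R a)) (at_right 0)"
        proof eventually_elim
          case (elim t)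
          have "a \<bullet> (p + x + t *\<^sub>R a) > a \<bullet> p" using elim(2) a(1) by (simp add: inner_add_right ax)
          then show ?case using a(2)[of "p + x + t *\<^sub>R a"] elim(1) by force
        qed
      qed simp
    next
      fix v assume v: "v \<in> facial_dirs ?B p" "\<i> *s v \<in> facial_dirs ?B p"
        "\<And>b. b \<in> set (drop k as) \<Longrightarrow> v \<bullet> b = 0 \<and> v \<bullet> (\<i> *s b) = 0"
      show "v = 0"
      proof (rule F(3))
        show "v \<in> L" using v(1,2) by (simp add: L_def)
        show "\<forall>b\<in>F. v \<bullet> b = 0 \<and> v \<bullet> (\<i> *s b) = 0" using orthogonal_span[OF _ v(3)] as(4) by blast
      qed
    qed
    then show ?thesis ..
  qed
qed

end
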